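(* For every integer $k\ge 2$, the class $\mathsf{FUL}_k$ is low for $\mathsf{Mod}_k\mathsf L$, for $\mathsf{coMod}_k\mathsf L$, for $\#_k\mathsf L$, and for $\mathsf{FUL}_k$ itself.
   Context: $\#\mathsf{L}$ is the class of functions $\varphi:\Sigma^\ast\to\mathbb N$ (with $\Sigma$ a finite alphabet) such that $\varphi(x)$ is the number of accepting computation branches on input $x$ of some nondeterministic logarithmic-space Turing machine all of whose branches halt (in polynomial time). $\mathsf{coMod}_k\mathsf L$ (respectively $\mathsf{Mod}_k\mathsf L$) is the class of languages $L$ for which there exists $\varphi\in\#\mathsf L$ such that $x\in L$ if and only if $\varphi(x)\equiv 0\pmod k$ (respectively $\varphi(x)\not\equiv 0\pmod k$). $\#_k\mathsf L$ is the class of functions $f:\Sigma^\ast\to\{0,1,\dots,k-1\}$ for which there exists $\varphi\in\#\mathsf L$ with $f(x)\equiv\varphi(x)\pmod k$ for all $x$. An $\mathsf{FUL}_k$ machine computing a (partial) function $f:\Sigma^\ast\rightharpoonup\Sigma^\ast$ is a nondeterministic logspace Turing machine, with an output tape, which (a) for inputs $x\in\operatorname{dom}(f)$ computes $f(x)$ on its output tape in some number $\varphi(x,f(x))\equiv 1\pmod k$ of its accepting branches, and (b) for each $y\ne f(x)$ (or for any string $y$, in the case $x\notin\operatorname{dom}(f)$) computes $y$ on its output tape on some number $\varphi(x,y)\equiv 0\pmod k$ of its accepting branches. $\mathsf{FUL}_k$ is the class of (partial) functions $f$ computed by some $\mathsf{FUL}_k$ machine. A function class $\mathcal F$ is low for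 a class $\mathcal C$ if $\mathcal C^{\mathcal F}=\mathcal C$, where $\mathcal C^{\mathcal F}$ is defined as $\mathcal C$ but with machines having access to an oracle evaluating a function $f\in\mathcal F$ (returning $f(q)$ on query $q\in\operatorname{dom}(f)$). Oracle access for nondeterministic logspace machines is in the Ruzzo–Simon–Tompa model: the machine makes no nondeterministic transitions while it writes on the oracle tape, i.e. each oracle query is determined by the contents of the input and work tapes before the query has started being written. *)

theory Defs
  imports Complex_Main "HOL-Number_Theory.Cong"
begin

section \<open>Nondeterministic Turing machines with output tape and oracle tape\<close>

text \<open>
  A machine has a two-way read-only input tape, finitely many two-way read/write work tapes that
  are infinite to the right, a one-way write-only output tape, and an oracle tape.
  The alphabet of the input, of the output, of the queries and of the answers is the finite
  type \<open>'a\<close>; the states and the work symbols are elements of finite sets.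
\<close>

datatype move = MLeft | MStay | MRight

fun mv :: "move \<Rightarrow> nat \<Rightarrow> nat" where
  "mv MLeft p = p - 1"
| "mv MStay p = p"
| "mv MRight p = p + 1"

text \<open>
  A read-only tape with contents \<open>w\<close> carries end markers at the positions \<open>0\<close> and
  \<open>length w + 1\<close>, which its head does not leave.
\<close>

datatype 'a cell = LeftEnd | Letter 'a | RightEnd

definition read_cell :: "'a list \<Rightarrow> nat \<Rightarrow> 'a cell" where
  "read_cell w p = (if p = 0 then LeftEnd
                    else if p \<le> length w then Letter (w ! (p - 1)) else RightEnd)"

definition mv_within :: "'a list \<Rightarrow> move \<Rightarrow> nat \<Rightarrow> nat" where
  "mv_within w d p = min (mv d p) (length w + 1)"

text \<open>
  The oracle tape either holds an answer, which can be read but not modified, or a query under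
  construction, which can be extended but not read. Opening a new query erases the previous
  answer, so that a query cannot be copied from that answer while it is being written.
\<close>

datatype 'a otape = Answer "'a list" nat | Query "'a list"

datatype 'a ocmd = OIdle | OMove move | OOpen | OWrite 'a | OAsk

type_synonym 'a pfun = "'a list \<Rightarrow> 'a list option"

fun read_oracle :: "'a otape \<Rightarrow> 'a cell" where
  "read_oracle (Answer y p) = read_cell y p"
| "read_oracle (Query w) = LeftEnd"

text \<open>
  The result \<open>None\<close> means that the command cannot be carried out. In particular a query
  outside the domain of the oracle is not answered: the branch ends there, without accepting.
\<close>

fun oracle_step :: "'a pfun \<Rightarrow> 'a ocmd \<Rightarrow> 'a otape \<Rightarrow> 'a otape option" where
  "oracle_step f OIdle t = Some t"
| "oracle_step f (OMove d) (Answer y p) = Some (Answer y (mv_within y d p))"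
| "oracle_step f OOpen (Answer y p) = Some (Query [])"
| "oracle_step f (OWrite a) (Query w) = Some (Query (w @ [a]))"
| "oracle_step f OAsk (Query w) = map_option (\<lambda>y. Answer y 0) (f w)"
| "oracle_step f _ _ = None"

record ('q, 'g, 'a) action =
  new_state :: 'q
  in_move :: move
  work_acts :: "('g \<times> move) list"
  emit :: "'a option"
  ocmd :: "'a ocmd"

record ('q, 'g, 'a) ntm =
  states :: "'q set"
  symbols :: "'g set"
  blank :: 'g
  tapes :: nat
  start :: 'q
  accept :: "'q set"
  delta :: "'q \<Rightarrow> 'a cell \<Rightarrow> 'g list \<Rightarrow> 'a cell \<Rightarrow> ('q, 'g, 'a) action set"

definition wf_ntm :: "('q, 'g, 'a) ntm \<Rightarrow> bool" where
  "wf_ntm M \<longleftrightarrow>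
     finite (states M) \<and> finite (symbols M) \<and> blank M \<in> symbols M \<and>
     start M \<in> states M \<and> accept M \<subseteq> states M \<and>
     (\<forall>q i gs z. q \<in> accept M \<longrightarrow> delta M q i gs z = {}) \<and>
     (\<forall>q i gs z a. q \<in> states M \<and> length gs = tapes M \<and> set gs \<subseteq> symbols M \<and>
          a \<in> delta M q i gs z \<longrightarrow>
        new_state a \<in> states M \<and> length (work_acts a) = tapes M \<and>
        fst ` set (work_acts a) \<subseteq> symbols M)"

definition oracle_free :: "('q, 'g, 'a) ntm \<Rightarrow> bool" where
  "oracle_free M \<longleftrightarrow> (\<forall>q i gs z. \<forall>a \<in> delta M q i gs z. ocmd a = OIdle)"

record ('q, 'g, 'a) config =
  cstate :: 'q
  in_pos :: nat
  work :: "((nat \<Rightarrow> 'g) \<times> nat) list"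
  out :: "'a list"
  otape :: "'a otape"

definition init_config :: "('q, 'g, 'a) ntm \<Rightarrow> ('q, 'g, 'a) config" where
  "init_config M = \<lparr> cstate = start M, in_pos = 0,
     work = replicate (tapes M) (\<lambda>_. blank M, 0), out = [], otape = Answer [] 0 \<rparr>"

definition choices ::
    "('q, 'g, 'a) ntm \<Rightarrow> 'a list \<Rightarrow> ('q, 'g, 'a) config \<Rightarrow> ('q, 'g, 'a) action set" where
  "choices M x c = delta M (cstate c) (read_cell x (in_pos c))
     (map (\<lambda>(t, p). t p) (work c)) (read_oracle (otape c))"

definition perform ::
    "'a pfun \<Rightarrow> 'a list \<Rightarrow> ('q, 'g, 'a) action \<Rightarrow> ('q, 'g, 'a) config
      \<Rightarrow> ('q, 'g, 'a) config option" where
  "perform f x a c = map_option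
     (\<lambda>t. \<lparr> cstate = new_state a,
            in_pos = mv_within x (in_move a) (in_pos c),
            work = map2 (\<lambda>(s, d) (t, p). (t(p := s), mv d p)) (work_acts a) (work c),
            out = out c @ (case emit a of None \<Rightarrow> [] | Some b \<Rightarrow> [b]),
            otape = t \<rparr>)
     (oracle_step f (ocmd a) (otape c))"

text \<open>A computation branch is identified with the sequence of actions chosen along it.\<close>

fun run ::
    "'a pfun \<Rightarrow> ('q, 'g, 'a) ntm \<Rightarrow> 'a list \<Rightarrow> ('q, 'g, 'a) config
      \<Rightarrow> ('q, 'g, 'a) action list \<Rightarrow> ('q, 'g, 'a) config option" where
  "run f M x c [] = Some c"
| "run f M x c (a # as) =
     (if a \<in> choices M x c then Option.bind (perform f x a c) (\<lambda>c'. run f M x c' as) else None)"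

definition reachable ::
    "'a pfun \<Rightarrow> ('q, 'g, 'a) ntm \<Rightarrow> 'a list \<Rightarrow> ('q, 'g, 'a) config \<Rightarrow> bool" where
  "reachable f M x c \<longleftrightarrow> (\<exists>as. run f M x (init_config M) as = Some c)"

definition accepting_branches ::
    "'a pfun \<Rightarrow> ('q, 'g, 'a) ntm \<Rightarrow> 'a list \<Rightarrow> ('q, 'g, 'a) action list set" where
  "accepting_branches f M x =
     {as. \<exists>c. run f M x (init_config M) as = Some c \<and> cstate c \<in> accept M}"

definition accepting_branches_with_output ::
    "'a pfun \<Rightarrow> ('q, 'g, 'a) ntm \<Rightarrow> 'a list \<Rightarrow> 'a list \<Rightarrow> ('q, 'g, 'a) action list set" where
  "accepting_branches_with_output f M x y =
     {as. \<exists>c. run f M x (init_config M) as = Some c \<and> cstate c \<in> accept M \<and> out c = y}"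


section \<open>Logarithmic space, polynomial time, and the Ruzzo--Simon--Tompa condition\<close>

definition halts_in_poly_time :: "'a pfun \<Rightarrow> ('q, 'g, 'a) ntm \<Rightarrow> bool" where
  "halts_in_poly_time f M \<longleftrightarrow>
     (\<exists>c d. \<forall>x as. run f M x (init_config M) as \<noteq> None \<longrightarrow> length as \<le> c * length x ^ d + c)"

text \<open>
  Only work tapes count as space. The cells in use are those up to the rightmost head position;
  adding 2 to the length of the input makes the logarithm positive.
\<close>

definition runs_in_log_space :: "'a pfun \<Rightarrow> ('q, 'g, 'a) ntm \<Rightarrow> bool" where
  "runs_in_log_space f M \<longleftrightarrow>
     (\<exists>b::real. \<forall>x c. reachable f M x c \<longrightarrow>
        (\<forall>(t, p) \<in> set (work c). real p \<le> b * log 2 (real (length x) + 2)))"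

text \<open>
  As the old answer is erased when a query is opened, the query that is then written without
  nondeterminism depends only on the control state, the input tape and the work tapes at that
  moment.
\<close>

definition deterministic_queries :: "'a pfun \<Rightarrow> ('q, 'g, 'a) ntm \<Rightarrow> bool" where
  "deterministic_queries f M \<longleftrightarrow>
     (\<forall>x c w. reachable f M x c \<and> otape c = Query w \<longrightarrow>
        (\<forall>a \<in> choices M x c. \<forall>b \<in> choices M x c. a = b))"

text \<open>
  An argument of type \<open>'a pfun option\<close> says whether there is oracle access:
  \<open>None\<close> stands for machines without an oracle, \<open>Some f\<close> for machines with an oracle
  evaluating the partial function \<open>f\<close>.
\<close>

fun oracle_of :: "'a pfun option \<Rightarrow> 'a pfun" where
  "oracle_of None = Map.empty"
| "oracle_of (Some f) = f"

definition logspace_ntm :: "'a pfun option \<Rightarrow> ('q, 'g, 'a) ntm \<Rightarrow> bool" where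
  "logspace_ntm Q M \<longleftrightarrow>
     wf_ntm M \<and> (Q = None \<longrightarrow> oracle_free M) \<and>
     halts_in_poly_time (oracle_of Q) M \<and> runs_in_log_space (oracle_of Q) M \<and>
     deterministic_queries (oracle_of Q) M"


section \<open>The classes\<close>

text \<open>
  States and work symbols are taken to be natural numbers, which is no restriction since there
  are only finitely many of them.
\<close>

definition SharpL :: "'a::finite pfun option \<Rightarrow> ('a list \<Rightarrow> nat) set" where
  "SharpL Q = {\<phi>. \<exists>M :: (nat, nat, 'a) ntm. logspace_ntm Q M \<and>
     (\<forall>x. \<phi> x = card (accepting_branches (oracle_of Q) M x))}"

definition ModL :: "nat \<Rightarrow> 'a::finite pfun option \<Rightarrow> 'a list set set" where
  "ModL k Q = {L. \<exists>\<phi> \<in> SharpL Q. \<forall>x. x \<in> L \<longleftrightarrow> \<not> [\<phi> x = 0] (mod k)}"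

definition coModL :: "nat \<Rightarrow> 'a::finite pfun option \<Rightarrow> 'a list set set" where
  "coModL k Q = {L. \<exists>\<phi> \<in> SharpL Q. \<forall>x. x \<in> L \<longleftrightarrow> [\<phi> x = 0] (mod k)}"

definition SharpModL :: "nat \<Rightarrow> 'a::finite pfun option \<Rightarrow> ('a list \<Rightarrow> nat) set" where
  "SharpModL k Q = {f. (\<forall>x. f x < k) \<and> (\<exists>\<phi> \<in> SharpL Q. \<forall>x. [f x = \<phi> x] (mod k))}"

definition FUL :: "nat \<Rightarrow> 'a::finite pfun option \<Rightarrow> 'a pfun set" where
  "FUL k Q = {f. \<exists>M :: (nat, nat, 'a) ntm. logspace_ntm Q M \<and>
     (\<forall>x y. (f x = Some y \<longrightarrow>
               [card (accepting_branches_with_output (oracle_of Q) M x y) = 1] (mod k)) \<and>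
            (f x \<noteq> Some y \<longrightarrow>
               [card (accepting_branches_with_output (oracle_of Q) M x y) = 0] (mod k)))}"

definition low_for :: "'a pfun set \<Rightarrow> ('a pfun option \<Rightarrow> 'c set) \<Rightarrow> bool" where
  "low_for F C \<longleftrightarrow> (\<Union>f \<in> F. C (Some f)) = C None"

end

theory Submission
  imports Defs
begin

text \<open>
  Let \<open>f\<close> be computed by an \<open>FUL\<^sub>k\<close> machine \<open>F\<close>, and let \<open>M\<close> be a machine with oracle \<open>f\<close>.
  The simulation of \<open>M\<close> stores neither queries nor answers. When \<open>M\<close> opens a query, its state,
  head positions and work tapes are saved; the query is determined by them, so any of its symbols can
  be recomputed by rerunning \<open>M\<close> from the saved configuration. Whenever \<open>M\<close> needs the cell of
  the answer at position \<open>p\<close>, the machine \<open>F\<close> is run on the recomputed query, and only the symbol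
  that it outputs at position \<open>p\<close> is kept. Modulo \<open>k\<close>, the number of accepting runs of \<open>F\<close>
  that yield a given symbol is 1 for the correct symbol and 0 for all others. As the scratch space is
  cleared afterwards, all runs that yield the same symbol continue identically, so the branches with a
  wrong symbol contribute 0 modulo \<open>k\<close>, whatever happens on them, provided that they halt. For
  this reason the simulation is written in a language whose loops are all clocked; its programs have a
  weight transformer semantics and are compiled into logspace machines with polynomially
  bounded running time.
\<close>

text \<open>Four clocks are nested: steps of \<open>M\<close>, steps of \<open>F\<close>, symbols of
  the replayed query, moves of the input head. All loops share one bound \<open>2 ^ S\<close>, with
  \<open>S\<close> equal to \<open>b\<close> times roughly the binary length of the input length n.
  This is polynomial in n, and the constant \<open>b\<close> is fixed only once the time exponents
  and space factors of \<open>M\<close> and \<open>F\<close> are known; a loop whose work is done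
  earlier idles until its clock runs out. Compilation is exact: it preserves the number of accepting
  branches of a program without any reference to \<open>k\<close>. Congruences enter in one place
  only, where the runs of \<open>F\<close> are grouped by their output. An undefined query needs no
  test: it is the case in which every output of \<open>F\<close> has multiplicity 0 modulo
  \<open>k\<close>, so that the branch vanishes modulo \<open>k\<close>, as the semantics of oracle
  access demands.\<close>

section \<open>Computation trees\<close>

text \<open>A derivation certifies three things at once about the computation from \<open>c\<close>:
  every branch makes fewer than \<open>t\<close> steps, no work head goes beyond \<open>S\<close>,
  and exactly \<open>n\<close> branches accept with an output in \<open>Y\<close>. Time, space and
  count of the compiled machine can thus be verified by a single induction.\<close>

inductive comp_tree :: "'a pfun \<Rightarrow> ('q, 'g, 'a) ntm \<Rightarrow> 'a list \<Rightarrow> 'a list set \<Rightarrow> nat \<Rightarrow> nat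
      \<Rightarrow> ('q, 'g, 'a) config \<Rightarrow> nat \<Rightarrow> bool"
  for f M x Y S where
  node: "\<lbrakk> \<forall>(t, p) \<in> set (work c). p \<le> S; finite (choices M x c);
     cstate c \<in> accept M \<Longrightarrow> choices M x c = {};
     \<forall>a \<in> choices M x c. \<exists>c'. perform f x a c = Some c' \<and> comp_tree f M x Y S t c' (g a);
     n = (if cstate c \<in> accept M \<and> out c \<in> Y then 1 else 0) + (\<Sum>a\<in>choices M x c. g a) \<rbrakk>
   \<Longrightarrow> comp_tree f M x Y S (Suc t) c n"

text \<open>The set \<open>Y\<close> treats both kinds of counting uniformly: \<open>UNIV\<close>
  for plain acceptance and singletons for acceptance with a given output.\<close>

definition accepting_into ::
    "'a pfun \<Rightarrow> ('q, 'g, 'a) ntm \<Rightarrow> 'a list \<Rightarrow> 'a list set \<Rightarrow> ('q, 'g, 'a) config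
      \<Rightarrow> ('q, 'g, 'a) action list set" where
  "accepting_into f M x Y c =
     {as. \<exists>c'. run f M x c as = Some c' \<and> cstate c' \<in> accept M \<and> out c' \<in> Y}"

lemma accepting_branches_into:
  "accepting_branches f M x = accepting_into f M x UNIV (init_config M)"
  "accepting_branches_with_output f M x y = accepting_into f M x {y} (init_config M)"
  by (auto simp: accepting_branches_def accepting_branches_with_output_def accepting_into_def)

lemma accepting_into_unfold:
  "accepting_into f M x Y c =
     (if cstate c \<in> accept M \<and> out c \<in> Y then {[]} else {}) \<union>
     (\<Union>a\<in>choices M x c. case perform f x a c of None \<Rightarrow> {} | Some c' \<Rightarrow> (#) a ` accepting_into f M x Y c')"
  (is "?L = ?R")
proof (rule set_eqI)
  fix as show "as \<in> ?L \<longleftrightarrow> as \<in> ?R"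
    by (cases as) (auto simp: accepting_into_def Option.bind_eq_Some_conv image_iff split: option.splits)
qed

lemma card_prefixed:
  assumes "finite A" and "\<And>a. a \<in> A \<Longrightarrow> finite (F a)"
  shows "finite (\<Union>a\<in>A. (#) a ` F a)" "card (\<Union>a\<in>A. (#) a ` F a) = (\<Sum>a\<in>A. card (F a))"
proof -
  show "finite (\<Union>a\<in>A. (#) a ` F a)" using assms by auto
  have "card (\<Union>a\<in>A. (#) a ` F a) = (\<Sum>a\<in>A. card ((#) a ` F a))"
    using assms by (intro card_UN_disjoint) auto
  also have "\<dots> = (\<Sum>a\<in>A. card (F a))"
    by (intro sum.cong) (auto simp: card_image)
  finally show "card (\<Union>a\<in>A. (#) a ` F a) = (\<Sum>a\<in>A. card (F a))" .
qed

text \<open>Branches with different first actions are different, so the counts of the subtrees add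
  up.\<close>

lemma comp_tree_count:
  "comp_tree f M x Y S t c n \<Longrightarrow>
    finite (accepting_into f M x Y c) \<and> card (accepting_into f M x Y c) = n"
proof (induction rule: comp_tree.induct)
  case (node c t g n)
  have "\<forall>a\<in>choices M x c. \<exists>c'. perform f x a c = Some c' \<and>
      finite (accepting_into f M x Y c') \<and> card (accepting_into f M x Y c') = g a"
    using node.IH by blast
  then obtain h where "\<forall>a\<in>choices M x c. perform f x a c = Some (h a) \<and>
      finite (accepting_into f M x Y (h a)) \<and> card (accepting_into f M x Y (h a)) = g a"
    by (rule bchoice[THEN exE])
  then have h: "\<And>a. a \<in> choices M x c \<Longrightarrow> perform f x a c = Some (h a) \<and>
      finite (accepting_into f M x Y (h a)) \<and> card (accepting_into f M x Y (h a)) = g a"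
    by blast
  have *: "accepting_into f M x Y c = (if cstate c \<in> accept M \<and> out c \<in> Y then {[]} else {}) \<union>
     (\<Union>a\<in>choices M x c. (#) a ` accepting_into f M x Y (h a))"
    by (subst accepting_into_unfold) (use h in auto)
  have **: "finite (\<Union>a\<in>choices M x c. (#) a ` accepting_into f M x Y (h a))"
    "card (\<Union>a\<in>choices M x c. (#) a ` accepting_into f M x Y (h a)) = (\<Sum>a\<in>choices M x c. g a)"
    using card_prefixed[of "choices M x c" "\<lambda>a. accepting_into f M x Y (h a)"] node.hyps(2) h by auto
  moreover have "[] \<notin> (\<Union>a\<in>choices M x c. (#) a ` accepting_into f M x Y (h a))"
    by auto
  ultimately show ?case unfolding * node.hyps(4) by simp
qed

lemma comp_tree_time_space:
  "comp_tree f M x Y S t c n \<Longrightarrow> run f M x c as = Some c' \<Longrightarrow>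
    length as \<le> t \<and> (\<forall>(tp, p) \<in> set (work c'). p \<le> S)"
proof (induction arbitrary: as rule: comp_tree.induct)
  case (node c t g n)
  show ?case
  proof (cases as)
    case Nil
    then show ?thesis using node.hyps node.prems by auto
  next
    case (Cons a as')
    then have "a \<in> choices M x c" using node.prems by (auto split: if_splits)
    with Cons node.prems node.IH show ?thesis by fastforce
  qed
qed

lemma comp_tree_mono:
  "comp_tree f M x Y S t c n \<Longrightarrow> t \<le> t' \<Longrightarrow> comp_tree f M x Y S t' c n"
proof (induction arbitrary: t' rule: comp_tree.induct)
  case (node c t g n)
  then obtain t0 where t0: "t' = Suc t0" "t \<le> t0" by (cases t') auto
  show ?case unfolding t0(1)
    by (rule comp_tree.node[where g = g]) (use node.hyps node.IH t0(2) in blast)+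
qed

lemma comp_tree_det:
  assumes "\<forall>(t, p) \<in> set (work c). p \<le> S" "choices M x c = {a}" "cstate c \<notin> accept M"
    "perform f x a c = Some c'" "comp_tree f M x Y S t c' n"
  shows "comp_tree f M x Y S (Suc t) c n"
  by (rule comp_tree.node[where g = "\<lambda>_. n"]) (use assms in auto)

section \<open>Concatenation of runs, and machines without an oracle\<close>

lemma run_append:
  "run f M x c (as @ bs) = Option.bind (run f M x c as) (\<lambda>c'. run f M x c' bs)"
  by (induction as arbitrary: c) auto

lemma oracle_free_run:
  assumes "oracle_free M"
  shows "run f M x c as = run g M x c as"
proof (induction as arbitrary: c)
  case (Cons a as)
  have "a \<in> choices M x c \<Longrightarrow> ocmd a = OIdle"
    using assms by (auto simp: oracle_free_def choices_def)
  then show ?case by (auto simp: perform_def Cons.IH)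
qed auto

lemma oracle_free_otape:
  assumes "oracle_free M"
  shows "run f M x c as = Some c' \<Longrightarrow> otape c' = otape c"
proof (induction as arbitrary: c)
  case (Cons a as)
  then obtain c1 where c1: "a \<in> choices M x c" "perform f x a c = Some c1" "run f M x c1 as = Some c'"
    by (auto simp: Option.bind_eq_Some_conv split: if_splits)
  then have "ocmd a = OIdle"
    using assms by (auto simp: oracle_free_def choices_def)
  with c1 show ?case using Cons.IH by (auto simp: perform_def)
qed auto

text \<open>The oracle tape keeps its initial empty answer, so no configuration with a query is ever
  reached.\<close>

lemma oracle_free_deterministic_queries: "oracle_free M \<Longrightarrow> deterministic_queries f M"
  unfolding deterministic_queries_def reachable_def
  by (metis init_config_def config.select_convs(5) oracle_free_otape otape.distinct(1))

text \<open>This gives the easy inclusion of lowness: an oracle may be ignored.\<close>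

lemma logspace_ntm_add_oracle:
  assumes "logspace_ntm None M"
  shows "logspace_ntm (Some f) M"
  using assms oracle_free_run[of M Map.empty _ _ _ f]
  unfolding logspace_ntm_def halts_in_poly_time_def runs_in_log_space_def reachable_def
  by (auto intro: oracle_free_deterministic_queries)

section \<open>Well-formed configurations\<close>

text \<open>\<open>wf_ntm\<close> constrains \<open>delta\<close> only on the declared states and
  symbols. Finite branching and invariance under renaming are therefore available for these
  configurations only.\<close>

definition wf_config :: "('q, 'g, 'a) ntm \<Rightarrow> 'a list \<Rightarrow> ('q, 'g, 'a) config \<Rightarrow> bool" where
  "wf_config M x c \<longleftrightarrow> cstate c \<in> states M \<and> length (work c) = tapes M \<and>
     (\<forall>(t, p) \<in> set (work c). range t \<subseteq> symbols M) \<and> in_pos c \<le> length x + 1"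

lemma wf_config_init: "wf_ntm M \<Longrightarrow> wf_config M x (init_config M)"
  by (auto simp: wf_config_def init_config_def wf_ntm_def)

definition actions :: "('q, 'g, 'a) ntm \<Rightarrow> ('q, 'g, 'a) action set" where
  "actions M = {a. new_state a \<in> states M \<and> length (work_acts a) = tapes M \<and>
        fst ` set (work_acts a) \<subseteq> symbols M}"

lemma choices_subset_actions:
  assumes "wf_ntm M" "wf_config M x c"
  shows "choices M x c \<subseteq> actions M"
proof
  fix a assume a: "a \<in> choices M x c"
  have "set (map (\<lambda>(t, p). t p) (work c)) \<subseteq> symbols M"
    using assms(2) by (fastforce simp: wf_config_def)
  moreover have "length (map (\<lambda>(t, p). t p) (work c)) = tapes M" "cstate c \<in> states M"
    using assms(2) by (auto simp: wf_config_def)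
  ultimately have "new_state a \<in> states M \<and> length (work_acts a) = tapes M \<and>
        fst ` set (work_acts a) \<subseteq> symbols M"
    using assms(1) a unfolding wf_ntm_def choices_def by blast
  then show "a \<in> actions M" by (simp add: actions_def)
qed

lemma perform_wf_config:
  assumes "wf_config M x c" "a \<in> actions M" "perform f x a c = Some c'"
  shows "wf_config M x c'"
proof -
  have "range (fst tp) \<subseteq> symbols M" if "tp \<in> set (work c')" for tp
  proof -
    have "tp \<in> set (map2 (\<lambda>(s, d) (t, p). (t(p := s), mv d p)) (work_acts a) (work c))"
      using assms(3) that by (auto simp: perform_def)
    then obtain s d t p where *: "((s, d), (t, p)) \<in> set (zip (work_acts a) (work c))" "tp = (t(p := s), mv d p)"
      by fastforce
    have "s \<in> symbols M" using *(1) assms(2) by (force simp: actions_def dest: set_zip_leftD)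
    moreover have "range t \<subseteq> symbols M" using *(1) assms(1) by (force simp: wf_config_def dest: set_zip_rightD)
    ultimately show ?thesis using * by auto
  qed
  then have "\<forall>(t, p) \<in> set (work c'). range t \<subseteq> symbols M" by fastforce
  moreover have "cstate c' \<in> states M" "length (work c') = tapes M" "in_pos c' \<le> length x + 1"
    using assms by (auto simp: wf_config_def actions_def perform_def mv_within_def)
  ultimately show ?thesis by (simp add: wf_config_def)
qed

lemma UNIV_move: "UNIV = {MLeft, MStay, MRight}"
  using move.exhaust by auto
instance move :: finite by standard (simp add: UNIV_move)

lemma UNIV_cell: "UNIV = insert LeftEnd (insert RightEnd (range Letter))"
  using cell.exhaust by auto
instance cell :: (finite) finite by standard (simp add: UNIV_cell)

lemma UNIV_ocmd: "UNIV = insert OIdle (insert OOpen (insert OAsk (range OMove \<union> range OWrite)))"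
proof (rule set_eqI)
  fix z :: "'a ocmd" show "z \<in> UNIV \<longleftrightarrow> z \<in> insert OIdle (insert OOpen (insert OAsk (range OMove \<union> range OWrite)))"
    by (cases z) auto
qed
instance ocmd :: (finite) finite by standard (simp add: UNIV_ocmd)

lemma finite_actions:
  assumes "finite (states M)" "finite (symbols M)"
  shows "finite (actions M :: ('q, 'g, 'a::finite) action set)"
proof -
  let ?W = "{ws. set ws \<subseteq> symbols M \<times> (UNIV :: move set) \<and> length ws = tapes M}"
  have "finite ?W" using assms by (intro finite_lists_length_eq) auto
  then have "finite ((\<lambda>(q, m, ws, e, oc). \<lparr>new_state = q, in_move = m, work_acts = ws, emit = e, ocmd = oc\<rparr>) `
      (states M \<times> (UNIV :: move set) \<times> ?W \<times> (UNIV :: 'a option set) \<times> (UNIV :: 'a ocmd set)))"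
    using assms by auto
  moreover have "actions M \<subseteq> (\<lambda>(q, m, ws, e, oc). \<lparr>new_state = q, in_move = m, work_acts = ws, emit = e, ocmd = oc\<rparr>) `
      (states M \<times> (UNIV :: move set) \<times> ?W \<times> (UNIV :: 'a option set) \<times> (UNIV :: 'a ocmd set))"
  proof
    fix a :: "('q, 'g, 'a) action" assume "a \<in> actions M"
    then show "a \<in> (\<lambda>(q, m, ws, e, oc). \<lparr>new_state = q, in_move = m, work_acts = ws, emit = e, ocmd = oc\<rparr>) `
      (states M \<times> (UNIV :: move set) \<times> ?W \<times> (UNIV :: 'a option set) \<times> (UNIV :: 'a ocmd set))"
      by (intro image_eqI[where x = "(new_state a, in_move a, work_acts a, emit a, ocmd a)"])
        (auto simp: actions_def)
  qed
  ultimately show ?thesis by (rule rev_finite_subset)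
qed

lemma finite_choices:
  fixes M :: "('q, 'g, 'a::finite) ntm"
  assumes "wf_ntm M" "wf_config M x c"
  shows "finite (choices M x c)"
  using choices_subset_actions[OF assms] finite_actions[of M] assms(1)
  by (auto simp: wf_ntm_def intro: finite_subset)

lemma run_wf_config:
  assumes "wf_ntm M"
  shows "wf_config M x c \<Longrightarrow> run f M x c as = Some c' \<Longrightarrow> wf_config M x c'"
proof (induction as arbitrary: c)
  case (Cons a as)
  then obtain c1 where c1: "a \<in> choices M x c" "perform f x a c = Some c1" "run f M x c1 as = Some c'"
    by (auto simp: Option.bind_eq_Some_conv split: if_splits)
  with Cons choices_subset_actions[OF assms] show ?case
    by (meson perform_wf_config subsetD)
qed auto

lemma reachable_wf_config: "wf_ntm M \<Longrightarrow> reachable f M x c \<Longrightarrow> wf_config M x c"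
  unfolding reachable_def using run_wf_config wf_config_init by blast

lemma reachable_step:
  "reachable f M x c \<Longrightarrow> a \<in> choices M x c \<Longrightarrow> perform f x a c = Some c' \<Longrightarrow> reachable f M x c'"
proof -
  assume "reachable f M x c" "a \<in> choices M x c" "perform f x a c = Some c'"
  then obtain as where "run f M x (init_config M) as = Some c" by (auto simp: reachable_def)
  with \<open>a \<in> _\<close> \<open>perform f x a c = _\<close> have "run f M x (init_config M) (as @ [a]) = Some c'"
    by (simp add: run_append)
  then show ?thesis unfolding reachable_def by blast
qed

section \<open>Renaming states and symbols\<close>

definition ren_act :: "('q \<Rightarrow> 'r) \<Rightarrow> ('g \<Rightarrow> 'h) \<Rightarrow> ('q, 'g, 'a) action \<Rightarrow> ('r, 'h, 'a) action" where
  "ren_act eq eg a = \<lparr> new_state = eq (new_state a), in_move = in_move a,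
     work_acts = map (apfst eg) (work_acts a), emit = emit a, ocmd = ocmd a \<rparr>"

definition ren_config :: "('q \<Rightarrow> 'r) \<Rightarrow> ('g \<Rightarrow> 'h) \<Rightarrow> ('q, 'g, 'a) config \<Rightarrow> ('r, 'h, 'a) config" where
  "ren_config eq eg c = \<lparr> cstate = eq (cstate c), in_pos = in_pos c,
     work = map (apfst ((\<circ>) eg)) (work c), out = out c, otape = otape c \<rparr>"

text \<open>Outside the renamed sets \<open>inv_into\<close> returns arbitrary values; the guard
  makes \<open>delta\<close> empty there.\<close>

definition ren_ntm :: "('q \<Rightarrow> 'r) \<Rightarrow> ('g \<Rightarrow> 'h) \<Rightarrow> ('q, 'g, 'a) ntm \<Rightarrow> ('r, 'h, 'a) ntm" where
  "ren_ntm eq eg M = \<lparr> states = eq ` states M, symbols = eg ` symbols M, blank = eg (blank M),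
     tapes = tapes M, start = eq (start M), accept = eq ` accept M,
     delta = (\<lambda>q i gs z. if q \<in> eq ` states M \<and> set gs \<subseteq> eg ` symbols M \<and> length gs = tapes M
       then ren_act eq eg ` delta M (inv_into (states M) eq q) i
              (map (inv_into (symbols M) eg) gs) z else {}) \<rparr>"

lemma perform_ren:
  "perform f x (ren_act eq eg a) (ren_config eq eg c) = map_option (ren_config eq eg) (perform f x a c)"
proof -
  have "map2 (\<lambda>(s, d) (t, p). (t(p := s), mv d p)) (map (apfst eg) as) (map (apfst ((\<circ>) eg)) ws) =
      map (apfst ((\<circ>) eg)) (map2 (\<lambda>(s, d) (t, p). (t(p := s), mv d p)) as ws)" for as ws
  proof (induction as arbitrary: ws)
    case (Cons u as)
    then show ?case by (cases ws; cases u) (auto simp: fun_upd_def o_def intro!: ext)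
  qed auto
  then show ?thesis
    by (cases "oracle_step f (ocmd a) (otape c)") (auto simp: perform_def ren_act_def ren_config_def)
qed

context
  fixes M :: "('q, 'g, 'a) ntm" and eq :: "'q \<Rightarrow> 'r" and eg :: "'g \<Rightarrow> 'h"
  assumes wf: "wf_ntm M" and inj: "inj_on eq (states M)" "inj_on eg (symbols M)"
begin

lemma choices_ren:
  assumes "wf_config M x c"
  shows "choices (ren_ntm eq eg M) x (ren_config eq eg c) = ren_act eq eg ` choices M x c"
proof -
  let ?rd = "\<lambda>(t, p). t p"
  have rng: "?rd tp \<in> symbols M" if "tp \<in> set (work c)" for tp
    using assms that by (cases tp) (fastforce simp: wf_config_def)
  have "map ?rd (map (apfst ((\<circ>) eg)) (work c)) = map eg (map ?rd (work c))" by auto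
  moreover have "map (inv_into (symbols M) eg) (map eg (map ?rd (work c))) = map ?rd (work c)"
    using rng inj by (auto simp: map_idI)
  moreover have "set (map eg (map ?rd (work c))) \<subseteq> eg ` symbols M" using rng by auto
  ultimately show ?thesis using assms inj
    by (simp add: choices_def ren_ntm_def ren_config_def wf_config_def del: map_map set_map)
qed

text \<open>Branches are counted as sequences of actions, so a renaming must not identify two
  actions.\<close>

lemma inj_on_ren_act: "inj_on (ren_act eq eg) (actions M)"
proof
  fix a b assume ab: "a \<in> actions M" "b \<in> actions M" "ren_act eq eg a = ren_act eq eg b"
  have "inj_on (apfst eg :: 'g \<times> move \<Rightarrow> _) (symbols M \<times> UNIV)"
    using inj by (auto simp: inj_on_def)
  moreover have "set (work_acts a) \<union> set (work_acts b) \<subseteq> symbols M \<times> UNIV"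
    using ab(1,2) by (force simp: actions_def)
  ultimately have "inj_on (apfst eg) (set (work_acts a) \<union> set (work_acts b))"
    by (rule inj_on_subset)
  then have "work_acts a = work_acts b"
    using ab(3) inj_on_map_eq_map by (auto simp: ren_act_def)
  then show "a = b" using ab inj by (auto simp: ren_act_def actions_def inj_on_eq_iff intro: action.equality)
qed

lemma wf_ren: "wf_ntm (ren_ntm eq eg M)"
proof -
  have s: "accept M \<subseteq> states M" "start M \<in> states M" "blank M \<in> symbols M" "finite (states M)" "finite (symbols M)"
    using wf by (auto simp: wf_ntm_def)
  have acc: "delta M q i gs z = {}" if "q \<in> accept M" for q i gs z using wf that by (auto simp: wf_ntm_def)
  have "delta (ren_ntm eq eg M) q i gs z = {}" if qa: "q \<in> accept (ren_ntm eq eg M)" for q i gs z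
  proof -
    obtain q0 where q0: "q0 \<in> accept M" "q = eq q0" using qa by (auto simp: ren_ntm_def)
    then have "inv_into (states M) eq q = q0" using s inj by auto
    then show ?thesis using q0 acc by (simp add: ren_ntm_def)
  qed
  moreover have "new_state a \<in> states (ren_ntm eq eg M) \<and> length (work_acts a) = tapes M \<and>
        fst ` set (work_acts a) \<subseteq> symbols (ren_ntm eq eg M)"
    if a: "a \<in> delta (ren_ntm eq eg M) q i gs z" for q i gs z a
  proof -
    obtain b where b: "a = ren_act eq eg b" "b \<in> delta M (inv_into (states M) eq q) i
              (map (inv_into (symbols M) eg) gs) z" "q \<in> eq ` states M" "set gs \<subseteq> eg ` symbols M" "length gs = tapes M"
      using a by (auto simp: ren_ntm_def split: if_splits)
    have "inv_into (states M) eq q \<in> states M" using b(3) by (simp add: inv_into_into)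
    moreover have "set (map (inv_into (symbols M) eg) gs) \<subseteq> symbols M" using b(4) by (auto simp: inv_into_into)
    moreover have "length (map (inv_into (symbols M) eg) gs) = tapes M" using b(5) by simp
    ultimately have "new_state b \<in> states M \<and> length (work_acts b) = tapes M \<and>
        fst ` set (work_acts b) \<subseteq> symbols M"
      using wf b(2) unfolding wf_ntm_def by blast
    then show ?thesis using b(1) by (fastforce simp: ren_act_def ren_ntm_def)
  qed
  moreover have "tapes (ren_ntm eq eg M) = tapes M" by (simp add: ren_ntm_def)
  moreover have "finite (states (ren_ntm eq eg M))" "finite (symbols (ren_ntm eq eg M))"
    "blank (ren_ntm eq eg M) \<in> symbols (ren_ntm eq eg M)" "start (ren_ntm eq eg M) \<in> states (ren_ntm eq eg M)"
    "accept (ren_ntm eq eg M) \<subseteq> states (ren_ntm eq eg M)"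
    using s by (auto simp: ren_ntm_def)
  ultimately show ?thesis unfolding wf_ntm_def by simp blast
qed

lemma oracle_free_ren: "oracle_free M \<Longrightarrow> oracle_free (ren_ntm eq eg M)"
  by (auto simp: oracle_free_def ren_ntm_def ren_act_def)

lemma comp_tree_ren:
  "comp_tree f M x Y S t c n \<Longrightarrow> wf_config M x c \<Longrightarrow>
    comp_tree f (ren_ntm eq eg M) x Y S t (ren_config eq eg c) n"
proof (induction rule: comp_tree.induct)
  case (node c t g n)
  let ?i = "inv_into (choices M x c) (ren_act eq eg)"
  have sub: "choices M x c \<subseteq> actions M" using choices_subset_actions wf node.prems by blast
  then have i: "inj_on (ren_act eq eg) (choices M x c)" using inj_on_ren_act inj_on_subset by blast
  have acc: "cstate (ren_config eq eg c) \<in> accept (ren_ntm eq eg M) \<longleftrightarrow> cstate c \<in> accept M"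
    using inj_on_image_mem_iff[OF inj(1), of "cstate c" "accept M"] node.prems wf
    by (simp add: ren_config_def ren_ntm_def wf_config_def wf_ntm_def)
  show ?case
  proof (rule comp_tree.node[where g = "\<lambda>b. g (?i b)"])
    show "\<forall>(t, p)\<in>set (work (ren_config eq eg c)). p \<le> S"
      using node.hyps(1) by (auto simp: ren_config_def)
    show "finite (choices (ren_ntm eq eg M) x (ren_config eq eg c))"
      using node.hyps(2) choices_ren node.prems by simp
    show "choices (ren_ntm eq eg M) x (ren_config eq eg c) = {}"
      if "cstate (ren_config eq eg c) \<in> accept (ren_ntm eq eg M)"
      using node.hyps(3) choices_ren node.prems that acc by simp
    show "\<forall>b\<in>choices (ren_ntm eq eg M) x (ren_config eq eg c). \<exists>c'.
        perform f x b (ren_config eq eg c) = Some c' \<and> comp_tree f (ren_ntm eq eg M) x Y S t c' (g (?i b))"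
    proof
      fix b assume "b \<in> choices (ren_ntm eq eg M) x (ren_config eq eg c)"
      then obtain a where a: "a \<in> choices M x c" "b = ren_act eq eg a" using choices_ren node.prems by auto
      from node.IH a(1) obtain c' where c': "perform f x a c = Some c'"
        "wf_config M x c' \<Longrightarrow> comp_tree f (ren_ntm eq eg M) x Y S t (ren_config eq eg c') (g a)" by blast
      have "wf_config M x c'" using perform_wf_config[OF node.prems _ c'(1)] sub a(1) by blast
      with a c' show "\<exists>c'. perform f x b (ren_config eq eg c) = Some c' \<and>
          comp_tree f (ren_ntm eq eg M) x Y S t c' (g (?i b))"
        using i by (simp add: perform_ren)
    qed
    have "(\<Sum>b\<in>ren_act eq eg ` choices M x c. g (?i b)) = (\<Sum>a\<in>choices M x c. g a)"
      using i by (simp add: sum.reindex)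
    then show "n = (if cstate (ren_config eq eg c) \<in> accept (ren_ntm eq eg M) \<and>
          out (ren_config eq eg c) \<in> Y then 1 else 0) +
        (\<Sum>b\<in>choices (ren_ntm eq eg M) x (ren_config eq eg c). g (?i b))"
      unfolding acc using node.hyps(4) choices_ren node.prems by (simp add: ren_config_def)
  qed
qed

lemma ren_config_init: "ren_config eq eg (init_config M) = init_config (ren_ntm eq eg M)"
  by (simp add: ren_config_def init_config_def ren_ntm_def o_def)

end

text \<open>The classes quantify over machines whose states and symbols are natural numbers, while
  the compiler below produces structured ones. Any injections on the two finite sets transport the
  trees, and with them all resource bounds and counts.\<close>

lemma nat_machine:
  fixes M :: "('q, 'g, 'a) ntm"
  assumes "wf_ntm M" "oracle_free M"
  obtains M' :: "(nat, nat, 'a) ntm" where "wf_ntm M'" "oracle_free M'"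
    "\<And>f x Y S t n. comp_tree f M x Y S t (init_config M) n \<Longrightarrow> comp_tree f M' x Y S t (init_config M') n"
proof -
  obtain eq :: "'q \<Rightarrow> nat" where eq: "inj_on eq (states M)"
    using finite_imp_inj_to_nat_seg[of "states M"] assms by (auto simp: wf_ntm_def)
  obtain eg :: "'g \<Rightarrow> nat" where eg: "inj_on eg (symbols M)"
    using finite_imp_inj_to_nat_seg[of "symbols M"] assms by (auto simp: wf_ntm_def)
  note ctx = assms(1) eq eg
  show thesis
    by (rule that[OF wf_ren[OF ctx] oracle_free_ren[OF ctx assms(2)]])
      (use comp_tree_ren[OF ctx] ren_config_init[OF ctx] wf_config_init[OF assms(1)] in metis)
qed

section \<open>Clocked programs\<close>

text \<open>Nondeterminism, the input head and the output occur only in \<open>Basic\<close>. A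
  \<open>Sweep\<close> passes over the work word to the right with its first function and back with
  its second. A \<open>Loop\<close> has no exit test: its number of rounds depends on the length of
  the word alone, so programs halt on every store, including those produced by wrong
  guesses.\<close>

datatype ('e, 'l, 'a) com =
    Basic "'e \<Rightarrow> 'a cell \<Rightarrow> ('e \<times> move \<times> 'a option) set"
  | Sweep "'e \<Rightarrow> 'l \<Rightarrow> 'e \<times> 'l" "'e \<Rightarrow> 'l \<Rightarrow> 'e \<times> 'l"
  | Seq "('e, 'l, 'a) com" "('e, 'l, 'a) com"
  | Cond "'e \<Rightarrow> bool" "('e, 'l, 'a) com" "('e, 'l, 'a) com"
  | Loop "('e, 'l, 'a) com"

text \<open>The action of a Mealy machine with state \<open>e\<close> on a word.\<close>

fun pass :: "('e \<Rightarrow> 'l \<Rightarrow> 'e \<times> 'm) \<Rightarrow> 'e \<Rightarrow> 'l list \<Rightarrow> 'e \<times> 'm list" where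
  "pass f e [] = (e, [])"
| "pass f e (l # w) = (let (e1, l1) = f e l; (e2, w2) = pass f e1 w in (e2, l1 # w2))"

type_synonym ('e, 'l, 'a) store = "'e \<times> nat \<times> 'l list \<times> 'a list"

text \<open>
  The semantics is the transformer that sends a weight \<open>\<kappa>\<close> of final stores to the sum of the
  weights over all branches of the program.
\<close>

primrec wt :: "'a list \<Rightarrow> ('e, 'l, 'a) com \<Rightarrow> (('e, 'l, 'a) store \<Rightarrow> nat) \<Rightarrow> ('e, 'l, 'a) store \<Rightarrow> nat"
  where
  "wt x (Basic h) \<kappa> = (\<lambda>(e, i, w, u). \<Sum>(e', d, b)\<in>h e (read_cell x i).
     \<kappa> (e', mv_within x d i, w, u @ (case b of None \<Rightarrow> [] | Some b \<Rightarrow> [b])))"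
| "wt x (Sweep f g) \<kappa> = (\<lambda>(e, i, w, u). let (e1, w1) = pass f e w; (e2, w2) = pass g e1 (rev w1)
     in \<kappa> (e2, i, rev w2, u))"
| "wt x (Seq c d) \<kappa> = wt x c (wt x d \<kappa>)"
| "wt x (Cond b c d) \<kappa> = (\<lambda>s. if b (fst s) then wt x c \<kappa> s else wt x d \<kappa> s)"
| "wt x (Loop c) \<kappa> = (\<lambda>s. (wt x c ^^ (2 ^ length (fst (snd (snd s))))) \<kappa> s)"

text \<open>The types of control values and letters may be infinite. Closure under finite sets
  \<open>E\<close> and \<open>G\<close> makes the compiled machine finite, and finiteness of
  \<open>h e z\<close> gives the sum in \<open>wt\<close> its intended meaning.\<close>

primrec closed_com :: "'e set \<Rightarrow> 'l set \<Rightarrow> ('e, 'l, 'a) com \<Rightarrow> bool" where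
  "closed_com E G (Basic h) \<longleftrightarrow> (\<forall>e\<in>E. \<forall>z. finite (h e z) \<and> fst ` h e z \<subseteq> E)"
| "closed_com E G (Sweep f g) \<longleftrightarrow> (\<forall>e\<in>E. \<forall>l\<in>G. f e l \<in> E \<times> G \<and> g e l \<in> E \<times> G)"
| "closed_com E G (Seq c d) \<longleftrightarrow> closed_com E G c \<and> closed_com E G d"
| "closed_com E G (Cond b c d) \<longleftrightarrow> closed_com E G c \<and> closed_com E G d"
| "closed_com E G (Loop c) \<longleftrightarrow> closed_com E G c"

lemma pass_closed:
  assumes "\<And>e l. e \<in> E \<Longrightarrow> l \<in> G \<Longrightarrow> f e l \<in> E \<times> G"
  shows "e \<in> E \<Longrightarrow> set w \<subseteq> G \<Longrightarrow> pass f e w = (e', w') \<Longrightarrow> e' \<in> E \<and> set w' \<subseteq> G \<and> length w' = length w"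
proof (induction w arbitrary: e e' w')
  case (Cons l w)
  obtain e1 l1 where f: "f e l = (e1, l1)" by fastforce
  obtain e2 w2 where p: "pass f e1 w = (e2, w2)" by fastforce
  have "e1 \<in> E" "l1 \<in> G" using assms[of e l] f Cons.prems by auto
  with Cons.IH[OF _ _ p] Cons.prems f p show ?case by auto
qed auto

section \<open>Compilation into one-tape machines\<close>

text \<open>Besides a letter, a cell holds one bit of every loop counter, namely the set of those
  stack depths whose counter has a 1 here, and a digit used by the setup phase. \<open>Mark\<close>
  is the left end of the tape.\<close>

datatype 'l sym = Blank | Mark | Cell 'l "nat set" nat

text \<open>The programs still to be run, the next one first. The flag \<open>True\<close> marks a
  loop whose body has just been completed and whose counter must now be advanced.\<close>

type_synonym ('e, 'l, 'a) stack = "(bool \<times> ('e, 'l, 'a) com) list"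

text \<open>\<open>Boot\<close> to \<open>Return\<close> lay out the work word, \<open>Fwd\<close>
  and \<open>Bwd\<close> are the two halves of a sweep, \<open>Incr\<close> and
  \<open>Rewind\<close> advance a loop counter. The flag of \<open>Rewind\<close> records an
  overflow, that is, the end of the loop.\<close>

datatype ('e, 'l, 'a) ctl =
    Boot | Scan | Carry | Extend nat | Return
  | Ready 'e "('e, 'l, 'a) stack"
  | Fwd 'e "('e, 'l, 'a) stack" | Bwd 'e "('e, 'l, 'a) stack"
  | Incr 'e "('e, 'l, 'a) stack" | Rewind bool 'e "('e, 'l, 'a) stack"

primrec start_com :: "'e \<Rightarrow> 'a cell \<Rightarrow> ('e, 'l, 'a) stack \<Rightarrow> ('e, 'l, 'a) com
    \<Rightarrow> (('e, 'l, 'a) ctl \<times> move \<times> 'l sym \<times> move \<times> 'a option) set" where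
  "start_com e z ks (Basic h) = (\<lambda>(e', d, b). (Ready e' ks, d, Mark, MStay, b)) ` h e z"
| "start_com e z ks (Sweep f g) = {(Fwd e ((False, Sweep f g) # ks), MStay, Mark, MRight, None)}"
| "start_com e z ks (Seq c d) = {(Ready e ((False, c) # (False, d) # ks), MStay, Mark, MStay, None)}"
| "start_com e z ks (Cond b c d) =
    {(Ready e ((False, if b e then c else d) # ks), MStay, Mark, MStay, None)}"
| "start_com e z ks (Loop c) = {(Ready e ((False, c) # (True, c) # ks), MStay, Mark, MStay, None)}"

text \<open>In the setup phase \<open>Scan\<close> ticks once at the left marker and once at every
  letter, so the counter ends at the input length plus 1. Loops active at the same time have
  different stack depths, which is why \<open>length ks\<close> can index their counters.\<close>

primrec trans :: "nat \<Rightarrow> 'l \<Rightarrow> 'e \<Rightarrow> ('e, 'l, 'a) com \<Rightarrow> 'a cell \<Rightarrow> 'l sym \<Rightarrow> ('e, 'l, 'a) ctl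
    \<Rightarrow> (('e, 'l, 'a) ctl \<times> move \<times> 'l sym \<times> move \<times> 'a option) set" where
  "trans b l0 e0 c0 z g Boot = {(Scan, MStay, Mark, MStay, None)}"
| "trans b l0 e0 c0 z g Scan =
    (if z = RightEnd then {(Ready e0 [(False, c0)], MStay, Mark, MStay, None)}
     else {(Carry, MRight, Mark, MRight, None)})"
| "trans b l0 e0 c0 z g Carry = (case g of
      Cell l v u \<Rightarrow>
        if u = 1 then {(Carry, MStay, Cell l v 0, MRight, None)}
        else if u = 0 then {(Return, MStay, Cell l v 1, MLeft, None)}
        else {(Carry, MStay, Cell l v u, MRight, None)}
    | Blank \<Rightarrow> {(Extend (b - 1), MStay, Cell l0 {} 1, MRight, None)}
    | Mark \<Rightarrow> {})"
| "trans b l0 e0 c0 z g (Extend j) = (case j of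
      Suc j \<Rightarrow> {(Extend j, MStay, Cell l0 {} 2, MRight, None)}
    | 0 \<Rightarrow> {(Return, MStay, Blank, MLeft, None)})"
| "trans b l0 e0 c0 z g Return =
    (if g = Mark then {(Scan, MStay, Mark, MStay, None)} else {(Return, MStay, g, MLeft, None)})"
| "trans b l0 e0 c0 z g (Ready e ks) = (case ks of
      [] \<Rightarrow> {}
    | p # ks' \<Rightarrow> if fst p then {(Incr e ks, MStay, Mark, MRight, None)} else start_com e z ks' (snd p))"
| "trans b l0 e0 c0 z g (Fwd e ks) = (case g of
      Cell l v u \<Rightarrow> (case ks of
          (False, Sweep f h) # _ \<Rightarrow> {(Fwd (fst (f e l)) ks, MStay, Cell (snd (f e l)) v u, MRight, None)}
        | _ \<Rightarrow> {})
    | Blank \<Rightarrow> {(Bwd e ks, MStay, Blank, MLeft, None)}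
    | Mark \<Rightarrow> {})"
| "trans b l0 e0 c0 z g (Bwd e ks) = (case ks of
      (False, Sweep f h) # ks' \<Rightarrow> (case g of
          Cell l v u \<Rightarrow> {(Bwd (fst (h e l)) ks, MStay, Cell (snd (h e l)) v u, MLeft, None)}
        | Mark \<Rightarrow> {(Ready e ks', MStay, Mark, MStay, None)}
        | Blank \<Rightarrow> {})
    | _ \<Rightarrow> {})"
| "trans b l0 e0 c0 z g (Incr e ks) = (case g of
      Cell l v u \<Rightarrow>
        if length ks \<in> v then {(Incr e ks, MStay, Cell l (v - {length ks}) u, MRight, None)}
        else {(Rewind False e ks, MStay, Cell l (insert (length ks) v) u, MLeft, None)}
    | Blank \<Rightarrow> {(Rewind True e ks, MStay, Blank, MLeft, None)}
    | Mark \<Rightarrow> {})"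
| "trans b l0 e0 c0 z g (Rewind r e ks) = (case g of
      Cell l v u \<Rightarrow> {(Rewind r e ks, MStay, Cell l v u, MLeft, None)}
    | Mark \<Rightarrow> (case ks of
          (True, c) # ks' \<Rightarrow> {(Ready e (if r then ks' else (False, c) # ks), MStay, Mark, MStay, None)}
        | _ \<Rightarrow> {})
    | Blank \<Rightarrow> {})"

text \<open>The stacks that can occur while \<open>c\<close> is run on top of \<open>ks\<close>. A
  loop body is always pushed on the same marked entry, so iterating does not create new stacks; the
  set is finite and stacks fit into the control state.\<close>

primrec stacks :: "('e, 'l, 'a) com \<Rightarrow> ('e, 'l, 'a) stack \<Rightarrow> ('e, 'l, 'a) stack set" where
  "stacks (Basic h) ks = {(False, Basic h) # ks}"
| "stacks (Sweep f g) ks = {(False, Sweep f g) # ks}"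
| "stacks (Seq c d) ks =
    insert ((False, Seq c d) # ks) (stacks c ((False, d) # ks) \<union> stacks d ks)"
| "stacks (Cond b c d) ks = insert ((False, Cond b c d) # ks) (stacks c ks \<union> stacks d ks)"
| "stacks (Loop c) ks =
    {(False, Loop c) # ks, (True, c) # ks} \<union> stacks c ((True, c) # ks)"

fun next_stacks :: "('e, 'l, 'a) stack \<Rightarrow> ('e, 'l, 'a) stack set" where
  "next_stacks [] = {}"
| "next_stacks ((True, c) # ks) = {ks, (False, c) # (True, c) # ks}"
| "next_stacks ((False, Basic h) # ks) = {ks}"
| "next_stacks ((False, Sweep f g) # ks) = {ks}"
| "next_stacks ((False, Seq c d) # ks) = {(False, c) # (False, d) # ks}"
| "next_stacks ((False, Cond b c d) # ks) = {(False, c) # ks, (False, d) # ks}"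
| "next_stacks ((False, Loop c) # ks) = {(False, c) # (True, c) # ks}"

lemma finite_stacks: "finite (stacks c ks)"
  by (induction c arbitrary: ks) auto

lemma stacks_self: "(False, c) # ks \<in> stacks c ks"
  by (cases c) auto

lemma next_stacks_closed: "ks' \<in> stacks c ks \<Longrightarrow> next_stacks ks' \<subseteq> insert ks (stacks c ks)"
proof (induction c arbitrary: ks ks')
  case (Seq c d)
  then show ?case using stacks_self[of c "(False, d) # ks"] stacks_self[of d ks] by fastforce
next
  case (Cond b c d)
  then show ?case using stacks_self[of c ks] stacks_self[of d ks] by fastforce
next
  case (Loop c)
  then show ?case using stacks_self[of c "(True, c) # ks"] by fastforce
qed auto

lemma closed_com_stacks:
  "closed_com E G c \<Longrightarrow> \<forall>p\<in>set ks. closed_com E G (snd p) \<Longrightarrow> ks' \<in> stacks c ks \<Longrightarrow>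
    \<forall>p\<in>set ks'. closed_com E G (snd p)"
proof (induction c arbitrary: ks ks')
  case (Seq c d)
  show ?case
    using Seq.IH(1)[of "(False, d) # ks" ks'] Seq.IH(2)[of ks ks'] Seq.prems by auto
next
  case (Cond b c d)
  show ?case
    using Cond.IH(1)[of ks ks'] Cond.IH(2)[of ks ks'] Cond.prems by auto
next
  case (Loop c)
  show ?case using Loop.IH[of "(True, c) # ks" ks'] Loop.prems by auto
qed auto

definition all_stacks :: "('e, 'l, 'a) com \<Rightarrow> ('e, 'l, 'a) stack set" where
  "all_stacks c = insert [] (stacks c [])"

text \<open>One work tape is enough, because the letters, all loop counters and the setup digits
  share its cells. An empty stack means acceptance.\<close>

definition compiled :: "nat \<Rightarrow> 'l \<Rightarrow> 'e \<Rightarrow> 'e set \<Rightarrow> 'l set \<Rightarrow> ('e, 'l, 'a) com \<Rightarrow> (('e, 'l, 'a) ctl, 'l sym, 'a) ntm"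
  where
  "compiled b l0 e0 E G c = \<lparr>
     states = {Boot, Scan, Carry, Return} \<union> Extend ` {..b} \<union>
       (\<Union>e\<in>E. \<Union>ks\<in>all_stacks c. {Ready e ks, Fwd e ks, Bwd e ks, Incr e ks, Rewind True e ks, Rewind False e ks}),
     symbols = {Blank, Mark} \<union> (\<lambda>(l, v, u). Cell l v u) ` (G \<times> Pow (length ` all_stacks c) \<times> {..2}),
     blank = Blank, tapes = 1, start = Boot, accept = (\<lambda>e. Ready e []) ` E,
     delta = (\<lambda>q z gs _. (\<lambda>(q', d, g, d', b). \<lparr> new_state = q', in_move = d,
        work_acts = [(g, d')], emit = b, ocmd = OIdle \<rparr>) ` trans b l0 e0 c z (hd gs) q) \<rparr>"

lemma all_stacks_next: "ks \<in> all_stacks c \<Longrightarrow> next_stacks ks \<subseteq> all_stacks c"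
  unfolding all_stacks_def using next_stacks_closed[of ks c "[]"] by auto

lemma wf_compiled:
  fixes c0 :: "('e, 'l, 'a) com"
  assumes "closed_com E G c0" "finite E" "finite G" "e0 \<in> E" "l0 \<in> G"
  shows "wf_ntm (compiled b l0 e0 E G c0)"
proof -
  let ?M = "compiled b l0 e0 E G c0"
  have fin: "finite (all_stacks c0)" by (simp add: all_stacks_def finite_stacks)
  have cl: "closed_com E G (snd p)" if "ks \<in> all_stacks c0" "p \<in> set ks" for ks p
    using that closed_com_stacks[OF assms(1), of "[]" ks] by (auto simp: all_stacks_def)
  have st: "Ready e ks \<in> states ?M" "Fwd e ks \<in> states ?M" "Bwd e ks \<in> states ?M" "Incr e ks \<in> states ?M"
      "Rewind r e ks \<in> states ?M" if "e \<in> E" "ks \<in> all_stacks c0" for e ks r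
    using that by (cases r; auto simp: compiled_def)+
  have st0: "Boot \<in> states ?M" "Scan \<in> states ?M" "Carry \<in> states ?M" "Return \<in> states ?M"
    "j \<le> b \<Longrightarrow> Extend j \<in> states ?M" for j by (auto simp: compiled_def)
  have sy: "Blank \<in> symbols ?M" "Mark \<in> symbols ?M" by (auto simp: compiled_def)
  have sy2: "Cell l v u \<in> symbols ?M \<longleftrightarrow> l \<in> G \<and> v \<subseteq> length ` all_stacks c0 \<and> u \<le> 2" for l v u
    by (auto simp: compiled_def image_iff)
  have step: "q' \<in> states ?M \<and> g' \<in> symbols ?M"
    if "q \<in> states ?M" "g \<in> symbols ?M" "(q', d, g', d', o') \<in> trans b l0 e0 c0 z g q" for q g q' d g' d' o' z
  proof (cases q)
    case (Ready e ks)
    have e: "e \<in> E" "ks \<in> all_stacks c0" using that(1) Ready by (auto simp: compiled_def)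
    show ?thesis
    proof (cases ks)
      case (Cons p ks1)
      note ks = e(2)[unfolded Cons]
      obtain r c where p: "p = (r, c)" by fastforce
      show ?thesis
      proof (cases r)
        case True
        then show ?thesis using that Ready Cons p e sy st by auto
      next
        case False
        have c: "closed_com E G c" using cl[OF ks, of p] p by simp
        have n: "next_stacks ((False, c) # ks1) \<subseteq> all_stacks c0"
          using all_stacks_next[OF ks] False p by simp
        show ?thesis
        proof (cases c)
          case (Basic h)
          then show ?thesis using that(3) Ready Cons p False c n e sy by (fastforce intro: st)
        qed (use that(3) Ready Cons p False c n e sy ks in \<open>auto intro: st\<close>)
      qed
    qed (use that Ready in auto)
  next
    case (Fwd e ks)
    have e: "e \<in> E" "ks \<in> all_stacks c0" using that(1) Fwd by (auto simp: compiled_def)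
    show ?thesis
    proof (cases g)
      case Blank
      then show ?thesis using that(3) Fwd e sy by (auto intro: st)
    next
      case Mark
      then show ?thesis using that(3) Fwd by auto
    next
      case (Cell l v u)
      with that(3) Fwd obtain f h ks1 where ks: "ks = (False, Sweep f h) # ks1"
        by (auto split: list.splits prod.splits bool.splits com.splits)
      then have "f e l \<in> E \<times> G" using cl[OF e(2), of "(False, Sweep f h)"] e(1) that(2) Cell sy2 by auto
      then show ?thesis using that Fwd ks Cell sy2 e by (auto intro!: st simp: mem_Times_iff)
    qed
  next
    case (Bwd e ks)
    have e: "e \<in> E" "ks \<in> all_stacks c0" using that(1) Bwd by (auto simp: compiled_def)
    show ?thesis
    proof (cases g)
      case Blank
      then show ?thesis using that(3) Bwd by (auto split: list.splits prod.splits bool.splits com.splits)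
    next
      case Mark
      with that(3) Bwd obtain f h ks1 where ks: "ks = (False, Sweep f h) # ks1"
        by (auto split: list.splits prod.splits bool.splits com.splits)
      then show ?thesis using that Bwd Mark e all_stacks_next[OF e(2)] by (auto intro!: st)
    next
      case (Cell l v u)
      with that(3) Bwd obtain f h ks1 where ks: "ks = (False, Sweep f h) # ks1"
        by (auto split: list.splits prod.splits bool.splits com.splits)
      then have "h e l \<in> E \<times> G" using cl[OF e(2), of "(False, Sweep f h)"] e(1) that(2) Cell sy2 by auto
      then show ?thesis using that Bwd ks Cell sy2 e by (auto intro!: st simp: mem_Times_iff)
    qed
  next
    case (Incr e ks)
    have e: "e \<in> E" "ks \<in> all_stacks c0" using that(1) Incr by (auto simp: compiled_def)
    then have "length ks \<in> length ` all_stacks c0" by blast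
    with e that Incr sy sy2 show ?thesis
      by (cases g) (auto split: if_splits intro: st)
  next
    case (Rewind r e ks)
    have e: "e \<in> E" "ks \<in> all_stacks c0" using that(1) Rewind by (auto simp: compiled_def)
    show ?thesis
    proof (cases g)
      case Mark
      with that(3) Rewind obtain c ks1 where ks: "ks = (True, c) # ks1"
        by (auto split: list.splits prod.splits bool.splits com.splits)
      then show ?thesis using that Rewind Mark e all_stacks_next[OF e(2)] by (auto intro!: st)
    qed (use that Rewind e in \<open>auto intro: st\<close>)
  next
    case Carry
    then show ?thesis using that(2,3) sy sy2 st0 assms(5) by (cases g) (auto split: if_splits)
  next
    case (Extend j)
    have "j \<le> b" using that(1) Extend by (auto simp: compiled_def)
    with that(2,3) sy sy2 st0 assms(5) Extend show ?thesis by (cases j) auto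
  next
    case Return
    then show ?thesis using that(2,3) sy sy2 st0 by (cases g) auto
  next
    case Scan
    have "Ready e0 [(False, c0)] \<in> states ?M"
      by (rule st) (use assms(4) stacks_self[of c0 "[]"] in \<open>auto simp: all_stacks_def\<close>)
    then show ?thesis using that(2,3) sy sy2 st0 Scan by (auto split: if_splits)
  next
    case Boot
    then show ?thesis using that(2,3) sy sy2 st0 by auto
  qed
  have acc: "accept ?M \<subseteq> states ?M" by (auto simp: compiled_def all_stacks_def)
  have "finite (states ?M)" "finite (symbols ?M)"
    using fin assms by (auto simp: compiled_def)
  moreover have "delta ?M q i gs z = {}" if "q \<in> accept ?M" for q i gs z
    using that by (auto simp: compiled_def)
  moreover have "new_state a \<in> states ?M \<and> length (work_acts a) = tapes ?M \<and> fst ` set (work_acts a) \<subseteq> symbols ?M"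
    if q: "q \<in> states ?M" "length gs = tapes ?M" "set gs \<subseteq> symbols ?M" "a \<in> delta ?M q i gs z" for q gs a i z
  proof -
    have "hd gs \<in> symbols ?M" using q(2,3) by (cases gs) (auto simp: compiled_def)
    moreover obtain q' d g' d' o' where "(q', d, g', d', o') \<in> trans b l0 e0 c0 i (hd gs) q"
        "a = \<lparr> new_state = q', in_move = d, work_acts = [(g', d')], emit = o', ocmd = OIdle \<rparr>"
      using q(4) by (auto simp: compiled_def)
    ultimately show ?thesis using step[OF q(1)] by (auto simp: compiled_def)
  qed
  moreover have "blank ?M \<in> symbols ?M" "start ?M \<in> states ?M"
    using st0(1) sy(1) by (auto simp: compiled_def)
  ultimately show ?thesis unfolding wf_ntm_def using acc by (intro conjI allI impI; (elim conjE)?) blast+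
qed

lemma oracle_free_compiled: "oracle_free (compiled b l0 e0 E G c)"
  by (auto simp: oracle_free_def compiled_def)

section \<open>Contents of the work tape and loop counters\<close>

definition tape_of :: "'l sym list \<Rightarrow> nat \<Rightarrow> 'l sym" where
  "tape_of us i = (if i = 0 then Mark else if i \<le> length us then us ! (i - 1) else Blank)"

lemma tape_of_simps [simp]:
  "tape_of us 0 = Mark"
  "tape_of (us @ c # vs) (Suc (length us)) = c"
  "tape_of us (Suc (length us)) = Blank"
  "(tape_of us)(0 := Mark) = tape_of us"
  "(tape_of (us @ c # vs))(Suc (length us) := c') = tape_of (us @ c' # vs)"
  "(tape_of us)(Suc (length us) := Blank) = tape_of us"
  by (auto simp: tape_of_def fun_eq_iff nth_append nth_Cons split: nat.splits)

lemma tape_of_snoc: "(tape_of us)(Suc (length us) := c) = tape_of (us @ [c])"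
  by (auto simp: tape_of_def fun_eq_iff nth_append)

definition cells :: "'l list \<Rightarrow> (nat set \<times> nat) list \<Rightarrow> 'l sym list" where
  "cells w a = map2 (\<lambda>l (v, u). Cell l v u) w a"

lemma cells_simps [simp]:
  "cells [] a = []" "cells (l # w) ((v, u) # a) = Cell l v u # cells w a"
  "length (cells w a) = min (length w) (length a)"
  by (simp_all add: cells_def)

lemma cells_rev: "length w = length a \<Longrightarrow> cells (rev w) (rev a) = rev (cells w a)"
  by (simp add: cells_def zip_rev rev_map)

text \<open>Binary increment on track \<open>k\<close>, least significant bit first;
  \<open>True\<close> reports an overflow.\<close>

fun incr :: "nat \<Rightarrow> (nat set \<times> nat) list \<Rightarrow> bool \<times> (nat set \<times> nat) list" where
  "incr k [] = (True, [])"
| "incr k ((v, u) # a) =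
    (if k \<in> v then apsnd ((#) (v - {k}, u)) (incr k a) else (False, (insert k v, u) # a))"

fun loop_val :: "nat \<Rightarrow> (nat set \<times> nat) list \<Rightarrow> nat" where
  "loop_val k [] = 0"
| "loop_val k ((v, u) # a) = of_bool (k \<in> v) + 2 * loop_val k a"

definition erase :: "nat \<Rightarrow> (nat set \<times> nat) list \<Rightarrow> (nat set \<times> nat) list" where
  "erase k a = map (\<lambda>(v, u). (v - {k}, u)) a"

lemma incr_False: "incr k a = (False, a') \<Longrightarrow> loop_val k a' = Suc (loop_val k a)"
  by (induction k a arbitrary: a' rule: incr.induct) (auto simp: apsnd_def map_prod_def split: if_splits prod.splits)

text \<open>An overflow occurs only at the maximal value and leaves the track empty. Hence a loop
  runs its body exactly \<open>2 ^ length a\<close> times, and its track is ready when the loop is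
  entered again.\<close>

lemma incr_True: "incr k a = (True, a') \<Longrightarrow> Suc (loop_val k a) = 2 ^ length a \<and> a' = erase k a"
  by (induction k a arbitrary: a' rule: incr.induct)
    (auto simp: apsnd_def map_prod_def erase_def split: if_splits prod.splits)

text \<open>Expresses that the other tracks are untouched.\<close>

lemma erase_incr: "erase k (snd (incr k a)) = erase k a"
  by (induction k a rule: incr.induct) (auto simp: apsnd_def map_prod_def erase_def split: prod.splits)

lemma length_erase [simp]: "length (erase k a) = length a"
  by (simp add: erase_def)

lemma length_incr: "incr k a = (r, a') \<Longrightarrow> length a' = length a"
  using erase_incr[of k a] by (metis length_erase snd_conv)

lemma loop_val_less: "loop_val k a < 2 ^ length a"
  by (induction k a rule: loop_val.induct) auto

lemma loop_val_0: "\<forall>p\<in>set a. k \<notin> fst p \<Longrightarrow> loop_val k a = 0 \<and> erase k a = a"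
  by (induction k a rule: loop_val.induct) (auto simp: erase_def)

text \<open>Loops nested in a program use only tracks with an index above the depth at which it
  runs; these have to be zero when it starts.\<close>

definition idle_from :: "nat \<Rightarrow> (nat set \<times> nat) list \<Rightarrow> bool" where
  "idle_from k a \<longleftrightarrow> (\<forall>p\<in>set a. \<forall>i\<ge>k. i \<notin> fst p)"

text \<open>While the body of a loop runs, the track of the loop itself is occupied, and only deeper
  tracks are known to be free.\<close>

lemma idle_from_erase: "idle_from k (erase k a) \<Longrightarrow> idle_from (Suc k) a"
  unfolding idle_from_def erase_def
  by (auto simp: case_prod_unfold) (metis Suc_leD Suc_n_not_le_n fst_conv)

text \<open>
  The setup phase writes a binary counter whose digits 0 and 1 are separated by \<open>b - 1\<close> fillers 2;
  counting the input leaves a word of length \<open>b\<close> times the number of digits.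
\<close>

fun tick :: "nat \<Rightarrow> nat list \<Rightarrow> nat list" where
  "tick b [] = 1 # replicate (b - 1) 2"
| "tick b (y # ys) = (if y = 1 then 0 # tick b ys else if y = 0 then 1 # ys else y # tick b ys)"

fun tick_val :: "nat list \<Rightarrow> nat" where
  "tick_val [] = 0"
| "tick_val (y # ys) = (if y < 2 then y + 2 * tick_val ys else tick_val ys)"

fun digits :: "nat list \<Rightarrow> nat" where
  "digits [] = 0"
| "digits (y # ys) = (if y < 2 then Suc (digits ys) else digits ys)"

lemma tick_val_less: "tick_val ys < 2 ^ digits ys"
  by (induction ys) auto

lemma filler: "tick_val (replicate j 2) = 0" "digits (replicate j 2) = 0"
  by (induction j) auto

lemma tick_val_tick: "tick_val (tick b ys) = Suc (tick_val ys)"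
  by (induction b ys rule: tick.induct) (auto simp: filler)

text \<open>A digit, together with its fillers, is appended only when all present digits are 1, that
  is, when the value reaches a power of 2.\<close>

lemma tick_cases:
  "b \<ge> 1 \<Longrightarrow> (digits (tick b ys) = digits ys \<and> length (tick b ys) = length ys) \<or>
    (digits (tick b ys) = Suc (digits ys) \<and> length (tick b ys) = length ys + b \<and>
     Suc (tick_val ys) = 2 ^ digits ys)"
  by (induction b ys rule: tick.induct) (auto simp: filler)

text \<open>The number of digits is the binary length of \<open>i\<close>. The lower bound on
  \<open>2 ^ digits\<close> holds because the value fits into the digits, the upper one because
  digits are added only at powers of 2.\<close>

lemma ticks:
  assumes "b \<ge> 1"
  shows "tick_val ((tick b ^^ i) []) = i" "length ((tick b ^^ i) []) = b * digits ((tick b ^^ i) [])"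
    "i < 2 ^ digits ((tick b ^^ i) [])" "i > 0 \<Longrightarrow> 2 ^ digits ((tick b ^^ i) []) \<le> 2 * i"
proof -
  show v: "tick_val ((tick b ^^ i) []) = i" for i by (induction i) (auto simp: tick_val_tick)
  show "length ((tick b ^^ i) []) = b * digits ((tick b ^^ i) [])"
  proof (induction i)
    case (Suc i)
    then show ?case using tick_cases[OF assms, of "(tick b ^^ i) []"] by auto
  qed auto
  show "i < 2 ^ digits ((tick b ^^ i) [])" using tick_val_less[of "(tick b ^^ i) []"] v by simp
  show "i > 0 \<Longrightarrow> 2 ^ digits ((tick b ^^ i) []) \<le> 2 * i"
  proof (induction i)
    case (Suc i)
    then show ?case using tick_cases[OF assms, of "(tick b ^^ i) []"] v[of i] by (cases "i = 0") auto
  qed auto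
qed

lemma length_tick: "length ys \<le> length (tick b ys)"
  by (induction b ys rule: tick.induct) auto

lemma ticks_mono: "i \<le> j \<Longrightarrow> length ((tick b ^^ i) []) \<le> length ((tick b ^^ j) [])"
proof (induction j)
  case (Suc j)
  then show ?case using length_tick[of "(tick b ^^ j) []" b] by (cases "i = Suc j") auto
qed auto

text \<open>\<open>2 * S + 3\<close> steps are one pass in each direction plus three steps for
  leaving the mark, turning round, and arriving at the mark. \<open>Cond\<close> charges both
  branches, which is enough for an upper bound.\<close>

primrec cost :: "nat \<Rightarrow> ('e, 'l, 'a) com \<Rightarrow> nat" where
  "cost S (Basic h) = 1"
| "cost S (Sweep f g) = 2 * S + 3"
| "cost S (Seq c d) = 1 + cost S c + cost S d"
| "cost S (Cond b c d) = 1 + cost S c + cost S d"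
| "cost S (Loop c) = 1 + 2 ^ S * (cost S c + 2 * S + 3)"

section \<open>Computation trees of the compiled machine\<close>

definition machine_config :: "'q \<Rightarrow> nat \<Rightarrow> (nat \<Rightarrow> 'g) \<Rightarrow> nat \<Rightarrow> 'a list \<Rightarrow> ('q, 'g, 'a) config" where
  "machine_config q i t h u = \<lparr> cstate = q, in_pos = i, work = [(t, h)], out = u, otape = Answer [] 0 \<rparr>"

context
  fixes b :: nat and l0 :: 'l and e0 :: 'e and E :: "'e set" and G :: "'l set"
    and c0 :: "('e, 'l, 'a) com" and x :: "'a list" and Y :: "'a list set" and S :: nat
  assumes b: "b \<ge> 1"
begin

abbreviation tree :: "nat \<Rightarrow> (('e, 'l, 'a) ctl, 'l sym, 'a) config \<Rightarrow> nat \<Rightarrow> bool" where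
  "tree \<equiv> comp_tree Map.empty (compiled b l0 e0 E G c0) x Y (Suc S)"

lemma choices_compiled:
  "choices (compiled b l0 e0 E G c0) x (machine_config q i t h u) =
    (\<lambda>(q', d, g, d', b). \<lparr> new_state = q', in_move = d,
        work_acts = [(g, d')], emit = b, ocmd = OIdle \<rparr>) ` trans b l0 e0 c0 (read_cell x i) (t h) q"
  by (simp add: choices_def machine_config_def compiled_def)

lemma perform_compiled:
  "perform f x \<lparr> new_state = q', in_move = d, work_acts = [(g, d')], emit = ob, ocmd = OIdle \<rparr>
     (machine_config q i t h u) =
   Some (machine_config q' (mv_within x d i) (t(h := g)) (mv d' h)
     (u @ (case ob of None \<Rightarrow> [] | Some b \<Rightarrow> [b])))"
  by (simp add: perform_def machine_config_def)

lemma accept_compiled: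
  "cstate (machine_config q i t h u) \<in> accept (compiled b l0 e0 E G c0) \<longleftrightarrow> (\<exists>e\<in>E. q = Ready e [])"
  by (auto simp: machine_config_def compiled_def)

text \<open>All transitions except those of \<open>Basic\<close> and the advance of
  \<open>Scan\<close> have this form.\<close>

lemma tree_det:
  assumes "trans b l0 e0 c0 (read_cell x i) (t h) q = {(q', MStay, g, d', None)}"
    "\<And>e. q \<noteq> Ready e []" "h \<le> Suc S" "i \<le> Suc (length x)"
    "tree m (machine_config q' i (t(h := g)) (mv d' h) u) n"
  shows "tree (Suc m) (machine_config q i t h u) n"
proof (rule comp_tree_det)
  show "cstate (machine_config q i t h u) \<notin> accept (compiled b l0 e0 E G c0)"
    using assms(2) by (auto simp: accept_compiled)
  show "\<forall>(t, p)\<in>set (work (machine_config q i t h u)). p \<le> Suc S"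
    using assms(3) by (simp add: machine_config_def)
  have "mv_within x MStay i = i" using assms(4) by (simp add: mv_within_def)
  then show "perform Map.empty x \<lparr> new_state = q', in_move = MStay, work_acts = [(g, d')], emit = None, ocmd = OIdle \<rparr>
     (machine_config q i t h u) = Some (machine_config q' i (t(h := g)) (mv d' h) u)"
    by (simp add: perform_compiled)
qed (use assms in \<open>simp_all add: choices_compiled\<close>)

text \<open>Stated backwards, from the configuration after the pass to the one before it, because a
  tree describes what is still to come. The prefix \<open>us\<close> consists of the cells already
  passed.\<close>

lemma tree_fwd:
  assumes "i \<le> Suc (length x)" and K: "K = (False, Sweep f h) # ks"
  shows "pass f e w = (e', w') \<Longrightarrow> length a = length w \<Longrightarrow> length us + length w \<le> S \<Longrightarrow>
    tree m (machine_config (Fwd e' K) i (tape_of (us @ cells w' a)) (Suc (length us + length w)) u) n \<Longrightarrow>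
    tree (m + length w) (machine_config (Fwd e K) i (tape_of (us @ cells w a)) (Suc (length us)) u) n"
proof (induction w arbitrary: e us a w')
  case (Cons l w)
  obtain v y a1 where a: "a = (v, y) # a1" "length a1 = length w" using Cons.prems(2) by (cases a) auto
  obtain w1 where w1: "pass f (fst (f e l)) w = (e', w1)" "w' = snd (f e l) # w1"
    using Cons.prems(1) by (auto simp: Let_def split: prod.splits)
  let ?us = "us @ [Cell (snd (f e l)) v y]"
  have "tree (m + length w) (machine_config (Fwd (fst (f e l)) K) i (tape_of (?us @ cells w a1)) (Suc (length ?us)) u) n"
    by (rule Cons.IH[OF w1(1) a(2)]) (use Cons.prems a w1 in auto)
  then have *: "tree (m + length w) (machine_config (Fwd (fst (f e l)) K) i (tape_of (us @ Cell (snd (f e l)) v y # cells w a1)) (Suc (Suc (length us))) u) n"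
    by simp
  show ?case unfolding a(1) cells_simps list.size add_Suc_right
    by (rule tree_det[where g = "Cell (snd (f e l)) v y" and d' = MRight and q' = "Fwd (fst (f e l)) K"])
      (use Cons.prems assms * in auto)
qed auto

text \<open>Here \<open>w\<close> is listed in the order of reading, from right to left, which
  accounts for \<open>rev\<close> on the tape.\<close>

lemma tree_bwd:
  assumes "i \<le> Suc (length x)" and K: "K = (False, Sweep f h) # ks"
  shows "pass h e w = (e', w') \<Longrightarrow> length a = length w \<Longrightarrow> length w \<le> S \<Longrightarrow>
    tree m (machine_config (Bwd e' K) i (tape_of (rev (cells w' a) @ vs)) 0 u) n \<Longrightarrow>
    tree (m + length w) (machine_config (Bwd e K) i (tape_of (rev (cells w a) @ vs)) (length w) u) n"
proof (induction w arbitrary: e a w' vs)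
  case (Cons l w)
  obtain v y a1 where a: "a = (v, y) # a1" "length a1 = length w" using Cons.prems(2) by (cases a) auto
  obtain w1 where w1: "pass h (fst (h e l)) w = (e', w1)" "w' = snd (h e l) # w1"
    using Cons.prems(1) by (auto simp: Let_def split: prod.splits)
  let ?vs = "Cell (snd (h e l)) v y # vs" and ?us = "rev (cells w a1)"
  have *: "tree (m + length w) (machine_config (Bwd (fst (h e l)) K) i (tape_of (?us @ ?vs)) (length w) u) n"
    by (rule Cons.IH[OF w1(1) a(2)]) (use Cons.prems a w1 in auto)
  have l: "length ?us = length w" using a(2) by simp
  note tl = tape_of_simps(2,5)[of ?us, unfolded l]
  show ?case unfolding a(1) cells_simps list.size add_Suc_right rev.simps append_assoc append_Cons append_Nil
    by (rule tree_det[where g = "Cell (snd (h e l)) v y" and d' = MLeft and q' = "Bwd (fst (h e l)) K"])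
      (use Cons.prems assms * tl in auto)
qed auto

lemma tree_sweep:
  assumes i: "i \<le> Suc (length x)" and p: "pass f e w = (e1, w1)" "pass h e1 (rev w1) = (e2, w2)"
    and l: "length a = S" "length w = S" "length w1 = S" "length w2 = S"
    and t: "tree m (machine_config (Ready e2 ks) i (tape_of (cells (rev w2) a)) 0 u) n"
  shows "tree (m + (2 * S + 3)) (machine_config (Ready e ((False, Sweep f h) # ks)) i (tape_of (cells w a)) 0 u) n"
proof -
  let ?K = "(False, Sweep f h) # ks"
  have "tree (Suc m) (machine_config (Bwd e2 ?K) i (tape_of (cells (rev w2) a)) 0 u) n"
    by (rule tree_det[where g = Mark and d' = MStay and q' = "Ready e2 ks"]) (use i t in auto)
  then have "tree (Suc m) (machine_config (Bwd e2 ?K) i (tape_of (rev (cells w2 (rev a)) @ [])) 0 u) n"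
    using cells_rev[of w2 "rev a"] l by simp
  from tree_bwd[OF i refl p(2) _ _ this] l
  have "tree (Suc m + S) (machine_config (Bwd e1 ?K) i (tape_of (rev (cells (rev w1) (rev a)))) S u) n" by simp
  then have 1: "tree (Suc m + S) (machine_config (Bwd e1 ?K) i (tape_of (cells w1 a)) S u) n"
    using cells_rev[of w1 a] l by simp
  have c: "length (cells w1 a) = S" using l by simp
  note tl = tape_of_simps(3,6)[of "cells w1 a", unfolded c]
  have "tree (Suc (Suc m + S)) (machine_config (Fwd e1 ?K) i (tape_of (cells w1 a)) (Suc S) u) n"
    by (rule tree_det[where g = Blank and d' = MLeft and q' = "Bwd e1 ?K"]) (use i 1 tl in auto)
  with tree_fwd[OF i refl p(1), of a "[]" "Suc (Suc m + S)" h ks u n] l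
  have "tree (Suc (Suc m + S) + S) (machine_config (Fwd e ?K) i (tape_of (cells w a)) (Suc 0) u) n"
    by simp
  then have "tree (Suc (Suc (Suc m + S) + S)) (machine_config (Ready e ?K) i (tape_of (cells w a)) 0 u) n"
    by (intro tree_det[where g = Mark and d' = MRight and q' = "Fwd e ?K"]) (use i in auto)
  then show ?thesis by (rule comp_tree_mono) simp
qed

lemma tree_leftwards:
  assumes i: "i \<le> Suc (length x)"
    and q: "\<And>e. q \<noteq> Ready e []"
      "\<And>l v y. trans b l0 e0 c0 (read_cell x i) (Cell l v y) q = {(q, MStay, Cell l v y, MLeft, None)}"
  shows "\<forall>c\<in>set us. \<exists>l v u. c = Cell l v u \<Longrightarrow> length us \<le> S \<Longrightarrow>
    tree m (machine_config q i (tape_of (us @ vs)) 0 u) n \<Longrightarrow>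
    tree (m + length us) (machine_config q i (tape_of (us @ vs)) (length us) u) n"
proof (induction us arbitrary: vs rule: rev_induct)
  case (snoc c us)
  obtain l v y where c: "c = Cell l v y" using snoc.prems(1) by auto
  have "tree (m + length us) (machine_config q i (tape_of (us @ c # vs)) (length us) u) n"
    by (rule snoc.IH) (use snoc.prems in auto)
  then have "tree (Suc (m + length us)) (machine_config q i (tape_of (us @ c # vs)) (Suc (length us)) u) n"
    by (intro tree_det[where g = c and d' = MLeft and q' = q]) (use snoc.prems(2) i q c in auto)
  then show ?case by simp
qed auto

text \<open>The head crosses at most \<open>w\<close> before it turns, and then has to come back
  over \<open>us\<close> as well.\<close>

lemma tree_incr:
  assumes i: "i \<le> Suc (length x)" and k: "k = length K"
  shows "incr k a = (r, a') \<Longrightarrow> length a = length w \<Longrightarrow> length us + length w \<le> S \<Longrightarrow>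
    \<forall>c\<in>set us. \<exists>l v u. c = Cell l v u \<Longrightarrow>
    tree m (machine_config (Rewind r e K) i (tape_of (us @ cells w a')) 0 u) n \<Longrightarrow>
    tree (m + 2 * length w + length us + 1) (machine_config (Incr e K) i (tape_of (us @ cells w a)) (Suc (length us)) u) n"
proof (induction a arbitrary: w us a')
  case Nil
  then have "tree (m + length us) (machine_config (Rewind True e K) i (tape_of (us @ [])) (length us) u) n"
    by (intro tree_leftwards) (use i in auto)
  with Nil show ?case
    by (auto intro!: tree_det[where g = Blank and d' = MLeft and q' = "Rewind True e K"] i)
next
  case (Cons p a)
  obtain v y where p: "p = (v, y)" by fastforce
  obtain l w1 where w: "w = l # w1" "length a = length w1" using Cons.prems(2) by (cases w) auto
  show ?case
  proof (cases "k \<in> v")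
    case True
    then obtain a1 where a1: "incr k a = (r, a1)" "a' = (v - {k}, y) # a1"
      using Cons.prems(1) p by (auto simp: apsnd_def map_prod_def split: prod.splits)
    let ?c = "Cell l (v - {k}) y"
    have "tree (m + 2 * length w1 + length (us @ [?c]) + 1)
        (machine_config (Incr e K) i (tape_of ((us @ [?c]) @ cells w1 a)) (Suc (length (us @ [?c]))) u) n"
      by (rule Cons.IH[OF a1(1) w(2)]) (use Cons.prems w p a1 in auto)
    then have *: "tree (m + 2 * length w1 + length us + 2)
        (machine_config (Incr e K) i (tape_of (us @ ?c # cells w1 a)) (Suc (Suc (length us))) u) n"
      by simp
    have "tree (Suc (m + 2 * length w1 + length us + 2))
        (machine_config (Incr e K) i (tape_of (us @ cells w (p # a))) (Suc (length us)) u) n"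
      by (rule tree_det[where g = ?c and d' = MRight and q' = "Incr e K"])
        (use Cons.prems * w i p k True in auto)
    then show ?thesis by (rule comp_tree_mono) (simp add: w)
  next
    case False
    let ?c = "Cell l (insert k v) y"
    have r: "r = False" "a' = (insert k v, y) # a" using Cons.prems(1) p False by auto
    have "tree (m + length us) (machine_config (Rewind False e K) i (tape_of (us @ ?c # cells w1 a)) (length us) u) n"
      by (rule tree_leftwards) (use i Cons.prems r w in auto)
    then have "tree (Suc (m + length us)) (machine_config (Incr e K) i (tape_of (us @ cells w (p # a))) (Suc (length us)) u) n"
      by (intro tree_det[where g = ?c and d' = MLeft and q' = "Rewind False e K"])
        (use Cons.prems w i p k False in auto)
    then show ?thesis by (rule comp_tree_mono) simp
  qed
qed

definition valid :: "('e, 'l, 'a) store \<Rightarrow> bool" where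
  "valid s \<longleftrightarrow> (case s of (e, i, w, u) \<Rightarrow> e \<in> E \<and> i \<le> Suc (length x) \<and> set w \<subseteq> G \<and> length w = S)"

definition ready :: "('e, 'l, 'a) stack \<Rightarrow> (nat set \<times> nat) list \<Rightarrow> ('e, 'l, 'a) store
    \<Rightarrow> (('e, 'l, 'a) ctl, 'l sym, 'a) config" where
  "ready ks a s = (case s of (e, i, w, u) \<Rightarrow> machine_config (Ready e ks) i (tape_of (cells w a)) 0 u)"

lemma tree_ready:
  assumes "trans b l0 e0 c0 (read_cell x i) Mark (Ready e (p # ks)) = {(Ready e' ks', MStay, Mark, MStay, None)}"
    "valid (e, i, w, u)" "tree m (ready ks' a (e', i, w, u)) n"
  shows "tree (Suc m) (ready (p # ks) a (e, i, w, u)) n"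
  unfolding ready_def prod.case
  by (rule tree_det) (use assms in \<open>auto simp: ready_def valid_def\<close>)

lemma idle_from_mono: "idle_from k a \<Longrightarrow> k \<le> k' \<Longrightarrow> idle_from k' a"
  by (auto simp: idle_from_def)

lemma tree_loop_back:
  assumes v: "valid (e, i, w, u)" and a: "length a = S"
    and inc: "incr (Suc (length ks)) a = (r, a')"
    and t: "tree m (ready (if r then ks else (False, c) # (True, c) # ks) a' (e, i, w, u)) n"
  shows "tree (m + (2 * S + 3)) (ready ((True, c) # ks) a (e, i, w, u)) n"
proof -
  let ?K = "(True, c) # ks"
  have i: "i \<le> Suc (length x)" and w: "length w = S" using v by (auto simp: valid_def)
  have "tree (Suc m) (machine_config (Rewind r e ?K) i (tape_of (cells w a')) 0 u) n"
    by (rule tree_det) (use i t in \<open>auto simp: ready_def\<close>)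
  with tree_incr[OF i, of "Suc (length ks)" ?K a r a' w "[]" "Suc m" e u n] a w inc
  have "tree (Suc m + 2 * S + 1) (machine_config (Incr e ?K) i (tape_of (cells w a)) (Suc 0) u) n" by simp
  then have "tree (Suc (Suc m + 2 * S + 1)) (machine_config (Ready e ?K) i (tape_of (cells w a)) 0 u) n"
    by (intro tree_det[where g = Mark and d' = MRight and q' = "Incr e ?K"]) (use i in auto)
  then show ?thesis unfolding ready_def prod.case by (rule comp_tree_mono) simp
qed

text \<open>Correctness of the compiler in continuation form: trees for all stores after
  \<open>c\<close>, with counts \<open>\<kappa>\<close>, yield a tree before \<open>c\<close> with
  count \<open>wt x c \<kappa>\<close>. Trees are required for every valid store since nothing is
  known about what \<open>c\<close> computes. The hypothesis on \<open>a\<close> keeps the counters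
  of loops inside \<open>c\<close> apart from those of enclosing loops.\<close>

theorem tree_exec:
  "closed_com E G c \<Longrightarrow> length a = S \<Longrightarrow> idle_from (Suc (length ks)) a \<Longrightarrow> valid s \<Longrightarrow>
    (\<And>s. valid s \<Longrightarrow> tree m (ready ks a s) (\<kappa> s)) \<Longrightarrow>
    tree (m + cost S c) (ready ((False, c) # ks) a s) (wt x c \<kappa> s)"
proof (induction c arbitrary: ks a s \<kappa> m)
  case (Basic h)
  obtain e i w u where s: "s = (e, i, w, u)" by (cases s)
  have v: "e \<in> E" "i \<le> Suc (length x)" "set w \<subseteq> G" "length w = S" using Basic.prems(4) s by (auto simp: valid_def)
  let ?H = "h e (read_cell x i)" and ?M = "compiled b l0 e0 E G c0"
  let ?c = "machine_config (Ready e ((False, Basic h) # ks)) i (tape_of (cells w a)) 0 u"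
  let ?mk = "\<lambda>(e', d, ob). \<lparr>new_state = Ready e' ks, in_move = d, work_acts = [(Mark :: 'l sym, MStay)], emit = ob, ocmd = OIdle\<rparr>"
  let ?s = "\<lambda>(e', d, ob). (e', mv_within x d i, w, u @ (case ob of None \<Rightarrow> [] | Some b \<Rightarrow> [b]))"
  \<comment> \<open>The continuation store can be read off the action, so the sum over actions
    becomes the sum over the outcomes of \<open>h\<close>; the injectivity below guarantees that no
    outcomes are merged.\<close>
  let ?g = "\<lambda>act. \<kappa> (?s (case new_state act of Ready e' _ \<Rightarrow> e', in_move act, emit act))"
  have ch: "choices ?M x ?c = ?mk ` ?H"
    by (simp add: choices_compiled image_image case_prod_unfold)
  have fin: "finite ?H" "fst ` ?H \<subseteq> E" using Basic.prems(1) v by auto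
  have inj: "inj_on ?mk ?H" by (auto simp: inj_on_def)
  show ?case unfolding s ready_def prod.case cost.simps add_Suc_right One_nat_def add_0_right
  proof (rule comp_tree.node[where g = ?g])
    show "\<forall>(t, p)\<in>set (work ?c). p \<le> Suc S" by (simp add: machine_config_def)
    show "finite (choices ?M x ?c)" unfolding ch using fin by simp
    have na: "cstate ?c \<notin> accept ?M" by (simp add: accept_compiled)
    then show "cstate ?c \<in> accept ?M \<Longrightarrow> choices ?M x ?c = {}" by blast
    show "\<forall>act\<in>choices ?M x ?c. \<exists>c'. perform Map.empty x act ?c = Some c' \<and> tree m c' (?g act)"
      unfolding ch
    proof
      fix act assume "act \<in> ?mk ` ?H"
      then obtain e' d ob where act: "act = ?mk (e', d, ob)" "(e', d, ob) \<in> ?H" by auto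
      then have "valid (?s (e', d, ob))" using fin v imageI[OF act(2), of fst] by (auto simp: valid_def mv_within_def)
      from Basic.prems(5)[OF this] show "\<exists>c'. perform Map.empty x act ?c = Some c' \<and> tree m c' (?g act)"
        by (simp add: act perform_compiled ready_def)
    qed
    have "(\<Sum>act\<in>?mk ` ?H. ?g act) = (\<Sum>p\<in>?H. ?g (?mk p))"
      using sum.reindex[OF inj, of ?g] by simp
    also have "\<dots> = (\<Sum>p\<in>?H. \<kappa> (?s p))" by (intro sum.cong) (auto split: prod.splits)
    also have "\<dots> = wt x (Basic h) \<kappa> (e, i, w, u)"
      by (auto simp: case_prod_unfold intro!: sum.cong)
    finally show "wt x (Basic h) \<kappa> (e, i, w, u) = (if cstate ?c \<in> accept ?M \<and> out ?c \<in> Y then 1 else 0) +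
        (\<Sum>act\<in>choices ?M x ?c. ?g act)"
      unfolding ch using na by simp
  qed
next
  case (Sweep f h)
  obtain e i w u where s: "s = (e, i, w, u)" by (cases s)
  have v: "e \<in> E" "i \<le> Suc (length x)" "set w \<subseteq> G" "length w = S" using Sweep.prems(4) s by (auto simp: valid_def)
  obtain e1 w1 where p1: "pass f e w = (e1, w1)" by fastforce
  obtain e2 w2 where p2: "pass h e1 (rev w1) = (e2, w2)" by fastforce
  have fh: "f e l \<in> E \<times> G" "h e l \<in> E \<times> G" if "e \<in> E" "l \<in> G" for e l using Sweep.prems(1) that by auto
  have 1: "e1 \<in> E \<and> set w1 \<subseteq> G \<and> length w1 = length w" by (rule pass_closed[OF fh(1) v(1,3) p1])
  then have 2: "e2 \<in> E \<and> set w2 \<subseteq> G \<and> length w2 = length (rev w1)"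
    by (intro pass_closed[OF fh(2) _ _ p2]) auto
  have "valid (e2, i, rev w2, u)" using 1 2 v by (auto simp: valid_def)
  from Sweep.prems(5)[OF this]
  have "tree m (machine_config (Ready e2 ks) i (tape_of (cells (rev w2) a)) 0 u) (\<kappa> (e2, i, rev w2, u))"
    by (simp add: ready_def)
  from tree_sweep[OF v(2) p1 p2 Sweep.prems(2) v(4) _ _ this] 1 2 v
  show ?case by (simp add: s ready_def p1 p2)
next
  case (Seq c d)
  obtain e i w u where s: "s = (e, i, w, u)" by (cases s)
  have "tree (m + cost S d + cost S c) (ready ((False, c) # (False, d) # ks) a s) (wt x c (wt x d \<kappa>) s)"
  proof (rule Seq.IH(1))
    show "idle_from (Suc (length ((False, d) # ks))) a" using Seq.prems(3) by (rule idle_from_mono) simp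
    show "tree (m + cost S d) (ready ((False, d) # ks) a s') (wt x d \<kappa> s')" if "valid s'" for s'
      by (rule Seq.IH(2)) (use Seq.prems that in auto)
  qed (use Seq.prems in auto)
  then have "tree (Suc (m + cost S d + cost S c)) (ready ((False, Seq c d) # ks) a s) (wt x (Seq c d) \<kappa> s)"
    unfolding s by (intro tree_ready) (use Seq.prems s in auto)
  then show ?case by (rule comp_tree_mono) simp
next
  case (Cond t c d)
  obtain e i w u where s: "s = (e, i, w, u)" by (cases s)
  let ?c = "if t e then c else d"
  have "tree (m + cost S ?c) (ready ((False, ?c) # ks) a s) (wt x ?c \<kappa> s)"
    using Cond.IH[of a ks s m \<kappa>] Cond.prems by auto
  then have "tree (Suc (m + cost S ?c)) (ready ((False, Cond t c d) # ks) a s) (wt x ?c \<kappa> s)"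
    unfolding s by (intro tree_ready) (use Cond.prems s in auto)
  then have "tree (m + cost S (Cond t c d)) (ready ((False, Cond t c d) # ks) a s) (wt x ?c \<kappa> s)"
    by (rule comp_tree_mono) simp
  moreover have "wt x ?c \<kappa> s = wt x (Cond t c d) \<kappa> s" by (simp add: s)
  ultimately show ?case by simp
next
  case (Loop c)
  let ?k = "Suc (length ks)"
  let ?t = "cost S c + 2 * S + 3"
  \<comment> \<open>Here \<open>r\<close> is the number of increments left before the counter
    overflows; with the body on top of the stack, \<open>Suc r\<close> executions of it
    remain.\<close>
  have *: "tree (m + Suc r * ?t) (ready ((False, c) # (True, c) # ks) a' s) ((wt x c ^^ Suc r) \<kappa> s)"
    if "erase ?k a' = a" "Suc (loop_val ?k a' + r) = 2 ^ S" "valid s" for r a' s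
    using that
  proof (induction r arbitrary: a' s)
    case 0
    have l: "length a' = S" using 0(1) Loop.prems(2) by (metis length_erase)
    have id: "idle_from (Suc ?k) a'" by (rule idle_from_erase) (use 0 Loop.prems in simp)
    obtain r a2 where inc: "incr ?k a' = (r, a2)" by fastforce
    have "r" using incr_False[of ?k a' a2] loop_val_less[of ?k a2] 0(2) inc length_incr[OF inc] l
      by (cases r) auto
    then have a2: "a2 = a" using incr_True inc 0(1) by auto
    have "tree (m + (2 * S + 3) + cost S c) (ready ((False, c) # (True, c) # ks) a' s) (wt x c \<kappa> s)"
    proof (rule Loop.IH)
      show "tree (m + (2 * S + 3)) (ready ((True, c) # ks) a' s') (\<kappa> s')" if "valid s'" for s'
      proof (cases s')
        case (fields e i w u)
        show ?thesis unfolding fields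
          by (rule tree_loop_back[OF _ l inc]) (use that fields a2 \<open>r\<close> Loop.prems(5) in auto)
      qed
    qed (use Loop.prems id l 0 in auto)
    then show ?case by (simp add: algebra_simps)
  next
    case (Suc r)
    have l: "length a' = S" using Suc.prems(1) Loop.prems(2) by (metis length_erase)
    have id: "idle_from (Suc ?k) a'" by (rule idle_from_erase) (use Suc.prems Loop.prems in simp)
    obtain r' a2 where inc: "incr ?k a' = (r', a2)" by fastforce
    have nr: "\<not> r'" using incr_True[of ?k a' a2] Suc.prems(2) inc l by auto
    then have a2: "erase ?k a2 = a" "loop_val ?k a2 = Suc (loop_val ?k a')"
      using incr_False[of ?k a' a2] inc erase_incr[of ?k a'] Suc.prems(1) by auto
    have "tree (m + Suc r * ?t + (2 * S + 3) + cost S c) (ready ((False, c) # (True, c) # ks) a' s)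
        (wt x c ((wt x c ^^ Suc r) \<kappa>) s)"
    proof (rule Loop.IH)
      show "tree (m + Suc r * ?t + (2 * S + 3)) (ready ((True, c) # ks) a' s') ((wt x c ^^ Suc r) \<kappa> s')"
        if "valid s'" for s'
      proof (cases s')
        case (fields e i w u)
        have "tree (m + Suc r * ?t) (ready ((False, c) # (True, c) # ks) a2 s') ((wt x c ^^ Suc r) \<kappa> s')"
          by (rule Suc.IH) (use a2 Suc.prems that in auto)
        then show ?thesis unfolding fields
          by (intro tree_loop_back[OF _ l inc]) (use that fields nr in auto)
      qed
    qed (use Loop.prems id l Suc.prems in auto)
    then show ?case unfolding funpow.simps(2)[of "Suc r"] o_def by (rule comp_tree_mono) simp
  qed
  obtain e i w u where s: "s = (e, i, w, u)" by (cases s)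
  have z: "loop_val ?k a = 0" "erase ?k a = a"
    using loop_val_0[of a ?k] Loop.prems(3) by (auto simp: idle_from_def)
  obtain N where N: "2 ^ S = Suc N" by (metis not0_implies_Suc power_not_zero zero_neq_numeral)
  have "tree (m + Suc N * ?t) (ready ((False, c) # (True, c) # ks) a s) ((wt x c ^^ Suc N) \<kappa> s)"
    by (rule *) (use z N Loop.prems in auto)
  then have "tree (Suc (m + Suc N * ?t)) (ready ((False, Loop c) # ks) a s) ((wt x c ^^ Suc N) \<kappa> s)"
    unfolding s by (intro tree_ready) (use Loop.prems s in auto)
  moreover have "wt x (Loop c) \<kappa> s = (wt x c ^^ Suc N) \<kappa> s"
    using Loop.prems(4) N by (simp add: s valid_def del: funpow.simps)
  moreover have "Suc (m + Suc N * ?t) = m + cost S (Loop c)" using N by simp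
  ultimately show ?case by (simp only:)
qed

section \<open>The setup phase\<close>

abbreviation setup_tape :: "nat list \<Rightarrow> nat \<Rightarrow> 'l sym" where
  "setup_tape ys \<equiv> tape_of (map (Cell l0 {}) ys)"

lemma tree_extend:
  assumes i: "i \<le> Suc (length x)"
  shows "length us + j \<le> S \<Longrightarrow> \<forall>c\<in>set us. \<exists>l v u. c = Cell l v u \<Longrightarrow>
    tree m (machine_config Return i (tape_of (us @ replicate j (Cell l0 {} 2))) 0 u) n \<Longrightarrow>
    tree (m + length us + 2 * j + 1) (machine_config (Extend j) i (tape_of us) (Suc (length us)) u) n"
proof (induction j arbitrary: us)
  case 0
  then have "tree (m + length us) (machine_config Return i (tape_of (us @ [])) (length us) u) n"
    by (intro tree_leftwards) (use i in auto)
  then have "tree (Suc (m + length us)) (machine_config (Extend 0) i (tape_of us) (Suc (length us)) u) n"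
    by (intro tree_det) (use 0 i in auto)
  then show ?case by simp
next
  case (Suc j)
  let ?us = "us @ [Cell l0 {} 2]"
  have "tree (m + length ?us + 2 * j + 1) (machine_config (Extend j) i (tape_of ?us) (Suc (length ?us)) u) n"
    by (rule Suc.IH) (use Suc.prems in auto)
  then have "tree (Suc (m + length ?us + 2 * j + 1)) (machine_config (Extend (Suc j)) i (tape_of us) (Suc (length us)) u) n"
    by (intro tree_det) (use Suc.prems i in \<open>auto simp: tape_of_snoc\<close>)
  then show ?case by (rule comp_tree_mono) simp
qed

lemma tree_carry:
  assumes i: "i \<le> Suc (length x)"
  shows "length us + length (tick b ys) \<le> S \<Longrightarrow> \<forall>c\<in>set us. \<exists>l v u. c = Cell l v u \<Longrightarrow>
    tree m (machine_config Return i (tape_of (us @ map (Cell l0 {}) (tick b ys))) 0 u) n \<Longrightarrow>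
    tree (m + length us + 2 * length (tick b ys) + 1)
      (machine_config Carry i (tape_of (us @ map (Cell l0 {}) ys)) (Suc (length us)) u) n"
proof (induction ys arbitrary: us)
  case Nil
  let ?us = "us @ [Cell l0 {} 1]"
  have "tree (m + length ?us + 2 * (b - 1) + 1) (machine_config (Extend (b - 1)) i (tape_of ?us) (Suc (length ?us)) u) n"
    by (rule tree_extend) (use Nil i in \<open>auto simp: map_replicate_const\<close>)
  then have "tree (Suc (m + length ?us + 2 * (b - 1) + 1)) (machine_config Carry i (tape_of us) (Suc (length us)) u) n"
    by (intro tree_det) (use Nil i in \<open>auto simp: tape_of_snoc\<close>)
  then show ?case unfolding list.map append_Nil2 by (rule comp_tree_mono) (use b in simp)
next
  case (Cons y ys)
  show ?case
  proof (cases "y = 0")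
    case True
    have "tree (m + length us) (machine_config Return i (tape_of (us @ Cell l0 {} 1 # map (Cell l0 {}) ys)) (length us) u) n"
      by (rule tree_leftwards) (use i Cons.prems True in auto)
    then have "tree (Suc (m + length us)) (machine_config Carry i (tape_of (us @ map (Cell l0 {}) (y # ys))) (Suc (length us)) u) n"
      by (intro tree_det[where g = "Cell l0 {} 1"]) (use Cons.prems i True in auto)
    then show ?thesis by (rule comp_tree_mono) simp
  next
    case False
    let ?y = "if y = 1 then 0 else y"
    let ?us = "us @ [Cell l0 {} ?y]"
    have "tree (m + length ?us + 2 * length (tick b ys) + 1)
      (machine_config Carry i (tape_of (?us @ map (Cell l0 {}) ys)) (Suc (length ?us)) u) n"
      by (rule Cons.IH) (use Cons.prems False in \<open>auto split: if_splits\<close>)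
    then have *: "tree (m + length us + 2 * length (tick b ys) + 2)
      (machine_config Carry i (tape_of (us @ Cell l0 {} ?y # map (Cell l0 {}) ys)) (Suc (Suc (length us))) u) n"
      by simp
    have "tree (Suc (m + length us + 2 * length (tick b ys) + 2))
        (machine_config Carry i (tape_of (us @ map (Cell l0 {}) (y # ys))) (Suc (length us)) u) n"
      by (rule tree_det[where g = "Cell l0 {} ?y" and d' = MRight and q' = Carry])
        (use Cons.prems i False * in auto)
    then show ?thesis by (rule comp_tree_mono) (use False in auto)
  qed
qed

text \<open>Induction from the right end of the input backwards: the position of the input head is
  at the same time the number of ticks made. Each tick costs at most two passes because lengths only
  grow towards \<open>S\<close>.\<close>

lemma tree_scan:
  assumes S: "S = length ((tick b ^^ Suc (length x)) [])"
    and fin: "tree m (machine_config (Ready e0 [(False, c0)]) (Suc (length x))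
      (setup_tape ((tick b ^^ Suc (length x)) [])) 0 []) n"
  shows "i \<le> Suc (length x) \<Longrightarrow>
    tree (m + 1 + (Suc (length x) - i) * (2 * S + 3)) (machine_config Scan i (setup_tape ((tick b ^^ i) [])) 0 []) n"
proof (induction i rule: inc_induct)
  case base
  have "tree (Suc m) (machine_config Scan (Suc (length x)) (setup_tape ((tick b ^^ Suc (length x)) [])) 0 []) n"
    by (rule tree_det[where g = Mark and d' = MStay and q' = "Ready e0 [(False, c0)]"])
      (use fin in \<open>auto simp: read_cell_def\<close>)
  then show ?case by simp
next
  case (step i)
  let ?ys = "(tick b ^^ i) []"
  have l: "length (tick b ?ys) \<le> S" unfolding S using ticks_mono[of "Suc i" "Suc (length x)" b] step.hyps by simp
  let ?m = "m + 1 + (Suc (length x) - Suc i) * (2 * S + 3)"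
  have "tree ?m (machine_config Scan (Suc i) (setup_tape (tick b ?ys)) 0 []) n" using step.IH by simp
  then have "tree (Suc ?m) (machine_config Return (Suc i) (setup_tape (tick b ?ys)) 0 []) n"
    by (intro tree_det[where g = Mark and d' = MStay and q' = Scan]) (use step.hyps in auto)
  with tree_carry[of "Suc i" "[]" ?ys "Suc ?m" "[]" n] step.hyps l
  have c: "tree (Suc ?m + 2 * length (tick b ?ys) + 1) (machine_config Carry (Suc i) (setup_tape ?ys) (Suc 0) []) n"
    by simp
  have z: "read_cell x i \<noteq> RightEnd" using step.hyps by (auto simp: read_cell_def)
  have "tree (Suc (Suc ?m + 2 * length (tick b ?ys) + 1)) (machine_config Scan i (setup_tape ?ys) 0 []) n"
  proof (rule comp_tree_det)
    show "choices (compiled b l0 e0 E G c0) x (machine_config Scan i (setup_tape ?ys) 0 []) =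
      {\<lparr>new_state = Carry, in_move = MRight, work_acts = [(Mark, MRight)], emit = None, ocmd = OIdle\<rparr>}"
      using z by (simp add: choices_compiled)
    show "perform Map.empty x \<lparr>new_state = Carry, in_move = MRight, work_acts = [(Mark, MRight)], emit = None, ocmd = OIdle\<rparr>
       (machine_config Scan i (setup_tape ?ys) 0 []) = Some (machine_config Carry (Suc i) (setup_tape ?ys) (Suc 0) [])"
      using step.hyps by (simp add: perform_compiled mv_within_def)
  qed (use c in \<open>auto simp: accept_compiled, auto simp: machine_config_def\<close>)
  moreover have "Suc (length x) - i = Suc (Suc (length x) - Suc i)" using step.hyps by simp
  ultimately show ?case by (auto elim!: comp_tree_mono simp del: funpow.simps simp: l)
qed

theorem tree_compiled:
  assumes S: "S = length ((tick b ^^ Suc (length x)) [])"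
    and c0: "closed_com E G c0" and "e0 \<in> E" "l0 \<in> G"
  shows "tree (Suc (length x) * (2 * S + 3) + cost S c0 + 3) (init_config (compiled b l0 e0 E G c0))
     (wt x c0 (\<lambda>(e, i, w, u). if u \<in> Y then 1 else 0) (e0, Suc (length x), replicate S l0, []))"
proof -
  let ?ys = "(tick b ^^ Suc (length x)) []"
  let ?a = "map (Pair {}) ?ys" and ?\<kappa> = "\<lambda>(e, i, w, u). if u \<in> Y then 1 else 0 :: nat"
  let ?s = "(e0, Suc (length x), replicate S l0, [])"
  have la: "length ?a = S" using S by simp
  have leaf: "tree 1 (ready [] ?a s) (?\<kappa> s)" if "valid s" for s
  proof -
    obtain e i w u where s: "s = (e, i, w, u)" by (cases s)
    have e: "e \<in> E" using that s by (simp add: valid_def)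
    show ?thesis unfolding s ready_def prod.case One_nat_def
      by (rule comp_tree.node[where g = "\<lambda>_. 0"])
        (use e in \<open>auto simp: choices_compiled compiled_def machine_config_def choices_def\<close>)
  qed
  have "tree (1 + cost S c0) (ready [(False, c0)] ?a ?s) (wt x c0 ?\<kappa> ?s)"
    by (rule tree_exec[OF c0 la _ _ leaf]) (use assms(3,4) in \<open>auto simp: idle_from_def valid_def\<close>)
  \<comment> \<open>What the setup leaves behind is already a word of \<open>S\<close> letters
    \<open>l0\<close> with all loop counters zero; the digits simply stay in their component of the
    cells.\<close>
  moreover have "cells (replicate S l0) ?a = map (Cell l0 {}) ?ys"
    unfolding S cells_def by (intro nth_equalityI) auto
  ultimately have "tree (1 + cost S c0) (machine_config (Ready e0 [(False, c0)]) (Suc (length x))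
      (setup_tape ?ys) 0 []) (wt x c0 ?\<kappa> ?s)"
    by (simp add: ready_def del: funpow.simps)
  from tree_scan[OF S this, of 0]
  have 1: "tree (1 + cost S c0 + 1 + Suc (length x) * (2 * S + 3)) (machine_config Scan 0 (setup_tape []) 0 [])
      (wt x c0 ?\<kappa> ?s)" by simp
  have t: "(\<lambda>_. Blank)(0 := Mark) = setup_tape []" by (auto simp: tape_of_def)
  have "tree (Suc (1 + cost S c0 + 1 + Suc (length x) * (2 * S + 3))) (machine_config Boot 0 (\<lambda>_. Blank) 0 [])
      (wt x c0 ?\<kappa> ?s)"
    by (rule tree_det[where g = Mark and d' = MStay and q' = Scan]) (use 1 t in auto)
  moreover have "machine_config Boot 0 (\<lambda>_. Blank) 0 [] = init_config (compiled b l0 e0 E G c0)"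
    by (simp add: machine_config_def init_config_def compiled_def)
  ultimately show ?thesis by (auto elim!: comp_tree_mono simp del: funpow.simps)
qed

end

section \<open>Polynomial time and logarithmic space of compiled programs\<close>

lemma sum_poly_bound:
  fixes N :: nat
  assumes "N \<ge> 1" "k \<le> C * N ^ D" "k' \<le> C' * N ^ D'"
  shows "1 + k + k' \<le> (1 + C + C') * N ^ (D + D')"
proof -
  have "N ^ D \<le> N ^ (D + D')" "N ^ D' \<le> N ^ (D + D')" using assms(1) by (auto intro: power_increasing)
  then have "C * N ^ D \<le> C * N ^ (D + D')" "C' * N ^ D' \<le> C' * N ^ (D + D')" by simp_all
  moreover have "1 \<le> N ^ (D + D')" using assms(1) by simp
  ultimately have "1 + k + k' \<le> N ^ (D + D') + C * N ^ (D + D') + C' * N ^ (D + D')"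
    using assms(2,3) by linarith
  then show ?thesis by (simp add: algebra_simps)
qed

text \<open>Measured in \<open>2 ^ S\<close>, because every level of loop nesting contributes such a
  factor; the degree depends on the program only.\<close>

lemma cost_poly: "\<exists>C D. \<forall>S. cost S c \<le> C * (2 ^ S) ^ D"
proof (induction c)
  case (Basic h)
  show ?case by (rule exI[of _ 1], rule exI[of _ 0]) simp
next
  case (Sweep f g)
  have "2 * S + 3 \<le> 5 * (2 ^ S) ^ 1" for S :: nat
    using less_exp[of S] unfolding power_one_right by linarith
  then show ?case by (metis cost.simps(2))
next
  case (Seq c d)
  then obtain C D C' D' where *: "\<And>S. cost S c \<le> C * (2 ^ S) ^ D" "\<And>S. cost S d \<le> C' * (2 ^ S) ^ D'" by blast
  have "cost S (Seq c d) \<le> (1 + C + C') * (2 ^ S) ^ (D + D')" for S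
    unfolding cost.simps by (rule sum_poly_bound) (use * in auto)
  then show ?case by blast
next
  case (Cond t c d)
  then obtain C D C' D' where *: "\<And>S. cost S c \<le> C * (2 ^ S) ^ D" "\<And>S. cost S d \<le> C' * (2 ^ S) ^ D'" by blast
  have "cost S (Cond t c d) \<le> (1 + C + C') * (2 ^ S) ^ (D + D')" for S
    unfolding cost.simps by (rule sum_poly_bound) (use * in auto)
  then show ?case by blast
next
  case (Loop c)
  then obtain C D where *: "\<And>S. cost S c \<le> C * (2 ^ S) ^ D" by blast
  have "cost S (Loop c) \<le> (C + 6) * (2 ^ S) ^ (D + 2)" for S
  proof -
    let ?N = "(2::nat) ^ S"
    have N: "?N \<ge> 1" "2 * S + 3 \<le> 5 * ?N" using less_exp[of S] by linarith+
    have "?N * (2 * S + 3) \<le> ?N * (5 * ?N)" using N(2) by (intro mult_left_mono) auto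
    also have "\<dots> = 5 * ?N ^ 2" by (simp add: power2_eq_square)
    also have "\<dots> \<le> 5 * ?N ^ (D + 2)" by (intro mult_left_mono power_increasing) auto
    finally have 1: "?N * (2 * S + 3) \<le> 5 * ?N ^ (D + 2)" .
    have "?N * cost S c \<le> ?N * (C * ?N ^ D)" using * by simp
    also have "\<dots> = C * ?N ^ (D + 1)" by simp
    also have "\<dots> \<le> C * ?N ^ (D + 2)" by (intro mult_left_mono power_increasing) auto
    finally have 2: "?N * cost S c \<le> C * ?N ^ (D + 2)" .
    have 3: "1 \<le> ?N ^ (D + 2)" using N(1) by (rule one_le_power)
    have "cost S (Loop c) = 1 + ?N * cost S c + ?N * (2 * S + 3)" by (simp add: algebra_simps)
    also have "\<dots> \<le> ?N ^ (D + 2) + C * ?N ^ (D + 2) + 5 * ?N ^ (D + 2)" using 1 2 3 by linarith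
    finally show ?thesis by (simp add: algebra_simps)
  qed
  then show ?case by blast
qed

text \<open>Brings a bound in \<open>n + 1\<close> into the form \<open>c * n ^ d + c\<close> that
  \<open>halts_in_poly_time\<close> asks for, where \<open>n\<close> may be 0.\<close>

lemma shift_poly: "(K::nat) * (n + 1) ^ e \<le> K * 2 ^ e * n ^ e + K * 2 ^ e"
proof -
  have "(n + 1) ^ e \<le> 2 ^ e * n ^ e + 2 ^ e"
  proof (cases n)
    case 0
    have "(1::nat) \<le> 2 ^ e" by simp
    with 0 show ?thesis unfolding 0 add_0 power_one by linarith
  next
    case (Suc m)
    have "(n + 1) ^ e \<le> (2 * n) ^ e" using Suc by (intro power_mono) auto
    then show ?thesis by (simp add: power_mult_distrib)
  qed
  then have "K * (n + 1) ^ e \<le> K * (2 ^ e * n ^ e + 2 ^ e)" by simp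
  then show ?thesis by (simp add: algebra_simps)
qed

text \<open>The machine is obtained before \<open>x\<close> and \<open>Y\<close>, so a single one
  serves for all inputs and all outputs. The caller chooses \<open>b\<close>, the number of cells
  per binary digit. Only the lower bound on \<open>L\<close> is passed on; the upper bound is
  consumed by the time and space estimates.\<close>

theorem compile:
  fixes c0 :: "('e, 'l, 'a::finite) com"
  assumes "closed_com E G c0" "finite E" "finite G" "e0 \<in> E" "l0 \<in> G" and b: "b \<ge> 1"
  obtains M :: "(nat, nat, 'a) ntm" and L :: "nat \<Rightarrow> nat" where "logspace_ntm None M"
    "\<And>n. n + 1 < 2 ^ L n"
    "\<And>x Y. card (accepting_into Map.empty M x Y (init_config M)) =
      wt x c0 (\<lambda>(e, i, w, u). if u \<in> Y then 1 else 0)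
        (e0, Suc (length x), replicate (b * L (length x)) l0, [])"
proof -
  obtain M :: "(nat, nat, 'a) ntm" where M: "wf_ntm M" "oracle_free M"
    "\<And>f x Y S t n. comp_tree f (compiled b l0 e0 E G c0) x Y S t (init_config (compiled b l0 e0 E G c0)) n
      \<Longrightarrow> comp_tree f M x Y S t (init_config M) n"
    using nat_machine[OF wf_compiled[OF assms(1-5)] oracle_free_compiled] by blast
  define L where "L n = digits ((tick b ^^ Suc n) [])" for n
  have L: "n + 1 < 2 ^ L n" "2 ^ L n \<le> 2 * (n + 1)" for n
    using ticks(3,4)[OF b, of "Suc n"] by (simp_all add: L_def del: funpow.simps)
  define S where "S n = b * L n" for n
  have S: "S n = length ((tick b ^^ Suc n) [])" for n
    using ticks(2)[OF b, of "Suc n"] by (simp add: L_def S_def del: funpow.simps)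
  define T where "T n = Suc n * (2 * S n + 3) + cost (S n) c0 + 3" for n
  have tree: "comp_tree Map.empty M x Y (Suc (S (length x))) (T (length x)) (init_config M)
     (wt x c0 (\<lambda>(e, i, w, u). if u \<in> Y then 1 else 0)
        (e0, Suc (length x), replicate (S (length x)) l0, []))" for x Y
    unfolding T_def by (rule M(3)[OF tree_compiled[OF b S assms(1,4,5)]])
  obtain C D where C: "\<And>S. cost S c0 \<le> C * (2 ^ S) ^ D" using cost_poly[of c0] by blast
  let ?K = "5 * 2 ^ b + C * 2 ^ (b * D) + 3" and ?e = "b + 1 + b * D"
  have T: "T n \<le> ?K * (n + 1) ^ ?e" for n
  proof -
    \<comment> \<open>A loop costs a factor \<open>2 ^ S n\<close>. As \<open>2 ^ L n\<close> is at
      most \<open>2 * (n + 1)\<close>, this is polynomial of degree \<open>b\<close>.\<close>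
    have "(2::nat) ^ S n = (2 ^ L n) ^ b" by (simp add: S_def power_mult[symmetric] mult.commute)
    also have "\<dots> \<le> (2 * (n + 1)) ^ b" using L(2) by (rule power_mono) simp
    finally have s: "(2::nat) ^ S n \<le> 2 ^ b * (n + 1) ^ b" by (simp only: power_mult_distrib)
    have "2 * S n + 3 \<le> 5 * 2 ^ S n" using less_exp[of "S n"] by linarith
    also have "\<dots> \<le> 5 * (2 ^ b * (n + 1) ^ b)" using s by simp
    finally have "Suc n * (2 * S n + 3) \<le> Suc n * (5 * (2 ^ b * (n + 1) ^ b))" by (rule mult_left_mono) simp
    also have "\<dots> = 5 * 2 ^ b * (n + 1) ^ (b + 1)" by (simp add: algebra_simps)
    also have "\<dots> \<le> 5 * 2 ^ b * (n + 1) ^ ?e" by (intro mult_left_mono power_increasing) auto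
    finally have 1: "Suc n * (2 * S n + 3) \<le> 5 * 2 ^ b * (n + 1) ^ ?e" .
    have "cost (S n) c0 \<le> C * (2 ^ S n) ^ D" by (rule C)
    also have "\<dots> \<le> C * (2 ^ b * (n + 1) ^ b) ^ D" using s by (intro mult_left_mono power_mono) auto
    also have "\<dots> = C * 2 ^ (b * D) * (n + 1) ^ (b * D)" by (simp add: power_mult_distrib power_mult)
    also have "\<dots> \<le> C * 2 ^ (b * D) * (n + 1) ^ ?e" by (intro mult_left_mono power_increasing) auto
    finally have 2: "cost (S n) c0 \<le> C * 2 ^ (b * D) * (n + 1) ^ ?e" .
    have "1 \<le> (n + 1) ^ ?e" by (rule one_le_power) simp
    with 1 2 have "T n \<le> 5 * 2 ^ b * (n + 1) ^ ?e + C * 2 ^ (b * D) * (n + 1) ^ ?e + 3 * (n + 1) ^ ?e"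
      unfolding T_def by linarith
    then show ?thesis by (simp add: algebra_simps)
  qed
  have "halts_in_poly_time Map.empty M" unfolding halts_in_poly_time_def
  proof (intro exI allI impI)
    fix x as assume "run Map.empty M x (init_config M) as \<noteq> None"
    then have "length as \<le> T (length x)" using comp_tree_time_space[OF tree[of x UNIV]] by blast
    also have "\<dots> \<le> ?K * (length x + 1) ^ ?e" by (rule T)
    also have "\<dots> \<le> ?K * 2 ^ ?e * length x ^ ?e + ?K * 2 ^ ?e" by (rule shift_poly)
    finally show "length as \<le> ?K * 2 ^ ?e * length x ^ ?e + ?K * 2 ^ ?e" .
  qed
  moreover have "runs_in_log_space Map.empty M" unfolding runs_in_log_space_def
  proof (intro exI allI impI ballI)
    fix x c tp assume "reachable Map.empty M x c" "tp \<in> set (work c)"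
    then have "snd tp \<le> Suc (S (length x))"
      unfolding reachable_def using comp_tree_time_space[OF tree[of x UNIV]] by fastforce
    \<comment> \<open>\<open>L n\<close> is at most 1 plus the logarithm, hence at most twice the
      logarithm, which is at least 1; the additional 1 in the factor pays for the cell of the
      mark.\<close>
    moreover have "real (Suc (S n)) \<le> (2 * real b + 1) * log 2 (real n + 2)" for n
    proof -
      have l1: "log 2 (real n + 2) \<ge> 1" by simp
      have "real (2 ^ L n) \<le> real (2 * (n + 1))" using L(2) by (simp only: of_nat_le_iff)
      then have "2 ^ L n \<le> 2 * (real n + 2)" by simp
      then have "log 2 (2 ^ L n) \<le> log 2 (2 * (real n + 2))" by (subst log_le_cancel_iff) auto
      moreover have "log 2 (2 * (real n + 2)) = 1 + log 2 (real n + 2)" by (subst log_mult) auto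
      moreover have "log 2 (2 ^ L n) = real (L n)" by simp
      ultimately have "real (L n) \<le> 1 + log 2 (real n + 2)" by linarith
      then have "real (L n) \<le> 2 * log 2 (real n + 2)" using l1 by linarith
      then have "real b * real (L n) \<le> real b * (2 * log 2 (real n + 2))" by (rule mult_left_mono) simp
      moreover have "real (Suc (S n)) = 1 + real b * real (L n)" by (simp add: S_def)
      moreover have "(2 * real b + 1) * log 2 (real n + 2) = real b * (2 * log 2 (real n + 2)) + log 2 (real n + 2)"
        by (simp add: algebra_simps)
      ultimately show ?thesis using l1 by linarith
    qed
    ultimately have "real (snd tp) \<le> (2 * real b + 1) * log 2 (real (length x) + 2)"
      by (meson of_nat_mono order_trans)
    then show "case tp of (t, p) \<Rightarrow> real p \<le> (2 * real b + 1) * log 2 (real (length x) + 2)"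
      by (simp add: case_prod_unfold)
  qed
  ultimately have "logspace_ntm None M"
    using M oracle_free_deterministic_queries by (simp add: logspace_ntm_def)
  then show thesis
    by (rule that[of M L]) (use L(1) comp_tree_count[OF tree] in \<open>auto simp: S_def\<close>)
qed

section \<open>Counting accepting branches step by step\<close>

text \<open>The recursion that the iterated simulation of one step satisfies under
  \<open>wt\<close>: accepting configurations wait for the clock to run out, all others
  branch.\<close>

primrec paths :: "'a pfun \<Rightarrow> ('q, 'g, 'a) ntm \<Rightarrow> 'a list \<Rightarrow> nat \<Rightarrow> (('q, 'g, 'a) config \<Rightarrow> nat)
    \<Rightarrow> ('q, 'g, 'a) config \<Rightarrow> nat" where
  "paths f M x 0 \<kappa> c = \<kappa> c"
| "paths f M x (Suc N) \<kappa> c = (if cstate c \<in> accept M then \<kappa> c else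
     \<Sum>a\<in>choices M x c. case perform f x a c of None \<Rightarrow> 0 | Some c' \<Rightarrow> paths f M x N \<kappa> c')"

lemma choices_accept: "wf_ntm M \<Longrightarrow> cstate c \<in> accept M \<Longrightarrow> choices M x c = {}"
  by (auto simp: wf_ntm_def choices_def)

text \<open>All branches end within \<open>N\<close> steps, so the clock runs out only at
  configurations that cannot continue; those that do not accept weigh nothing by the assumption on
  \<open>\<kappa>\<close>.\<close>

lemma paths_sum:
  fixes M :: "('q, 'g, 'a::finite) ntm"
  assumes wf: "wf_ntm M" and \<kappa>: "\<And>c. cstate c \<notin> accept M \<Longrightarrow> \<kappa> c = 0"
  shows "wf_config M x c \<Longrightarrow> (\<And>as. run f M x c as \<noteq> None \<Longrightarrow> length as \<le> N) \<Longrightarrow>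
    finite (accepting_into f M x UNIV c) \<and>
    paths f M x N \<kappa> c = (\<Sum>as\<in>accepting_into f M x UNIV c. \<kappa> (the (run f M x c as)))"
proof (induction N arbitrary: c)
  case 0
  have "accepting_into f M x UNIV c = (if cstate c \<in> accept M then {[]} else {})"
  proof -
    have "as = []" if "run f M x c as = Some c'" for as c' using 0(2)[of as] that by simp
    then show ?thesis by (auto simp: accepting_into_def) fastforce
  qed
  then show ?case using \<kappa> by simp
next
  case (Suc N)
  show ?case
  proof (cases "cstate c \<in> accept M")
    case True
    then have "accepting_into f M x UNIV c = {[]}"
      using choices_accept[OF wf True] by (subst accepting_into_unfold) simp
    then show ?thesis using True by simp
  next
    case False
    let ?F = "\<lambda>a. case perform f x a c of None \<Rightarrow> {} | Some c' \<Rightarrow> accepting_into f M x UNIV c'"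
    let ?\<kappa> = "\<lambda>as. \<kappa> (the (run f M x c as))"
    have A: "accepting_into f M x UNIV c = (\<Union>a\<in>choices M x c. (#) a ` ?F a)"
      using False by (subst accepting_into_unfold) (auto split: option.splits)
    have fin: "finite (choices M x c)" using finite_choices[OF wf Suc.prems(1)] .
    have step: "finite (?F a) \<and> (case perform f x a c of None \<Rightarrow> 0 | Some c' \<Rightarrow> paths f M x N \<kappa> c') =
        (\<Sum>as\<in>(#) a ` ?F a. ?\<kappa> as)" if a: "a \<in> choices M x c" for a
    proof (cases "perform f x a c")
      case (Some c')
      have "wf_config M x c'"
        using perform_wf_config[OF Suc.prems(1) _ Some] choices_subset_actions[OF wf Suc.prems(1)] a by blast
      moreover have "length as \<le> N" if "run f M x c' as \<noteq> None" for as
        using Suc.prems(2)[of "a # as"] a Some that by auto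
      ultimately have "finite (accepting_into f M x UNIV c') \<and>
          paths f M x N \<kappa> c' = (\<Sum>as\<in>accepting_into f M x UNIV c'. \<kappa> (the (run f M x c' as)))"
        by (rule Suc.IH)
      with a Some show ?thesis by (simp add: sum.reindex)
    qed auto
    have "(\<Sum>as\<in>accepting_into f M x UNIV c. ?\<kappa> as) = (\<Sum>a\<in>choices M x c. \<Sum>as\<in>(#) a ` ?F a. ?\<kappa> as)"
      unfolding A using fin step by (intro sum.UNION_disjoint) auto
    also have "\<dots> = (\<Sum>a\<in>choices M x c. case perform f x a c of None \<Rightarrow> 0 | Some c' \<Rightarrow> paths f M x N \<kappa> c')"
      using step by (intro sum.cong) auto
    finally show ?thesis unfolding A using False fin step by (auto simp del: UN_simps)
  qed
qed

lemma paths_card: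
  fixes M :: "('q, 'g, 'a::finite) ntm"
  assumes wf: "wf_ntm M" and "wf_config M x c" and "\<And>as. run f M x c as \<noteq> None \<Longrightarrow> length as \<le> N"
  shows "finite (accepting_into f M x UNIV c) \<and>
    paths f M x N (\<lambda>c. if cstate c \<in> accept M \<and> out c \<in> Y then 1 else 0) c =
      card (accepting_into f M x Y c)"
proof -
  let ?\<kappa> = "\<lambda>c. if cstate c \<in> accept M \<and> out c \<in> Y then 1 else 0 :: nat"
  have *: "finite (accepting_into f M x UNIV c) \<and>
    paths f M x N ?\<kappa> c = (\<Sum>as\<in>accepting_into f M x UNIV c. ?\<kappa> (the (run f M x c as)))"
    by (rule paths_sum[OF wf _ assms(2,3)]) auto
  have "(\<Sum>as\<in>accepting_into f M x UNIV c. ?\<kappa> (the (run f M x c as))) =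
      (\<Sum>as\<in>accepting_into f M x Y c. 1)"
    using * by (intro sum.mono_neutral_cong_right) (auto simp: accepting_into_def)
  with * show ?thesis by simp
qed

section \<open>Counters and tapes on the tracks of a word\<close>

text \<open>\<open>Cur\<close> holds the current configuration of \<open>M\<close>,
  \<open>Sav\<close> the one in which the latest query was opened, \<open>Scr\<close> the replay
  starting from it, and \<open>Fun\<close> the configuration of \<open>F\<close>.\<close>

datatype slot = Cur | Sav | Scr | Fun

text \<open>\<open>Pos s\<close> is the input head of the machine in slot \<open>s\<close>,
  \<open>Cnt s\<close> counts down to the wanted symbol of its output or query, \<open>Ans\<close>
  is the head on the answer, and \<open>Tmp\<close> serves to walk along the real input.\<close>

datatype ctr = Pos slot | Cnt slot | Ans | Tmp

datatype mode = NoQuery | Writing | Answered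

text \<open>\<open>res s\<close> is the cell captured from slot \<open>s\<close>, \<open>cel\<close>
  the input cell and \<open>gs\<close> the work symbols of the simulated step, \<open>act\<close>
  its action. \<open>fl\<close> is mainly the outcome of zero tests, \<open>car\<close> a carry,
  \<open>ini\<close> marks the first cell of a sweep, and \<open>asked\<close> ends the replay of a
  query.\<close>

record 'a regs =
  st :: "slot \<Rightarrow> nat"
  res :: "slot \<Rightarrow> 'a cell"
  cel :: "'a cell"
  gs :: "nat list"
  act :: "(nat, nat, 'a) action"
  mode :: mode
  fl :: bool
  car :: bool
  ini :: bool
  asked :: bool

type_synonym letter = "(ctr \<Rightarrow> bool) \<times> (slot \<times> nat \<Rightarrow> nat \<times> bool)"
type_synonym simtapes = "slot \<Rightarrow> ((nat \<Rightarrow> nat) \<times> nat) list"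
type_synonym 'a prog = "('a regs, letter, 'a) com"

text \<open>Cell \<open>i\<close> of the word holds bit \<open>i\<close> of every counter and, for
  each simulated tape, symbol \<open>i\<close> with a mark if the head is there. Absent tapes read
  \<open>(0, False)\<close>, so that clearing a slot amounts to giving it no tapes.\<close>

definition letter :: "(ctr \<Rightarrow> nat) \<Rightarrow> simtapes \<Rightarrow> nat \<Rightarrow> letter" where
  "letter C T i = (\<lambda>k. odd (C k div 2 ^ i),
     \<lambda>(s, j). if j < length (T s) then (fst (T s ! j) i, snd (T s ! j) = i) else (0, False))"

definition word :: "nat \<Rightarrow> (ctr \<Rightarrow> nat) \<Rightarrow> simtapes \<Rightarrow> letter list" where
  "word S C T = map (letter C T) [0..<S]"

lemma length_word [simp]: "length (word S C T) = S"
  by (simp add: word_def)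

lemma pass_upt:
  assumes "\<And>i. i < S \<Longrightarrow> f (\<sigma> i) (h i) = (\<sigma> (Suc i), h' i)"
  shows "pass f (\<sigma> 0) (map h [0..<S]) = (\<sigma> S, map h' [0..<S])"
proof -
  have "pass f (\<sigma> i) (map h [i..<S]) = (\<sigma> S, map h' [i..<S])" if "i \<le> S" for i
    using that
  proof (induction i rule: inc_induct)
    case (step i)
    then show ?case using assms[of i] by (simp add: upt_conv_Cons)
  qed simp
  then show ?thesis by simp
qed

lemma pass_rev_upt:
  assumes "\<And>i. i < S \<Longrightarrow> f (\<rho> (Suc i)) (h i) = (\<rho> i, h' i)"
  shows "pass f (\<rho> S) (rev (map h [0..<S])) = (\<rho> 0, rev (map h' [0..<S]))"
  using assms
proof (induction S)
  case (Suc S)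
  then show ?case by simp
qed simp

lemma pass_skip: "pass (\<lambda>e l. (e, l)) e w = (e, w)"
  by (induction w) auto

text \<open>
  The intermediate control states of both passes are given as functions \<open>\<sigma>\<close> and \<open>\<rho>\<close> of the
  position, which reduces each of the operations below to a check of single cells.
\<close>

lemma wt_sweep:
  assumes "\<And>i. i < S \<Longrightarrow> f (\<sigma> i) (letter C T i) = (\<sigma> (Suc i), m i)"
    and "\<And>i. i < S \<Longrightarrow> g (\<rho> (Suc i)) (m i) = (\<rho> i, letter C' T' i)"
    and "\<sigma> 0 = e" "\<rho> S = \<sigma> S" "\<rho> 0 = e'"
  shows "wt x (Sweep f g) \<kappa> (e, i, word S C T, u) = \<kappa> (e', i, word S C' T', u)"
  using pass_upt[of S f \<sigma> "letter C T" m] pass_rev_upt[of S g \<rho> m "letter C' T'"] assms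
  by (simp add: word_def)

definition fwd :: "('a regs \<Rightarrow> letter \<Rightarrow> 'a regs \<times> letter) \<Rightarrow> 'a prog" where
  "fwd f = Sweep f (\<lambda>e l. (e, l))"

lemma wt_fwd:
  assumes "\<And>i. i < S \<Longrightarrow> f (\<sigma> i) (letter C T i) = (\<sigma> (Suc i), letter C' T' i)"
    and "\<sigma> 0 = e" "\<sigma> S = e'"
  shows "wt x (fwd f) \<kappa> (e, i, word S C T, u) = \<kappa> (e', i, word S C' T', u)"
  unfolding fwd_def by (rule wt_sweep[where \<rho> = "\<lambda>_. e'" and \<sigma> = \<sigma>]) (use assms in auto)

definition upd :: "('a regs \<Rightarrow> 'a regs) \<Rightarrow> 'a prog" where
  "upd f = Basic (\<lambda>e z. {(f e, MStay, None)})"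

definition skip :: "'a prog" where "skip = upd (\<lambda>e. e)"

definition abort :: "'a prog" where "abort = Basic (\<lambda>e z. {})"

definition mapl :: "(letter \<Rightarrow> letter) \<Rightarrow> 'a prog" where
  "mapl g = fwd (\<lambda>e l. (e, g l))"

lemma wt_upd [simp]: "i \<le> Suc (length x) \<Longrightarrow> wt x (upd f) \<kappa> (e, i, w, u) = \<kappa> (f e, i, w, u)"
  by (simp add: upd_def mv_within_def)

lemma wt_skip [simp]: "i \<le> Suc (length x) \<Longrightarrow> wt x skip \<kappa> (e, i, w, u) = \<kappa> (e, i, w, u)"
  by (simp add: skip_def)

lemma wt_abort [simp]: "wt x abort \<kappa> s = 0"
  by (cases s) (simp add: abort_def)

lemma wt_mapl:
  "(\<And>i. g (letter C T i) = letter C' T' i) \<Longrightarrow>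
    wt x (mapl g) \<kappa> (e, i, word S C T, u) = \<kappa> (e, i, word S C' T', u)"
  unfolding mapl_def by (rule wt_fwd[where \<sigma> = "\<lambda>_. e"]) auto

section \<open>Arithmetic on counters\<close>

definition inc :: "ctr \<Rightarrow> 'a prog" where
  "inc k = Seq (upd (\<lambda>e. e\<lparr>car := True\<rparr>))
     (fwd (\<lambda>e l. (e\<lparr>car := car e \<and> fst l k\<rparr>, ((fst l)(k := (fst l k \<noteq> car e)), snd l))))"

definition dec :: "ctr \<Rightarrow> 'a prog" where
  "dec k = Seq (upd (\<lambda>e. e\<lparr>car := True\<rparr>))
     (fwd (\<lambda>e l. (e\<lparr>car := car e \<and> \<not> fst l k\<rparr>, ((fst l)(k := (fst l k \<noteq> car e)), snd l))))"

definition zero_test :: "ctr \<Rightarrow> 'a prog" where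
  "zero_test k = Seq (upd (\<lambda>e. e\<lparr>fl := True\<rparr>)) (fwd (\<lambda>e l. (e\<lparr>fl := fl e \<and> \<not> fst l k\<rparr>, l)))"

text \<open>In passing from \<open>v\<close> to \<open>Suc v\<close>, a carry reaches bit
  \<open>i\<close> iff the lower bits of \<open>v\<close> are all 1, that is, iff
  \<open>2 ^ i\<close> divides \<open>Suc v\<close>. This lemma is the propagation of the carry by
  one bit.\<close>

lemma dvd_Suc_power2:
  "2 ^ Suc i dvd Suc v \<longleftrightarrow> 2 ^ i dvd Suc v \<and> odd (v div 2 ^ i)"
proof (cases "2 ^ i dvd Suc v")
  case True
  then obtain d where d: "Suc v = 2 ^ i * d" by blast
  have "Suc v div 2 ^ i = Suc (v div 2 ^ i)" using True by (simp add: div_Suc mod_eq_0_iff_dvd)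
  then have "d = Suc (v div 2 ^ i)" using d by (metis nonzero_mult_div_cancel_left power_eq_0_iff zero_neq_numeral)
  moreover have "2 ^ Suc i dvd Suc v \<longleftrightarrow> even d" unfolding d by (simp add: mult.commute)
  ultimately show ?thesis using True by simp
next
  case False
  then show ?thesis by (meson dvd_trans le_imp_power_dvd lessI less_imp_le)
qed

lemma odd_Suc_div_power2:
  "odd (Suc v div 2 ^ i) \<longleftrightarrow> odd (v div 2 ^ i) \<noteq> (2 ^ i dvd Suc v)"
  by (simp add: div_Suc mod_eq_0_iff_dvd)

lemma odd_div_power2_dvd:
  "2 ^ Suc i dvd (v::nat) \<longleftrightarrow> 2 ^ i dvd v \<and> even (v div 2 ^ i)"
proof (cases "2 ^ i dvd v")
  case True
  then show ?thesis by (auto simp: mult.commute elim!: dvdE)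
next
  case False
  then show ?thesis by (meson dvd_trans le_imp_power_dvd lessI less_imp_le)
qed

lemma wt_inc:
  assumes "Suc (C k) < 2 ^ S" "i \<le> Suc (length x)"
  shows "wt x (inc k) \<kappa> (e, i, word S C T, u) =
    \<kappa> (e\<lparr>car := False\<rparr>, i, word S (C(k := Suc (C k))) T, u)"
proof -
  \<comment> \<open>No carry leaves the last cell.\<close>
  have "\<not> 2 ^ S dvd Suc (C k)" using assms(1) nat_dvd_not_less by blast
  have "wt x (fwd (\<lambda>e l. (e\<lparr>car := car e \<and> fst l k\<rparr>, ((fst l)(k := (fst l k \<noteq> car e)), snd l)))) \<kappa>
      (e\<lparr>car := True\<rparr>, i, word S C T, u) = \<kappa> (e\<lparr>car := False\<rparr>, i, word S (C(k := Suc (C k))) T, u)"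
    by (rule wt_fwd[where \<sigma> = "\<lambda>i. e\<lparr>car := 2 ^ i dvd Suc (C k)\<rparr>"])
      (use \<open>\<not> 2 ^ S dvd Suc (C k)\<close> in \<open>auto simp: letter_def fun_eq_iff dvd_Suc_power2 odd_Suc_div_power2 simp del: power_Suc\<close>)
  then show ?thesis using assms(2) by (simp add: inc_def)
qed

lemma wt_dec:
  assumes "C k = Suc v" "C k < 2 ^ S" "i \<le> Suc (length x)"
  shows "wt x (dec k) \<kappa> (e, i, word S C T, u) = \<kappa> (e\<lparr>car := False\<rparr>, i, word S (C(k := v)) T, u)"
proof -
  have "\<not> 2 ^ S dvd Suc v" using assms(1,2) nat_dvd_not_less by auto
  have eq: "(a \<and> b = (\<not> a)) = (a \<and> \<not> b)" for a b by auto
  have "wt x (fwd (\<lambda>e l. (e\<lparr>car := car e \<and> \<not> fst l k\<rparr>, ((fst l)(k := (fst l k \<noteq> car e)), snd l)))) \<kappa>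
      (e\<lparr>car := True\<rparr>, i, word S C T, u) = \<kappa> (e\<lparr>car := False\<rparr>, i, word S (C(k := v)) T, u)"
    \<comment> \<open>A borrow reaches bit \<open>i\<close> iff the lower bits of
      \<open>Suc v\<close> are all 0, which is the same divisibility as for the carry.\<close>
    by (rule wt_fwd[where \<sigma> = "\<lambda>i. e\<lparr>car := 2 ^ i dvd Suc v\<rparr>"])
      (use \<open>\<not> 2 ^ S dvd Suc v\<close> in \<open>auto simp: letter_def fun_eq_iff assms(1) eq dvd_Suc_power2 odd_Suc_div_power2 simp del: power_Suc\<close>)
  then show ?thesis using assms(3) by (simp add: dec_def)
qed

lemma wt_zero_test:
  assumes "C k < 2 ^ S" "i \<le> Suc (length x)"
  shows "wt x (zero_test k) \<kappa> (e, i, word S C T, u) = \<kappa> (e\<lparr>fl := (C k = 0)\<rparr>, i, word S C T, u)"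
proof -
  have "2 ^ S dvd C k \<longleftrightarrow> C k = 0" using assms(1) nat_dvd_not_less by auto
  then have "wt x (fwd (\<lambda>e l. (e\<lparr>fl := fl e \<and> \<not> fst l k\<rparr>, l))) \<kappa>
      (e\<lparr>fl := True\<rparr>, i, word S C T, u) = \<kappa> (e\<lparr>fl := (C k = 0)\<rparr>, i, word S C T, u)"
    by (intro wt_fwd[where \<sigma> = "\<lambda>i. e\<lparr>fl := 2 ^ i dvd C k\<rparr>"])
      (auto simp: letter_def odd_div_power2_dvd simp del: power_Suc)
  then show ?thesis using assms(2) by (simp add: zero_test_def)
qed

definition copy_ctr :: "ctr \<Rightarrow> ctr \<Rightarrow> 'a prog" where
  "copy_ctr k k' = mapl (\<lambda>l. ((fst l)(k' := fst l k), snd l))"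

definition clear_ctr :: "ctr \<Rightarrow> 'a prog" where
  "clear_ctr k = mapl (\<lambda>l. ((fst l)(k := False), snd l))"

definition copy_slot :: "slot \<Rightarrow> slot \<Rightarrow> 'a prog" where
  "copy_slot s s' = mapl (\<lambda>l. (fst l, \<lambda>(r, j). if r = s' then snd l (s, j) else snd l (r, j)))"

definition clear_slot :: "slot \<Rightarrow> 'a prog" where
  "clear_slot s = mapl (\<lambda>l. (fst l, \<lambda>(r, j). if r = s then (0, False) else snd l (r, j)))"

lemma wt_copy_ctr [simp]:
  "wt x (copy_ctr k k') \<kappa> (e, i, word S C T, u) = \<kappa> (e, i, word S (C(k' := C k)) T, u)"
  unfolding copy_ctr_def by (rule wt_mapl) (auto simp: letter_def)

lemma wt_clear_ctr [simp]:
  "wt x (clear_ctr k) \<kappa> (e, i, word S C T, u) = \<kappa> (e, i, word S (C(k := 0)) T, u)"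
  unfolding clear_ctr_def by (rule wt_mapl) (auto simp: letter_def)

lemma wt_copy_slot [simp]:
  "wt x (copy_slot s s') \<kappa> (e, i, word S C T, u) = \<kappa> (e, i, word S C (T(s' := T s)), u)"
  unfolding copy_slot_def by (rule wt_mapl) (auto simp: letter_def)

lemma wt_clear_slot [simp]:
  "wt x (clear_slot s) \<kappa> (e, i, word S C T, u) = \<kappa> (e, i, word S C (T(s := [])), u)"
  unfolding clear_slot_def by (rule wt_mapl) (auto simp: letter_def)

section \<open>Operations on simulated work tapes\<close>

text \<open>Heads start in the first cell, the only one that the sweep enters with
  \<open>ini\<close> set. The final reset covers the empty word.\<close>

definition init_slot :: "slot \<Rightarrow> nat \<Rightarrow> nat \<Rightarrow> 'a prog" where
  "init_slot s m bl = Seq (upd (\<lambda>e. e\<lparr>ini := True\<rparr>))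
     (Seq (fwd (\<lambda>e l. (e\<lparr>ini := False\<rparr>, (fst l, \<lambda>(r, j). if r = s then if j < m then (bl, ini e) else (0, False)
        else snd l (r, j))))) (upd (\<lambda>e. e\<lparr>ini := False\<rparr>)))"

lemma wt_init_slot [simp]:
  assumes "i \<le> Suc (length x)"
  shows "wt x (init_slot s m bl) \<kappa> (e, i, word S C T, u) =
    \<kappa> (e\<lparr>ini := False\<rparr>, i, word S C (T(s := replicate m (\<lambda>_. bl, 0))), u)"
proof -
  let ?f = "\<lambda>e l. (e\<lparr>ini := False\<rparr>, (fst l, \<lambda>(r, j). if r = s then if j < m then (bl, ini e) else (0, False)
        else snd l (r, j)))"
  have "wt x (fwd ?f) \<kappa>' (e\<lparr>ini := True\<rparr>, i, word S C T, u) =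
      \<kappa>' (e\<lparr>ini := (S = 0)\<rparr>, i, word S C (T(s := replicate m (\<lambda>_. bl, 0))), u)" for \<kappa>'
    by (rule wt_fwd[where \<sigma> = "\<lambda>i. e\<lparr>ini := (i = 0)\<rparr>"]) (auto simp: letter_def fun_eq_iff)
  then show ?thesis using assms by (simp add: init_slot_def)
qed

definition read_head :: "slot \<Rightarrow> nat \<Rightarrow> 'a prog" where
  "read_head s j = fwd (\<lambda>e l. (if snd (snd l (s, j)) then e\<lparr>gs := (gs e)[j := fst (snd l (s, j))]\<rparr> else e, l))"

lemma wt_read_head:
  assumes "j < length (T s)" "snd (T s ! j) < S"
  shows "wt x (read_head s j) \<kappa> (e, i, word S C T, u) =
    \<kappa> (e\<lparr>gs := (gs e)[j := fst (T s ! j) (snd (T s ! j))]\<rparr>, i, word S C T, u)"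
  unfolding read_head_def
  by (rule wt_fwd[where \<sigma> = "\<lambda>i. if i > snd (T s ! j) then e\<lparr>gs := (gs e)[j := fst (T s ! j) (snd (T s ! j))]\<rparr> else e"])
    (use assms in \<open>auto simp: letter_def\<close>)

text \<open>The default makes the value meaningful for every content of the registers, as closure of
  the programs requires.\<close>

definition work_act :: "nat \<Rightarrow> 'a regs \<Rightarrow> nat \<times> move" where
  "work_act j e = (if j < length (work_acts (act e)) then work_acts (act e) ! j else (0, MStay))"

text \<open>A head mark can be carried to the right only in the forward pass and to the left only in
  the backward pass. \<open>fl\<close> detects a left move from the first cell, where the head has
  to stay.\<close>

definition write_head :: "slot \<Rightarrow> nat \<Rightarrow> 'a prog" where
  "write_head s j = Seq (upd (\<lambda>e. e\<lparr>ini := True, fl := False, car := False\<rparr>)) (Seq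
     (Sweep
       (\<lambda>e l. let (y, b) = snd l (s, j); (y', d) = work_act j e in
         (e\<lparr>ini := False, fl := fl e \<or> (b \<and> ini e \<and> d = MLeft), car := (b \<and> d = MRight)\<rparr>,
          (fst l, (snd l)((s, j) := (if b then y' else y, (b \<and> d \<noteq> MRight) \<or> car e)))))
       (\<lambda>e l. let (y, b) = snd l (s, j) in
         if snd (work_act j e) = MLeft \<and> \<not> fl e
         then (e\<lparr>car := b\<rparr>, (fst l, (snd l)((s, j) := (y, car e)))) else (e, l)))
     (upd (\<lambda>e. e\<lparr>ini := False, fl := False, car := False\<rparr>)))"

lemma letter_upd:
  assumes "j < length (T s)"
  shows "letter C (T(s := (T s)[j := (t, p)])) i = (fst (letter C T i), (snd (letter C T i))((s, j) := (t i, p = i)))"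
  using assms by (auto simp: letter_def fun_eq_iff nth_list_update)

lemma letter_at: "j < length (T s) \<Longrightarrow> snd (letter C T i) (s, j) = (fst (T s ! j) i, snd (T s ! j) = i)"
  by (simp add: letter_def)

lemma wt_write_head:
  assumes j: "j < length (T s)" and w: "work_act j e = (y, d)" and Ts: "T s ! j = (t, p)"
    and p: "p < S" "mv d p < S" and i: "i \<le> Suc (length x)"
  shows "wt x (write_head s j) \<kappa> (e, i, word S C T, u) =
    \<kappa> (e\<lparr>ini := False, fl := False, car := False\<rparr>, i, word S C (T(s := (T s)[j := (t(p := y), mv d p)])), u)"
proof -
  let ?f = "\<lambda>e l. let (y, b) = snd l (s, j); (y', d) = work_act j e in
         (e\<lparr>ini := False, fl := fl e \<or> (b \<and> ini e \<and> d = MLeft), car := (b \<and> d = MRight)\<rparr>,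
          (fst l, (snd l)((s, j) := (if b then y' else y, (b \<and> d \<noteq> MRight) \<or> car e))))"
  let ?g = "\<lambda>e l. let (y, b) = snd l (s, j) in
         if snd (work_act j e) = MLeft \<and> \<not> fl e
         then (e\<lparr>car := b\<rparr>, (fst l, (snd l)((s, j) := (y, car e)))) else (e, l)"
  let ?T' = "T(s := (T s)[j := (t(p := y), mv d p)])"
  \<comment> \<open>The head after the forward pass: a right move has been made, a left move is
    still pending.\<close>
  let ?p1 = "if d = MRight then Suc p else p"
  let ?m = "\<lambda>i. letter C (T(s := (T s)[j := (t(p := y), ?p1)])) i"
  let ?stay = "d = MLeft \<and> p = 0"
  have wa: "work_act j (e\<lparr>ini := a, fl := b, car := c\<rparr>) = (y, d)" for a b c
    unfolding w[symmetric] by (simp add: work_act_def)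
  have sweep: "wt x (Sweep ?f ?g) \<kappa>' (e\<lparr>ini := True, fl := False, car := False\<rparr>, i, word S C T, u) =
      \<kappa>' (e\<lparr>ini := False, fl := ?stay, car := False\<rparr>, i, word S C ?T', u)" for \<kappa>'
  proof (rule wt_sweep[where \<sigma> = "\<lambda>i. e\<lparr>ini := (i = 0), fl := ?stay \<and> i > 0, car := (d = MRight \<and> i = Suc p)\<rparr>"
        and \<rho> = "\<lambda>i. e\<lparr>ini := False, fl := ?stay, car := (d = MLeft \<and> p > 0 \<and> i = p)\<rparr>" and m = ?m])
    show "?f (e\<lparr>ini := (i = 0), fl := ?stay \<and> i > 0, car := (d = MRight \<and> i = Suc p)\<rparr>) (letter C T i) =
      (e\<lparr>ini := (Suc i = 0), fl := ?stay \<and> Suc i > 0, car := (d = MRight \<and> Suc i = Suc p)\<rparr>, ?m i)" if "i < S" for i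
      unfolding letter_upd[of j T s, OF j] Let_def letter_at[of j T s, OF j] wa Ts
      by (cases d; cases "p = 0"; cases "i = 0") (auto simp: fun_eq_iff)
    show "?g (e\<lparr>ini := False, fl := ?stay, car := (d = MLeft \<and> p > 0 \<and> Suc i = p)\<rparr>) (?m i) =
      (e\<lparr>ini := False, fl := ?stay, car := (d = MLeft \<and> p > 0 \<and> i = p)\<rparr>, letter C ?T' i)" if "i < S" for i
      unfolding letter_upd[of j T s, OF j] Let_def letter_at[of j T s, OF j] wa Ts
      by (cases d) (auto simp: fun_eq_iff)
  next
    have "(d = MRight \<and> S = Suc p) = False" "(?stay \<and> S > 0) = ?stay" "(S = 0) = False"
        "(d = MLeft \<and> p > 0 \<and> S = p) = False"
      using p by auto
    then show "e\<lparr>ini := False, fl := ?stay, car := (d = MLeft \<and> p > 0 \<and> S = p)\<rparr> =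
        e\<lparr>ini := (S = 0), fl := ?stay \<and> S > 0, car := (d = MRight \<and> S = Suc p)\<rparr>"
      by (simp only:)
    have "(d = MLeft \<and> p > 0 \<and> 0 = p) = False" by auto
    then show "e\<lparr>ini := False, fl := ?stay, car := (d = MLeft \<and> p > 0 \<and> 0 = p)\<rparr> =
        e\<lparr>ini := False, fl := ?stay, car := False\<rparr>" by (simp only:)
  qed simp
  show ?thesis unfolding write_head_def wt.simps(3) wt_upd[OF i] sweep by simp
qed

definition seqs :: "'a prog list \<Rightarrow> 'a prog" where
  "seqs cs = foldr Seq cs skip"

lemma wt_loop_iter:
  assumes "\<And>n \<kappa>. n < N \<Longrightarrow> wt x c \<kappa> (s n) = \<kappa> (s (Suc n))"
  shows "(wt x c ^^ N) \<kappa> (s 0) = \<kappa> (s N)"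
proof -
  have "n \<le> N \<Longrightarrow> (wt x c ^^ (N - n)) \<kappa> (s n) = \<kappa> (s N)" for n
  proof (induction n rule: inc_induct)
    case (step n)
    then have "N - n = Suc (N - Suc n)" by simp
    then show ?case using assms step by simp
  qed simp
  then show ?thesis by (metis diff_zero zero_le)
qed

lemma wt_seqs_iter:
  assumes "\<And>j \<kappa>. j < m \<Longrightarrow> wt x (c j) \<kappa> (s j) = \<kappa> (s (Suc j))" "fst (snd (s m)) \<le> Suc (length x)"
  shows "wt x (seqs (map c [0..<m])) \<kappa> (s 0) = \<kappa> (s m)"
proof -
  have "n \<le> m \<Longrightarrow> wt x (seqs (map c [n..<m])) \<kappa> (s n) = \<kappa> (s m)" for n
  proof (induction n rule: inc_induct)
    case base
    then show ?case using assms(2) by (cases "s m") (simp add: seqs_def)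
  next
    case (step n)
    then show ?case using assms(1)[of n] by (simp add: seqs_def upt_conv_Cons)
  qed
  then show ?thesis by blast
qed

section \<open>Simulating one step of a machine\<close>

lemma read_cell_LeftEnd [simp]: "read_cell w p = LeftEnd \<longleftrightarrow> p = 0"
  by (simp add: read_cell_def)

lemma read_cell_RightEnd [simp]: "read_cell w p = RightEnd \<longleftrightarrow> p > length w"
  by (auto simp: read_cell_def)

lemma read_cell_0 [simp]: "read_cell w 0 = LeftEnd"
  by (simp add: read_cell_def)

lemma flag_idem [simp]:
  "\<not> car e \<Longrightarrow> e\<lparr>car := False\<rparr> = e" "\<not> fl e \<Longrightarrow> e\<lparr>fl := False\<rparr> = e" "\<not> ini e \<Longrightarrow> e\<lparr>ini := False\<rparr> = e"
  by simp_all

text \<open>The cell under the head tells whether an end marker blocks the move, so the position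
  need never be compared with the length of the tape.\<close>

definition move_ctr :: "ctr \<Rightarrow> ('a regs \<Rightarrow> move) \<Rightarrow> ('a regs \<Rightarrow> 'a cell) \<Rightarrow> 'a prog" where
  "move_ctr k d z = Cond (\<lambda>e. d e = MLeft \<and> z e \<noteq> LeftEnd) (dec k)
     (Cond (\<lambda>e. d e = MRight \<and> z e \<noteq> RightEnd) (inc k) skip)"

lemma wt_move_ctr:
  assumes "z e = read_cell w (C k)" "C k \<le> Suc (length w)" "Suc (length w) < 2 ^ S" "\<not> car e"
    "i \<le> Suc (length x)"
  shows "wt x (move_ctr k d z) \<kappa> (e, i, word S C T, u) =
    \<kappa> (e, i, word S (C(k := mv_within w (d e) (C k))) T, u)"
proof -
  have e: "e\<lparr>car := False\<rparr> = e" using assms(4) by simp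
  show ?thesis
  proof (cases "d e")
    case MLeft
    show ?thesis
    proof (cases "C k")
      case 0
      then show ?thesis using assms MLeft by (simp add: move_ctr_def mv_within_def fun_upd_idem)
    next
      case (Suc v)
      then show ?thesis using assms MLeft wt_dec[of C k v S i x \<kappa>] e
        by (simp add: move_ctr_def mv_within_def)
    qed
  next
    case MStay
    then show ?thesis using assms by (simp add: move_ctr_def mv_within_def fun_upd_idem)
  next
    case MRight
    then show ?thesis using assms wt_inc[of C k S i x \<kappa>] e
      by (cases "C k > length w") (auto simp: move_ctr_def mv_within_def fun_upd_idem min_def)
  qed
qed

text \<open>A left move at the left marker has no effect, so making more moves than there are
  positions replaces a test.\<close>

definition rewind :: "'a prog" where
  "rewind = Loop (Basic (\<lambda>e z. {(e, MLeft, None)}))"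

lemma wt_rewind:
  assumes "i \<le> Suc (length x)" "Suc (length x) < 2 ^ S"
  shows "wt x rewind \<kappa> (e, i, word S C T, u) = \<kappa> (e, 0, word S C T, u)"
proof -
  have "(wt x (Basic (\<lambda>e z. {(e, MLeft, None)})) ^^ (2 ^ S)) \<kappa> ((\<lambda>n. (e, i - n, word S C T, u)) 0) =
     \<kappa> ((\<lambda>n. (e, i - n, word S C T, u)) (2 ^ S))"
    by (rule wt_loop_iter) (use assms in \<open>auto simp: mv_within_def min_def\<close>)
  then show ?thesis using assms by (simp add: rewind_def)
qed

text \<open>The replay and the main simulation share the one real input head. Between operations it
  rests at position 0; positions are kept in counters, and the head walks out and back to fetch a
  cell.\<close>

definition read_input :: "slot \<Rightarrow> 'a prog" where
  "read_input s = Seq (copy_ctr (Pos s) Tmp) (Seq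
     (Loop (Seq (zero_test Tmp) (Cond fl skip (Seq (dec Tmp) (Basic (\<lambda>e z. {(e, MRight, None)}))))))
     (Seq (Basic (\<lambda>e z. {(e\<lparr>cel := z, fl := False\<rparr>, MStay, None)})) rewind))"

lemma wt_read_input:
  assumes p: "C (Pos s) \<le> Suc (length x)" "Suc (length x) < 2 ^ S" and e: "\<not> fl e" "\<not> car e" and z: "C Tmp = 0"
  shows "wt x (read_input s) \<kappa> (e, 0, word S C T, u) =
    \<kappa> (e\<lparr>cel := read_cell x (C (Pos s))\<rparr>, 0, word S C T, u)"
proof -
  define p where "p = C (Pos s)"
  let ?c = "Seq (zero_test Tmp) (Cond fl skip (Seq (dec Tmp) (Basic (\<lambda>e z. {(e, MRight, None)})))) :: 'a prog"
  \<comment> \<open>The first \<open>p\<close> rounds move the head, the next one finds the counter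
    at zero and sets \<open>fl\<close>, and the rest idle.\<close>
  let ?s = "\<lambda>n. (e\<lparr>fl := (n > p)\<rparr>, min n p, word S (C(Tmp := p - n)) T, u)"
  have e': "e\<lparr>car := False\<rparr> = e" "e\<lparr>fl := False\<rparr> = e" using e by simp_all
  have "(wt x ?c ^^ (2 ^ S)) \<kappa>' (?s 0) = \<kappa>' (?s (2 ^ S))" for \<kappa>'
  proof (rule wt_loop_iter)
    fix n :: nat and \<kappa> assume "n < 2 ^ S"
    have 1: "wt x (zero_test Tmp) \<kappa>' (e', i', word S (C(Tmp := v)) T, u) =
        \<kappa>' (e'\<lparr>fl := (v = 0)\<rparr>, i', word S (C(Tmp := v)) T, u)"
      if "v \<le> p" "i' \<le> Suc (length x)" for \<kappa>' e' i' v
      using p that by (subst wt_zero_test) (auto simp: p_def)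
    show "wt x ?c \<kappa> (?s n) = \<kappa> (?s (Suc n))"
    proof (cases "n < p")
      case True
      have d: "wt x (dec Tmp) \<kappa>' (e, n, word S (C(Tmp := p - n)) T, u) =
          \<kappa>' (e, n, word S (C(Tmp := p - Suc n)) T, u)" for \<kappa>'
        using p True e by (subst wt_dec[where v = "p - Suc n"]) (auto simp: p_def)
      have "wt x ?c \<kappa> (?s n) = wt x (zero_test Tmp) (wt x (Cond fl skip (Seq (dec Tmp) (Basic (\<lambda>e z. {(e, MRight, None)})))) \<kappa>)
          (e, n, word S (C(Tmp := p - n)) T, u)"
        using True e by simp
      also have "\<dots> = wt x (Basic (\<lambda>e z. {(e, MRight, None)})) \<kappa> (e, n, word S (C(Tmp := p - Suc n)) T, u)"
        using True p e d by (subst 1) (simp_all add: p_def)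
      also have "\<dots> = \<kappa> (?s (Suc n))"
        using True p e by (simp add: mv_within_def p_def)
      finally show ?thesis .
    next
      case False
      then show ?thesis using p by (simp add: 1 p_def)
    qed
  qed
  moreover have "C(Tmp := 0) = C" using z by (simp add: fun_upd_idem)
  moreover have "e\<lparr>cel := r, fl := False\<rparr> = e\<lparr>cel := r\<rparr>" for r using e by simp
  ultimately show ?thesis using p e' wt_rewind[of p x S \<kappa>]
    by (simp add: read_input_def p_def mv_within_def del: wt.simps(5)) (simp add: p_def[symmetric] e')
qed

text \<open>On well-formed configurations the intersection changes nothing; for arbitrary registers
  it keeps the choice finite and inside the control set. \<open>em\<close> sends the emitted symbol
  to the real output, which happens for the main simulation of \<open>M\<close> only.\<close>

definition choose_act :: "(nat, nat, 'a) ntm \<Rightarrow> slot \<Rightarrow> bool \<Rightarrow> ('a regs \<Rightarrow> 'a cell) \<Rightarrow> 'a prog" where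
  "choose_act X s em z = Basic (\<lambda>e _. (\<lambda>a. (e\<lparr>act := a, st := (st e)(s := new_state a)\<rparr>, MStay,
      if em then emit a else None)) ` (delta X (st e s) (cel e) (gs e) (z e) \<inter> actions X))"

definition step_com :: "(nat, nat, 'a) ntm \<Rightarrow> slot \<Rightarrow> bool \<Rightarrow> ('a regs \<Rightarrow> 'a cell) \<Rightarrow> 'a prog" where
  "step_com X s em z = Seq (upd (\<lambda>e. e\<lparr>gs := replicate (tapes X) 0\<rparr>))
     (Seq (seqs (map (read_head s) [0..<tapes X])) (Seq (choose_act X s em z)
     (Seq (seqs (map (write_head s) [0..<tapes X])) (move_ctr (Pos s) (\<lambda>e. in_move (act e)) cel))))"

definition emitted :: "('q, 'g, 'a) action \<Rightarrow> 'a list" where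
  "emitted a = (case emit a of None \<Rightarrow> [] | Some b \<Rightarrow> [b])"

lemma take_drop_step:
  assumes "length xs = length ys" "j < length xs"
  shows "(take j xs @ drop j ys)[j := xs ! j] = take (Suc j) xs @ drop (Suc j) ys"
    "(take j xs @ drop j ys) ! j = ys ! j"
  using assms by (auto intro!: nth_equalityI simp: nth_append nth_list_update min_def less_Suc_eq)

lemma wt_read_heads:
  assumes m: "length (T s) = m" and p: "\<forall>(t, p)\<in>set (T s). p < S"
  shows "wt x (seqs (map (read_head s) [0..<m])) \<kappa> (e\<lparr>gs := replicate m 0\<rparr>, 0, word S C T, u) =
    \<kappa> (e\<lparr>gs := map (\<lambda>(t, p). t p) (T s)\<rparr>, 0, word S C T, u)"
proof -
  define g where "g = map (\<lambda>(t, p). t p) (T s)"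
  define r where "r j = (e\<lparr>gs := take j g @ drop j (replicate m 0)\<rparr>, 0 :: nat, word S C T, u)" for j
  have "wt x (seqs (map (read_head s) [0..<m])) \<kappa> (r 0) = \<kappa> (r m)"
  proof (rule wt_seqs_iter)
    fix j \<kappa> assume j: "j < m"
    have "T s ! j \<in> set (T s)" using j m by simp
    then have "snd (T s ! j) < S" using p by (metis case_prodD prod.collapse)
    moreover have "fst (T s ! j) (snd (T s ! j)) = g ! j" using j m by (simp add: g_def case_prod_unfold)
    ultimately show "wt x (read_head s j) \<kappa> (r j) = \<kappa> (r (Suc j))"
      using j m take_drop_step(1)[of g "replicate m 0" j] unfolding r_def
      by (subst wt_read_head) (simp_all add: g_def)
  qed (simp add: r_def)
  then show ?thesis using m by (simp add: r_def g_def)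
qed

lemma wt_write_heads:
  assumes m: "length (T s) = m" "length (work_acts (act e)) = m"
    and p: "\<forall>(t, p)\<in>set (T s). Suc p < S" and e: "\<not> fl e" "\<not> car e" "\<not> ini e"
  shows "wt x (seqs (map (write_head s) [0..<m])) \<kappa> (e, 0, word S C T, u) =
    \<kappa> (e, 0, word S C (T(s := map2 (\<lambda>(y, d) (t, p). (t(p := y), mv d p)) (work_acts (act e)) (T s))), u)"
proof -
  define n where "n = map2 (\<lambda>(y, d) (t, p). (t(p := y), mv d p)) (work_acts (act e)) (T s)"
  define t where "t j = take j n @ drop j (T s)" for j
  define w where "w j = (e, 0 :: nat, word S C (T(s := t j)), u)" for j
  have ln: "length n = m" using m by (simp add: n_def)
  have "wt x (seqs (map (write_head s) [0..<m])) \<kappa> (w 0) = \<kappa> (w m)"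
  proof (rule wt_seqs_iter)
    fix j \<kappa> assume j: "j < m"
    obtain y d where yd: "work_acts (act e) ! j = (y, d)" by fastforce
    obtain tj pj where tp: "T s ! j = (tj, pj)" by fastforce
    have "T s ! j \<in> set (T s)" using j m by simp
    then have "Suc pj < S" using p tp by auto
    then have pj: "pj < S" "mv d pj < S" by (cases d; simp)+
    have nj: "n ! j = (tj(pj := y), mv d pj)" using j m yd tp by (simp add: n_def)
    have tj: "t j ! j = (tj, pj)" "(t j)[j := (tj(pj := y), mv d pj)] = t (Suc j)" "j < length (t j)"
      using take_drop_step[of n "T s" j] j m ln tp nj by (auto simp: t_def)
    have "wt x (write_head s j) \<kappa> (w j) = \<kappa> (e\<lparr>ini := False, fl := False, car := False\<rparr>, 0,
        word S C ((T(s := t j))(s := ((T(s := t j)) s)[j := (tj(pj := y), mv d pj)])), u)"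
      unfolding w_def by (rule wt_write_head) (use j m yd tj pj in \<open>auto simp: work_act_def\<close>)
    also have "\<dots> = \<kappa> (w (Suc j))" using e tj(2) by (simp add: w_def)
    finally show "wt x (write_head s j) \<kappa> (w j) = \<kappa> (w (Suc j))" .
  qed (simp add: w_def)
  moreover have "t 0 = T s" "t m = n" using m ln by (simp_all add: t_def)
  ultimately show ?thesis by (simp add: w_def n_def)
qed

text \<open>Covers everything in a step except the oracle command; the oracle cell that the machine
  sees is supplied through \<open>z\<close>.\<close>

lemma wt_step_com:
  fixes X :: "(nat, nat, 'a) ntm"
  assumes X: "wf_ntm X" "wf_config X v c"
    and sp: "\<forall>(t, p)\<in>set (work c). Suc p < S"
    and st: "st e s = cstate c" "T s = work c" "C (Pos s) = in_pos c" "cel e = read_cell v (in_pos c)"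
    and z: "\<And>g. z (e\<lparr>gs := g\<rparr>) = read_oracle (otape c)"
    and v: "Suc (length v) < 2 ^ S" and e: "\<not> fl e" "\<not> car e" "\<not> ini e"
  shows "wt x (step_com X s em z) \<kappa> (e, 0, word S C T, u) =
    (\<Sum>a\<in>choices X v c. \<kappa> (e\<lparr>gs := map (\<lambda>(t, p). t p) (work c), act := a, st := (st e)(s := new_state a)\<rparr>, 0,
       word S (C(Pos s := mv_within v (in_move a) (in_pos c)))
         (T(s := map2 (\<lambda>(y, d) (t, p). (t(p := y), mv d p)) (work_acts a) (work c))),
       u @ (if em then emitted a else [])))"
proof -
  let ?m = "tapes X" and ?g = "map (\<lambda>(t, p). t p) (work c)"
  have l: "length (T s) = ?m" using X(2) st(2) by (simp add: wf_config_def)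
  have reads: "wt x (seqs (map (read_head s) [0..<?m])) \<kappa>' (e\<lparr>gs := replicate ?m 0\<rparr>, 0, word S C T, u) =
     \<kappa>' (e\<lparr>gs := ?g\<rparr>, 0, word S C T, u)" for \<kappa>'
    using wt_read_heads[of T s ?m S x \<kappa>' e C u] l sp st(2) by fastforce
  let ?e = "\<lambda>a. e\<lparr>gs := ?g, act := a, st := (st e)(s := new_state a)\<rparr>"
  let ?u = "\<lambda>a. u @ (if em then emitted a else [])"
  let ?T = "\<lambda>a. T(s := map2 (\<lambda>(y, d) (t, p). (t(p := y), mv d p)) (work_acts a) (work c))"
  have writes: "wt x (seqs (map (write_head s) [0..<?m])) \<kappa>' (?e a, 0, word S C T, ?u a) =
      \<kappa>' (?e a, 0, word S C (?T a), ?u a)"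
    if a: "a \<in> choices X v c" for a \<kappa>'
  proof -
    have "length (work_acts a) = ?m" using a choices_subset_actions[OF X] by (auto simp: actions_def)
    then show ?thesis using wt_write_heads[of T s ?m "?e a" S x \<kappa>' C "?u a"] l sp st(2) e by simp
  qed
  have ch: "delta X (st e s) (cel e) ?g (read_oracle (otape c)) = choices X v c"
    by (simp add: choices_def st)
  have ch2: "choices X v c \<inter> actions X = choices X v c" using choices_subset_actions[OF X] by blast
  \<comment> \<open>The register \<open>act\<close> remembers the action, so distinct actions have
    distinct outcomes and none is lost when the image is formed.\<close>
  have inj: "inj_on (\<lambda>a. (?e a, MStay, if em then emit a else None)) (choices X v c)"
  proof (rule inj_onI)
    fix a b assume "(?e a, MStay, if em then emit a else None) = (?e b, MStay, if em then emit b else None)"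
    then have "act (fst (?e a, MStay, if em then emit a else None)) = act (fst (?e b, MStay, if em then emit b else None))"
      by (rule arg_cong)
    then show "a = b" by simp
  qed
  have ip: "in_pos c \<le> Suc (length v)" using X(2) by (simp add: wf_config_def)
  have mv: "wt x (move_ctr (Pos s) (\<lambda>e. in_move (act e)) cel) \<kappa> (?e a, 0, word S C T', u') =
     \<kappa> (?e a, 0, word S (C(Pos s := mv_within v (in_move a) (in_pos c))) T', u')" for a T' u'
    using wt_move_ctr[of cel "?e a" v C "Pos s" S 0 x "\<lambda>e. in_move (act e)" \<kappa> T' u'] st ip v e by simp
  have "wt x (choose_act X s em z) \<kappa>' (e\<lparr>gs := ?g\<rparr>, 0, word S C T, u) =
    (\<Sum>a\<in>choices X v c. \<kappa>' (?e a, 0, word S C T, ?u a))" for \<kappa>'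
    unfolding choose_act_def
    by (simp add: z ch ch2 sum.reindex[OF inj] mv_within_def emitted_def)
      (auto simp: emitted_def intro!: sum.cong split: option.splits)
  then show ?thesis
    by (simp add: step_com_def reads writes mv)
qed

section \<open>Evaluating the oracle\<close>

definition idle_act :: "(nat, nat, 'a) action" where
  "idle_act = \<lparr> new_state = 0, in_move = MStay, work_acts = [], emit = None, ocmd = OIdle \<rparr>"

text \<open>A canonical form of the registers. Weights are functions of the whole store, so
  leftovers must be removed before runs that yield the same symbol can be identified.\<close>

definition tidy :: "(slot \<Rightarrow> nat) \<Rightarrow> (slot \<Rightarrow> 'a cell) \<Rightarrow> mode \<Rightarrow> 'a regs" where
  "tidy q r m = \<lparr> st = q, res = r, cel = LeftEnd, gs = [], act = idle_act, mode = m,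
     fl = False, car = False, ini = False, asked = False \<rparr>"

lemma tidy_simps [simp]:
  "st (tidy q r m) = q" "res (tidy q r m) = r" "cel (tidy q r m) = LeftEnd" "gs (tidy q r m) = []"
  "act (tidy q r m) = idle_act" "mode (tidy q r m) = m" "\<not> fl (tidy q r m)" "\<not> car (tidy q r m)"
  "\<not> ini (tidy q r m)" "\<not> asked (tidy q r m)"
  "(tidy q r m)\<lparr>st := q'\<rparr> = tidy q' r m" "(tidy q r m)\<lparr>res := r'\<rparr> = tidy q r' m"
  "(tidy q r m)\<lparr>mode := m'\<rparr> = tidy q r m'" "(tidy q r m)\<lparr>asked := False\<rparr> = tidy q r m"
  by (simp_all add: tidy_def)

definition option_list :: "'b option \<Rightarrow> 'b list" where
  "option_list z = (case z of None \<Rightarrow> [] | Some b \<Rightarrow> [b])"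

text \<open>
  With \<open>p\<close> initially in the counter \<open>Cnt s\<close>, capturing the symbols of a word one by one
  leaves the cell of that word at position \<open>p\<close> in \<open>res s\<close>.
\<close>

definition capture :: "slot \<Rightarrow> ((nat, nat, 'a) action \<Rightarrow> 'a option) \<Rightarrow> 'a prog" where
  "capture s sel = Cond (\<lambda>e. sel (act e) = None) skip
     (Seq (zero_test (Cnt s)) (Cond fl (upd (\<lambda>e. e\<lparr>fl := False\<rparr>))
       (Seq (dec (Cnt s)) (Seq (zero_test (Cnt s))
         (upd (\<lambda>e. e\<lparr>res := (if fl e then (res e)(s := Letter (the (sel (act e)))) else res e), fl := False\<rparr>))))))"

text \<open>The invariant is that \<open>res s\<close> shows cell \<open>p\<close> of the word
  produced so far: the end marker while the word is too short, so nothing is left to do when the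
  word ends. Truncated subtraction keeps the counter at 0 once the symbol has passed.\<close>

lemma wt_capture:
  assumes r: "res e s = read_cell w p" "C (Cnt s) = p - length w" "p < 2 ^ S" and e: "\<not> fl e" "\<not> car e"
    and i: "i \<le> Suc (length x)" and w': "w' = w @ option_list (sel (act e))"
  shows "wt x (capture s sel) \<kappa> (e, i, word S C T, u) =
    \<kappa> (e\<lparr>res := (res e)(s := read_cell w' p)\<rparr>, i, word S (C(Cnt s := p - length w')) T, u)"
proof (cases "sel (act e)")
  case None
  then have "w' = w" using w' by (simp add: option_list_def)
  moreover have "(res e)(s := read_cell w p) = res e" "C(Cnt s := p - length w) = C"
    using r by (simp_all add: fun_upd_idem)
  ultimately show ?thesis using None i by (simp add: capture_def)
next
  case (Some b)
  then have w'2: "w' = w @ [b]" using w' by (simp add: option_list_def)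
  show ?thesis
  proof (cases "p - length w")
    case 0
    then have "(res e)(s := read_cell w' p) = res e" "C(Cnt s := p - length w') = C"
      using r w'2 by (auto simp: fun_upd_idem read_cell_def nth_append)
    moreover have "C (Cnt s) < 2 ^ S" using r by simp
    ultimately show ?thesis using Some i 0 r(2) e by (simp add: capture_def wt_zero_test)
  next
    case (Suc v)
    have lt: "C (Cnt s) < 2 ^ S" using r by simp
    have cv: "C (Cnt s) = Suc v" using Suc r by simp
    have v': "p - length w' = v" using w'2 Suc by simp
    \<comment> \<open>Letters have positions from 1 on, behind the left marker; \<open>v = 0\<close>
      says that the new symbol sits at position \<open>p\<close>.\<close>
    have rs: "(if v = 0 then (res e)(s := Letter b) else res e) = (res e)(s := read_cell w' p)"
      using Suc r w'2 by (auto simp: fun_upd_idem read_cell_def nth_append fun_eq_iff)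
    show ?thesis unfolding v' rs[symmetric]
      using Some i cv e lt by (simp add: capture_def wt_zero_test wt_dec[where v = v])
  qed
qed

definition query_sel :: "(nat, nat, 'a) action \<Rightarrow> 'a option" where
  "query_sel a = (case ocmd a of OWrite b \<Rightarrow> Some b | _ \<Rightarrow> None)"

text \<open>A tape with an unfinished query reads as \<open>LeftEnd\<close>, so the replay needs no
  oracle. Once \<open>asked\<close> is set, the remaining rounds of the loop idle.\<close>

definition query_body :: "(nat, nat, 'a) ntm \<Rightarrow> 'a prog" where
  "query_body M = Cond asked skip (Seq (read_input Scr) (Seq (step_com M Scr False (\<lambda>_. LeftEnd))
     (Seq (capture Scr query_sel)
       (upd (\<lambda>e. (tidy (st e) (res e) (mode e))\<lparr>asked := (ocmd (act e) = OAsk)\<rparr>)))))"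

text \<open>The query is the input of \<open>F\<close>; this fetches the cell under the head of
  \<open>F\<close>. Initially \<open>res\<close> shows that cell of the empty word, as the invariant
  of \<open>capture\<close> demands.\<close>

definition read_query :: "(nat, nat, 'a) ntm \<Rightarrow> 'a prog" where
  "read_query M = Seq (copy_slot Sav Scr) (Seq (copy_ctr (Pos Sav) (Pos Scr))
     (Seq (copy_ctr (Pos Fun) (Cnt Scr)) (Seq (zero_test (Pos Fun))
     (Seq (upd (\<lambda>e. e\<lparr>st := (st e)(Scr := st e Sav),
         res := (res e)(Scr := (if fl e then LeftEnd else RightEnd)), fl := False\<rparr>))
     (Seq (Loop (query_body M)) (Seq (clear_slot Scr) (Seq (clear_ctr (Pos Scr)) (Seq (clear_ctr (Cnt Scr))
     (upd (\<lambda>e. (tidy ((st e)(Scr := 0)) ((res e)(Scr := LeftEnd)) (mode e))\<lparr>cel := res e Scr\<rparr>))))))))))"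

definition fun_body :: "(nat, nat, 'a) ntm \<Rightarrow> (nat, nat, 'a) ntm \<Rightarrow> 'a prog" where
  "fun_body M F = Cond (\<lambda>e. st e Fun \<in> accept F) skip (Seq (read_query M)
     (Seq (step_com F Fun False (\<lambda>_. LeftEnd)) (Seq (capture Fun emit)
       (upd (\<lambda>e. tidy (st e) (res e) (mode e))))))"

text \<open>Runs of \<open>F\<close> that do not accept are aborted, so the surviving branches
  correspond to the accepting ones.\<close>

definition run_fun :: "(nat, nat, 'a) ntm \<Rightarrow> (nat, nat, 'a) ntm \<Rightarrow> 'a prog" where
  "run_fun M F = Seq (init_slot Fun (tapes F) (blank F)) (Seq (clear_ctr (Pos Fun))
     (Seq (copy_ctr Ans (Cnt Fun)) (Seq (zero_test Ans)
     (Seq (upd (\<lambda>e. e\<lparr>st := (st e)(Fun := start F),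
         res := (res e)(Fun := (if fl e then LeftEnd else RightEnd)), fl := False\<rparr>))
     (Seq (Loop (fun_body M F)) (Seq (Cond (\<lambda>e. st e Fun \<in> accept F) skip abort)
     (Seq (clear_slot Fun) (Seq (clear_ctr (Pos Fun)) (Seq (clear_ctr (Cnt Fun))
     (upd (\<lambda>e. e\<lparr>st := (st e)(Fun := 0)\<rparr>)))))))))))"

definition query_store :: "(slot \<Rightarrow> nat) \<Rightarrow> (slot \<Rightarrow> 'a cell) \<Rightarrow> mode \<Rightarrow> (ctr \<Rightarrow> nat) \<Rightarrow> simtapes
    \<Rightarrow> 'a list \<Rightarrow> nat \<Rightarrow> nat \<Rightarrow> (nat, nat, 'a) config \<Rightarrow> 'a list \<Rightarrow> ('a regs, letter, 'a) store" where
  "query_store q r m C T u S p c w = (tidy (q(Scr := cstate c)) (r(Scr := read_cell w p)) m, 0,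
     word S (C(Pos Scr := in_pos c, Cnt Scr := p - length w)) (T(Scr := work c)), u)"

text \<open>The margin in \<open>Suc p < S\<close> leaves room for a right move, which the
  simulation makes before it is known whether the oracle command of the same step succeeds.\<close>

locale simulated =
  fixes M F :: "(nat, nat, 'a::finite) ntm" and f :: "'a pfun" and x :: "'a list" and S :: nat
  assumes wfM: "wf_ntm M" and wfF: "wf_ntm F" and freeF: "oracle_free F"
    and det: "deterministic_queries f M"
    and spaceM: "\<And>c. reachable f M x c \<Longrightarrow> \<forall>(t, p)\<in>set (work c). Suc p < S"
    and len: "Suc (length x) < 2 ^ S"
begin

context
  fixes q0 :: "slot \<Rightarrow> nat" and r0 :: "slot \<Rightarrow> 'a cell" and m0 :: mode and C :: "ctr \<Rightarrow> nat"
    and T :: simtapes and u :: "'a list" and p :: nat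
  assumes p: "p < 2 ^ S" and Tmp: "C Tmp = 0"
begin

text \<open>The Ruzzo-Simon-Tompa condition enters here: it leaves a single choice, so the replay
  neither branches nor multiplies weights.\<close>

lemma wt_query_body:
  assumes c: "reachable f M x c" "otape c = Query w" and a: "a \<in> choices M x c"
    and w': "w' = w @ option_list (query_sel a)"
  shows "wt x (query_body M) \<kappa> (query_store q0 r0 m0 C T u S p c w) =
    \<kappa> ((tidy (q0(Scr := new_state a)) (r0(Scr := read_cell w' p)) m0)\<lparr>asked := (ocmd a = OAsk)\<rparr>, 0,
      word S (C(Pos Scr := mv_within x (in_move a) (in_pos c), Cnt Scr := p - length w'))
        (T(Scr := map2 (\<lambda>(y, d) (t, p). (t(p := y), mv d p)) (work_acts a) (work c))), u)"
proof -
  have wf: "wf_config M x c" using reachable_wf_config[OF wfM c(1)] .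
  have ch: "choices M x c = {a}" using det c a by (force simp: deterministic_queries_def)
  let ?e = "tidy (q0(Scr := cstate c)) (r0(Scr := read_cell w p)) m0"
  let ?C = "C(Pos Scr := in_pos c, Cnt Scr := p - length w)"
  let ?C' = "?C(Pos Scr := mv_within x (in_move a) (in_pos c))"
  let ?T' = "T(Scr := map2 (\<lambda>(y, d) (t, p). (t(p := y), mv d p)) (work_acts a) (work c))"
  let ?e' = "?e\<lparr>cel := read_cell x (in_pos c), gs := map (\<lambda>(t, p). t p) (work c), act := a,
      st := (q0(Scr := new_state a))\<rparr>"
  have ri: "wt x (read_input Scr) \<kappa>' (?e, 0, word S ?C (T(Scr := work c)), u) =
      \<kappa>' (?e\<lparr>cel := read_cell x (in_pos c)\<rparr>, 0, word S ?C (T(Scr := work c)), u)" for \<kappa>'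
    using wt_read_input[of ?C Scr x S ?e \<kappa>' "T(Scr := work c)" u] len Tmp wf
    by (simp add: wf_config_def)
  have sc: "wt x (step_com M Scr False (\<lambda>_. LeftEnd)) \<kappa>'
      (?e\<lparr>cel := read_cell x (in_pos c)\<rparr>, 0, word S ?C (T(Scr := work c)), u) =
      \<kappa>' (?e', 0, word S ?C' ?T', u)" for \<kappa>'
    by (subst wt_step_com[OF wfM wf spaceM[OF c(1)]]) (use c(2) len ch in simp_all)
  have cp: "wt x (capture Scr query_sel) \<kappa>' (?e', 0, word S ?C' ?T', u) =
      \<kappa>' (?e'\<lparr>res := (res ?e')(Scr := read_cell w' p)\<rparr>, 0, word S (?C'(Cnt Scr := p - length w')) ?T', u)" for \<kappa>'
    by (rule wt_capture) (use p w' in simp_all)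
  have CC: "?C'(Cnt Scr := p - length w') = C(Pos Scr := mv_within x (in_move a) (in_pos c), Cnt Scr := p - length w')"
    by (simp add: fun_upd_twist)
  show ?thesis
    by (simp only: query_store_def query_body_def wt.simps(3,4) fst_conv tidy_simps if_False ri sc cp CC) simp
qed

lemma query_idle: "asked (fst s) \<Longrightarrow> fst (snd s) = 0 \<Longrightarrow> (wt x (query_body M) ^^ n) \<kappa> s = \<kappa> s"
  by (induction n; cases s) (simp_all add: query_body_def)

text \<open>What remains in slot \<open>Scr\<close> is left unspecified, since
  \<open>read_query\<close> clears it. One round beyond \<open>as\<close> is needed for the asking
  step itself.\<close>

lemma wt_query_loop:
  "run f M x c as = Some c1 \<Longrightarrow> \<forall>b\<in>set as. ocmd b \<noteq> OAsk \<Longrightarrow> reachable f M x c \<Longrightarrow> otape c = Query w \<Longrightarrow>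
    otape c1 = Query y \<Longrightarrow> a \<in> choices M x c1 \<Longrightarrow> ocmd a = OAsk \<Longrightarrow> length as < n \<Longrightarrow>
    \<exists>q1 i1 i2 ws. (wt x (query_body M) ^^ n) \<kappa> (query_store q0 r0 m0 C T u S p c w) =
      \<kappa> ((tidy (q0(Scr := q1)) (r0(Scr := read_cell y p)) m0)\<lparr>asked := True\<rparr>, 0,
        word S (C(Pos Scr := i1, Cnt Scr := i2)) (T(Scr := ws)), u)"
proof (induction as arbitrary: c w n)
  case Nil
  obtain n' where n: "n = Suc n'" using Nil by (cases n) auto
  have c: "c1 = c" "y = w" using Nil by auto
  have s: "w = w @ option_list (query_sel a)" using Nil by (simp add: option_list_def query_sel_def)
  show ?case unfolding n funpow.simps o_def c(2)
    by (subst wt_query_body[OF Nil.prems(3,4) _ s]) (use Nil c in \<open>auto simp: query_idle\<close>)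
next
  case (Cons b as)
  obtain n' where n: "n = Suc n'" using Cons.prems by (cases n) auto
  obtain c' where c': "b \<in> choices M x c" "perform f x b c = Some c'" "run f M x c' as = Some c1"
    using Cons.prems(1) by (auto simp: Option.bind_eq_Some_conv split: if_splits)
  let ?w = "w @ option_list (query_sel b)"
  have o: "otape c' = Query ?w" "ocmd b \<noteq> OAsk"
    using c'(2) Cons.prems(2,4) by (cases "ocmd b"; auto simp: perform_def option_list_def query_sel_def)+
  have "query_store q0 r0 m0 C T u S p c' ?w = ((tidy (q0(Scr := new_state b)) (r0(Scr := read_cell ?w p)) m0)\<lparr>asked := (ocmd b = OAsk)\<rparr>, 0,
      word S (C(Pos Scr := mv_within x (in_move b) (in_pos c), Cnt Scr := p - length ?w))
        (T(Scr := map2 (\<lambda>(y, d) (t, p). (t(p := y), mv d p)) (work_acts b) (work c))), u)"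
    using c'(2) o(2) by (auto simp: query_store_def perform_def)
  then have st: "wt x (query_body M) \<kappa>' (query_store q0 r0 m0 C T u S p c w) = \<kappa>' (query_store q0 r0 m0 C T u S p c' ?w)" for \<kappa>'
    using wt_query_body[OF Cons.prems(3,4) c'(1) refl] by simp
  have "reachable f M x c'" using reachable_step Cons.prems(3) c' by blast
  from Cons.IH[OF c'(3) _ this o(1) Cons.prems(5-7), of n'] show ?case
    unfolding n funpow.simps o_def st using Cons.prems(2,8) n by simp
qed

end

text \<open>From \<open>cs\<close>, where a query has just been opened, \<open>M\<close> writes
  \<open>y\<close> and can then ask; the bound on \<open>as\<close> lets the clocked replay reach
  that point.\<close>

definition query_run :: "(nat, nat, 'a) config \<Rightarrow> 'a list \<Rightarrow> bool" where
  "query_run cs y \<longleftrightarrow> (\<exists>as c1 a. reachable f M x cs \<and> otape cs = Query [] \<and> run f M x cs as = Some c1 \<and>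
     (\<forall>b\<in>set as. ocmd b \<noteq> OAsk) \<and> otape c1 = Query y \<and> a \<in> choices M x c1 \<and> ocmd a = OAsk \<and>
     length as < 2 ^ S)"

definition saved :: "(slot \<Rightarrow> nat) \<Rightarrow> (ctr \<Rightarrow> nat) \<Rightarrow> simtapes \<Rightarrow> (nat, nat, 'a) config \<Rightarrow> bool" where
  "saved q C T cs \<longleftrightarrow> q Sav = cstate cs \<and> T Sav = work cs \<and> C (Pos Sav) = in_pos cs \<and>
     q Scr = 0 \<and> C (Pos Scr) = 0 \<and> C (Cnt Scr) = 0 \<and> C Tmp = 0 \<and> T Scr = []"

text \<open>Apart from \<open>cel\<close> the store is restored exactly, so the query can be reread
  in every step of \<open>F\<close>.\<close>

lemma wt_read_query:
  assumes y: "query_run cs y" and s: "saved q C T cs" and r: "r Scr = LeftEnd" and p: "C (Pos Fun) < 2 ^ S"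
  shows "wt x (read_query M) \<kappa> (tidy q r m, 0, word S C T, u) =
    \<kappa> ((tidy q r m)\<lparr>cel := read_cell y (C (Pos Fun))\<rparr>, 0, word S C T, u)"
proof -
  obtain as c1 a where a: "reachable f M x cs" "otape cs = Query []" "run f M x cs as = Some c1"
     "\<forall>b\<in>set as. ocmd b \<noteq> OAsk" "otape c1 = Query y" "a \<in> choices M x c1" "ocmd a = OAsk" "length as < 2 ^ S"
    using y by (auto simp: query_run_def)
  let ?p = "C (Pos Fun)"
  let ?C = "C(Pos Scr := C (Pos Sav), Cnt Scr := ?p)"
  let ?s = "query_store q r m C T u S ?p cs []"
  have Tmp: "C Tmp = 0" using s by (simp add: saved_def)
  have init: "(tidy (q(Scr := q Sav)) (r(Scr := if ?p = 0 then LeftEnd else RightEnd)) m, 0,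
      word S ?C (T(Scr := T Sav)), u) = ?s"
    using s by (simp add: query_store_def saved_def read_cell_def)
  define R where "R = (\<lambda>\<kappa>'. wt x (clear_slot Scr) (wt x (clear_ctr (Pos Scr)) (wt x (clear_ctr (Cnt Scr))
     (wt x (upd (\<lambda>e. (tidy ((st e)(Scr := 0)) ((res e)(Scr := LeftEnd)) (mode e))\<lparr>cel := res e Scr\<rparr>)) \<kappa>'))))"
  obtain q1 i1 i2 ws where L: "(wt x (query_body M) ^^ 2 ^ S) (R \<kappa>) ?s =
      R \<kappa> ((tidy (q(Scr := q1)) (r(Scr := read_cell y ?p)) m)\<lparr>asked := True\<rparr>, 0,
        word S (C(Pos Scr := i1, Cnt Scr := i2)) (T(Scr := ws)), u)"
    using wt_query_loop[where C = C and p = "?p", OF p Tmp a(3,4,1,2,5-8)] by blast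
  have C: "C(Pos Scr := i1, Cnt Scr := i2, Pos Scr := 0, Cnt Scr := 0) = C"
    "T(Scr := ws, Scr := []) = T" "q(Scr := q1, Scr := 0) = q" "r(Scr := z, Scr := LeftEnd) = r" for z
    using s r by (auto simp: saved_def fun_eq_iff)
  have "wt x (read_query M) \<kappa> (tidy q r m, 0, word S C T, u) = (wt x (query_body M) ^^ 2 ^ S) (R \<kappa>)
      (tidy (q(Scr := q Sav)) (r(Scr := if ?p = 0 then LeftEnd else RightEnd)) m, 0,
      word S ?C (T(Scr := T Sav)), u)"
    using p by (simp add: read_query_def R_def wt_zero_test)
  also have "\<dots> = \<kappa> ((tidy q r m)\<lparr>cel := read_cell y ?p\<rparr>, 0, word S C T, u)"
    unfolding init L unfolding R_def using C by simp
  finally show ?thesis .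
qed

definition fun_store :: "(slot \<Rightarrow> nat) \<Rightarrow> (slot \<Rightarrow> 'a cell) \<Rightarrow> mode \<Rightarrow> (ctr \<Rightarrow> nat) \<Rightarrow> simtapes
    \<Rightarrow> 'a list \<Rightarrow> nat \<Rightarrow> (nat, nat, 'a) config \<Rightarrow> ('a regs, letter, 'a) store" where
  "fun_store q r m C T u p d = (tidy (q(Fun := cstate d)) (r(Fun := read_cell (out d) p)) m, 0,
     word S (C(Pos Fun := in_pos d, Cnt Fun := p - length (out d))) (T(Fun := work d)), u)"

lemma wt_fun_body:
  assumes y: "query_run cs y" and s: "saved q C T cs" and r: "r Scr = LeftEnd" and p: "p < 2 ^ S"
    and ly: "Suc (length y) < 2 ^ S" and d: "reachable Map.empty F y d"
    and sp: "\<forall>(t, p)\<in>set (work d). Suc p < S" and na: "cstate d \<notin> accept F"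
  shows "wt x (fun_body M F) \<kappa> (fun_store q r m C T u p d) =
    (\<Sum>a\<in>choices F y d. case perform Map.empty y a d of None \<Rightarrow> 0
       | Some d' \<Rightarrow> \<kappa> (fun_store q r m C T u p d'))"
proof -
  have wf: "wf_config F y d" using reachable_wf_config[OF wfF d] .
  have od: "otape d = Answer [] 0"
    using d oracle_free_otape[OF freeF] by (force simp: reachable_def init_config_def)
  let ?q = "q(Fun := cstate d)" and ?r = "r(Fun := read_cell (out d) p)"
  let ?C = "C(Pos Fun := in_pos d, Cnt Fun := p - length (out d))" and ?T = "T(Fun := work d)"
  let ?e = "(tidy ?q ?r m)\<lparr>cel := read_cell y (in_pos d)\<rparr>"
  have ip: "?C (Pos Fun) < 2 ^ S" using wf ly by (simp add: wf_config_def)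
  have rq: "wt x (read_query M) \<kappa>' (tidy ?q ?r m, 0, word S ?C ?T, u) = \<kappa>' (?e, 0, word S ?C ?T, u)" for \<kappa>'
    using wt_read_query[OF y, of ?q ?C ?T ?r \<kappa>' m u] s r ip by (simp add: saved_def)
  let ?e' = "\<lambda>a. ?e\<lparr>gs := map (\<lambda>(t, p). t p) (work d), act := a, st := ?q(Fun := new_state a)\<rparr>"
  let ?C' = "\<lambda>a. ?C(Pos Fun := mv_within y (in_move a) (in_pos d))"
  let ?T' = "\<lambda>a. ?T(Fun := map2 (\<lambda>(y, d) (t, p). (t(p := y), mv d p)) (work_acts a) (work d))"
  have sc: "wt x (step_com F Fun False (\<lambda>_. LeftEnd)) \<kappa>' (?e, 0, word S ?C ?T, u) =
      (\<Sum>a\<in>choices F y d. \<kappa>' (?e' a, 0, word S (?C' a) (?T' a), u))" for \<kappa>'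
    by (subst wt_step_com[OF wfF wf sp]) (use od ly in simp_all)
  let ?w = "\<lambda>a. out d @ option_list (emit a)"
  have cp: "wt x (capture Fun emit) \<kappa>' (?e' a, 0, word S (?C' a) (?T' a), u) =
      \<kappa>' ((?e' a)\<lparr>res := (res (?e' a))(Fun := read_cell (?w a) p)\<rparr>, 0,
        word S ((?C' a)(Cnt Fun := p - length (?w a))) (?T' a), u)" for \<kappa>' a
    by (rule wt_capture) (use p in simp_all)
  have "wt x (fun_body M F) \<kappa> (fun_store q r m C T u p d) =
     (\<Sum>a\<in>choices F y d. wt x (upd (\<lambda>e. tidy (st e) (res e) (mode e))) \<kappa>
       ((?e' a)\<lparr>res := (res (?e' a))(Fun := read_cell (?w a) p)\<rparr>, 0,
        word S ((?C' a)(Cnt Fun := p - length (?w a))) (?T' a), u))"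
    using na by (simp only: fun_store_def fun_body_def wt.simps(3,4) fst_conv tidy_simps fun_upd_same if_False rq sc cp)
  also have "\<dots> = (\<Sum>a\<in>choices F y d. case perform Map.empty y a d of None \<Rightarrow> 0
       | Some d' \<Rightarrow> \<kappa> (fun_store q r m C T u p d'))"
  proof (rule sum.cong)
    fix a assume "a \<in> choices F y d"
    then have "ocmd a = OIdle" using freeF by (auto simp: oracle_free_def choices_def)
    then show "wt x (upd (\<lambda>e. tidy (st e) (res e) (mode e))) \<kappa>
       ((?e' a)\<lparr>res := (res (?e' a))(Fun := read_cell (?w a) p)\<rparr>, 0,
        word S ((?C' a)(Cnt Fun := p - length (?w a))) (?T' a), u) =
       (case perform Map.empty y a d of None \<Rightarrow> 0 | Some d' \<Rightarrow> \<kappa> (fun_store q r m C T u p d'))"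
      by (simp add: perform_def fun_store_def option_list_def fun_upd_twist)
  qed simp
  finally show ?thesis .
qed

lemma wt_fun_loop:
  assumes y: "query_run cs y" and s: "saved q C T cs" and r: "r Scr = LeftEnd" and p: "p < 2 ^ S"
    and ly: "Suc (length y) < 2 ^ S"
    and sp: "\<And>d. reachable Map.empty F y d \<Longrightarrow> \<forall>(t, p)\<in>set (work d). Suc p < S"
  shows "reachable Map.empty F y d \<Longrightarrow> (wt x (fun_body M F) ^^ n) \<kappa> (fun_store q r m C T u p d) =
    paths Map.empty F y n (\<lambda>d. \<kappa> (fun_store q r m C T u p d)) d"
proof (induction n arbitrary: d)
  case (Suc n)
  show ?case
  proof (cases "cstate d \<in> accept F")
    case True
    have "wt x (fun_body M F) \<kappa>' (fun_store q r m C T u p d) = \<kappa>' (fun_store q r m C T u p d)" for \<kappa>'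
      using True by (simp add: fun_body_def fun_store_def)
    then have "(wt x (fun_body M F) ^^ Suc n) \<kappa> (fun_store q r m C T u p d) = \<kappa> (fun_store q r m C T u p d)"
      by (induction n) simp_all
    then show ?thesis using True by simp
  next
    case False
    have "(wt x (fun_body M F) ^^ Suc n) \<kappa> (fun_store q r m C T u p d) =
       (\<Sum>a\<in>choices F y d. case perform Map.empty y a d of None \<Rightarrow> 0
       | Some d' \<Rightarrow> (wt x (fun_body M F) ^^ n) \<kappa> (fun_store q r m C T u p d'))"
      using wt_fun_body[where r = r, OF y s r p ly Suc.prems sp[OF Suc.prems] False, of "(wt x (fun_body M F) ^^ n) \<kappa>"] by simp
    also have "\<dots> = paths Map.empty F y (Suc n) (\<lambda>d. \<kappa> (fun_store q r m C T u p d)) d"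
      using False Suc.IH reachable_step[OF Suc.prems] by (auto intro!: sum.cong split: option.splits)
    finally show ?thesis .
  qed
qed simp

text \<open>Each accepting branch of \<open>F\<close> on the query contributes once, and the store
  reached depends on the branch only through the captured cell of its output.\<close>

lemma wt_run_fun:
  assumes y: "query_run cs y" and s: "saved q C T cs" and r: "r Scr = LeftEnd" and p: "C Ans < 2 ^ S"
    and ly: "Suc (length y) < 2 ^ S"
    and sp: "\<And>d. reachable Map.empty F y d \<Longrightarrow> \<forall>(t, p)\<in>set (work d). Suc p < S"
    and tm: "\<And>as. run Map.empty F y (init_config F) as \<noteq> None \<Longrightarrow> length as \<le> 2 ^ S"
    and z: "q Fun = 0" "C (Pos Fun) = 0" "C (Cnt Fun) = 0" "T Fun = []"
  shows "finite (accepting_into Map.empty F y UNIV (init_config F)) \<and>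
    wt x (run_fun M F) \<kappa> (tidy q r m, 0, word S C T, u) =
    (\<Sum>as\<in>accepting_into Map.empty F y UNIV (init_config F).
      \<kappa> (tidy q (r(Fun := read_cell (out (the (run Map.empty F y (init_config F) as))) (C Ans))) m, 0, word S C T, u))"
proof -
  let ?p = "C Ans" and ?i = "init_config F"
  let ?s = "fun_store q r m C T u ?p"
  have init: "?s ?i = (tidy (q(Fun := start F)) (r(Fun := if ?p = 0 then LeftEnd else RightEnd)) m, 0,
      word S (C(Pos Fun := 0, Cnt Fun := ?p)) (T(Fun := replicate (tapes F) (\<lambda>_. blank F, 0))), u)"
    by (simp add: fun_store_def init_config_def read_cell_def)
  define R where "R = (\<lambda>\<kappa>'. wt x (Cond (\<lambda>e. st e Fun \<in> accept F) skip abort)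
    (wt x (clear_slot Fun) (wt x (clear_ctr (Pos Fun)) (wt x (clear_ctr (Cnt Fun))
     (wt x (upd (\<lambda>e. e\<lparr>st := (st e)(Fun := 0)\<rparr>)) \<kappa>')))))"
  have R: "R \<kappa> (?s d) = (if cstate d \<in> accept F
      then \<kappa> (tidy q (r(Fun := read_cell (out d) ?p)) m, 0, word S C T, u) else 0)" for d
  proof -
    have "C(Pos Fun := in_pos d, Cnt Fun := v, Pos Fun := 0, Cnt Fun := 0) = C"
      "T(Fun := work d, Fun := []) = T" "q(Fun := cstate d, Fun := 0) = q" for v
      using z by (auto simp: fun_eq_iff)
    then show ?thesis by (simp add: R_def fun_store_def)
  qed
  have ri: "reachable Map.empty F y ?i" by (auto simp: reachable_def intro: exI[of _ "[]"])
  have "wt x (run_fun M F) \<kappa> (tidy q r m, 0, word S C T, u) = (wt x (fun_body M F) ^^ 2 ^ S) (R \<kappa>) (?s ?i)"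
    using p by (simp add: run_fun_def R_def wt_zero_test init)
  also have "\<dots> = paths Map.empty F y (2 ^ S) (\<lambda>d. R \<kappa> (?s d)) ?i"
    by (rule wt_fun_loop[where r = r, OF y s r p ly sp ri])
  finally have w: "wt x (run_fun M F) \<kappa> (tidy q r m, 0, word S C T, u) =
      paths Map.empty F y (2 ^ S) (\<lambda>d. R \<kappa> (?s d)) ?i" .
  have "finite (accepting_into Map.empty F y UNIV ?i) \<and> paths Map.empty F y (2 ^ S) (\<lambda>d. R \<kappa> (?s d)) ?i =
     (\<Sum>as\<in>accepting_into Map.empty F y UNIV ?i. R \<kappa> (?s (the (run Map.empty F y ?i as))))"
    by (rule paths_sum[OF wfF]) (use R wf_config_init[OF wfF] tm in auto)
  moreover have "(\<Sum>as\<in>accepting_into Map.empty F y UNIV ?i. R \<kappa> (?s (the (run Map.empty F y ?i as)))) =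
     (\<Sum>as\<in>accepting_into Map.empty F y UNIV ?i.
      \<kappa> (tidy q (r(Fun := read_cell (out (the (run Map.empty F y ?i as))) ?p)) m, 0, word S C T, u))"
    by (rule sum.cong) (auto simp: R accepting_into_def)
  ultimately show ?thesis using w by simp
qed

end

section \<open>Simulating the oracle machine\<close>

lemma const_upd [simp]: "(\<lambda>_. c)(a := c) = (\<lambda>_. c)"
  by auto

text \<open>The state, head and work tapes have already been advanced, so \<open>OOpen\<close> saves
  the configuration after the opening action. \<open>OWrite\<close> stores nothing. At
  \<open>OAsk\<close> the machine \<open>F\<close> is run although no symbol is wanted yet: this
  removes, modulo \<open>k\<close>, the branches whose query has no answer. Each
  \<open>abort\<close> mirrors a failing \<open>oracle_step\<close>.\<close>

definition ocmd_com :: "(nat, nat, 'a) ntm \<Rightarrow> (nat, nat, 'a) ntm \<Rightarrow> 'a prog" where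
  "ocmd_com M F =
    Cond (\<lambda>e. ocmd (act e) = OIdle) skip
    (Cond (\<lambda>e. \<exists>d. ocmd (act e) = OMove d)
      (Cond (\<lambda>e. mode e = Writing) abort
        (move_ctr Ans (\<lambda>e. case ocmd (act e) of OMove d \<Rightarrow> d | _ \<Rightarrow> MStay) (\<lambda>e. res e Fun)))
    (Cond (\<lambda>e. ocmd (act e) = OOpen)
      (Cond (\<lambda>e. mode e = Writing) abort
        (Seq (copy_slot Cur Sav) (Seq (copy_ctr (Pos Cur) (Pos Sav)) (Seq (clear_ctr Ans)
          (upd (\<lambda>e. e\<lparr>st := (st e)(Sav := st e Cur), mode := Writing\<rparr>))))))
    (Cond (\<lambda>e. mode e \<noteq> Writing) abort
    (Cond (\<lambda>e. ocmd (act e) = OAsk)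
      (Seq (upd (\<lambda>e. tidy (st e) ((res e)(Fun := LeftEnd)) Answered)) (run_fun M F))
      skip))))"

text \<open>Before the first query the tape holds the empty answer, whose cells are just the two end
  markers.\<close>

definition oracle_cell :: "(nat, nat, 'a) ntm \<Rightarrow> (nat, nat, 'a) ntm \<Rightarrow> 'a prog" where
  "oracle_cell M F = Cond (\<lambda>e. mode e = Answered) (run_fun M F)
     (Seq (zero_test Ans) (upd (\<lambda>e. e\<lparr>res := (res e)(Fun :=
        (if mode e = Writing \<or> fl e then LeftEnd else RightEnd)), fl := False\<rparr>)))"

definition main_body :: "(nat, nat, 'a) ntm \<Rightarrow> (nat, nat, 'a) ntm \<Rightarrow> 'a prog" where
  "main_body M F = Cond (\<lambda>e. st e Cur \<in> accept M) skip (Seq (oracle_cell M F)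
     (Seq (read_input Cur) (Seq (step_com M Cur True (\<lambda>e. res e Fun)) (Seq (ocmd_com M F)
       (upd (\<lambda>e. tidy (st e) ((res e)(Fun := LeftEnd)) (mode e)))))))"

text \<open>The setup phase leaves the input head at the right end; hence the initial
  \<open>rewind\<close>.\<close>

definition simulation :: "(nat, nat, 'a) ntm \<Rightarrow> (nat, nat, 'a) ntm \<Rightarrow> 'a prog" where
  "simulation M F = Seq rewind (Seq (init_slot Cur (tapes M) (blank M))
     (Seq (upd (\<lambda>e. e\<lparr>st := (st e)(Cur := start M)\<rparr>))
     (Seq (Loop (main_body M F)) (Cond (\<lambda>e. st e Cur \<in> accept M) skip abort))))"

definition main_store :: "(nat, nat, 'a) config \<Rightarrow> (nat, nat, 'a) config \<Rightarrow> mode \<Rightarrow> nat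
    \<Rightarrow> nat \<Rightarrow> ('a regs, letter, 'a) store" where
  "main_store c cs m pa S = (tidy ((\<lambda>_. 0)(Cur := cstate c, Sav := cstate cs)) (\<lambda>_. LeftEnd) m, 0,
     word S ((\<lambda>_. 0)(Pos Cur := in_pos c, Pos Sav := in_pos cs, Ans := pa))
       ((\<lambda>_. [])(Cur := work c, Sav := work cs)), out c)"

text \<open>Group the sum by the value of \<open>g\<close>. A class other than that of
  \<open>y\<close> enters with a size divisible by \<open>k\<close>, whatever the value of
  \<open>h\<close> there.\<close>

lemma sum_by_class:
  fixes h :: "'c \<Rightarrow> nat"
  assumes "finite A" and "\<And>b. b \<noteq> y \<Longrightarrow> [card {a\<in>A. g a = b} = 0] (mod k)"
  shows "[(\<Sum>a\<in>A. h (g a)) = card {a\<in>A. g a = y} * h y] (mod k)"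
proof -
  have "(\<Sum>a\<in>A. h (g a)) = (\<Sum>b\<in>g ` A. \<Sum>a\<in>{a\<in>A. g a = b}. h (g a))"
    by (rule sum.image_gen[OF assms(1)])
  also have "\<dots> = (\<Sum>b\<in>g ` A. card {a\<in>A. g a = b} * h b)" by (intro sum.cong) auto
  also have "\<dots> = (\<Sum>b\<in>insert y (g ` A). card {a\<in>A. g a = b} * h b)"
  proof (rule sum.mono_neutral_left)
    show "\<forall>b\<in>insert y (g ` A) - g ` A. card {a\<in>A. g a = b} * h b = 0"
    proof
      fix b assume "b \<in> insert y (g ` A) - g ` A"
      then have "{a\<in>A. g a = b} = {}" by auto
      then show "card {a\<in>A. g a = b} * h b = 0" by (simp only: card.empty mult_zero_left)
    qed
  qed (use assms(1) in auto)
  also have "[\<dots> = (\<Sum>b\<in>insert y (g ` A). if b = y then card {a\<in>A. g a = y} * h y else 0)] (mod k)"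
  proof (rule cong_sum)
    fix b
    show "[card {a\<in>A. g a = b} * h b = (if b = y then card {a\<in>A. g a = y} * h y else 0)] (mod k)"
      using cong_scalar_right[OF assms(2), of b "h b"] by auto
  qed
  finally show ?thesis using assms(1) by simp
qed

text \<open>The bound in \<open>timeM\<close> is strict because the replay of a query takes one more
  round than the run that writes it.\<close>

locale simulated_mod = simulated +
  fixes k :: nat
  assumes FUL: "\<And>w y. f w = Some y \<Longrightarrow> [card (accepting_branches_with_output Map.empty F w y) = 1] (mod k)"
      "\<And>w y. f w \<noteq> Some y \<Longrightarrow> [card (accepting_branches_with_output Map.empty F w y) = 0] (mod k)"
    and timeM: "\<And>as. run f M x (init_config M) as \<noteq> None \<Longrightarrow> length as < 2 ^ S"
    and query_len: "\<And>cs w. query_run cs w \<Longrightarrow> Suc (length w) < 2 ^ S"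
    and query_space: "\<And>cs w d. query_run cs w \<Longrightarrow> reachable Map.empty F w d \<Longrightarrow> \<forall>(t, p)\<in>set (work d). Suc p < S"
    and query_time: "\<And>cs w as. query_run cs w \<Longrightarrow> run Map.empty F w (init_config F) as \<noteq> None \<Longrightarrow> length as \<le> 2 ^ S"
    and answer_len: "\<And>cs w y. query_run cs w \<Longrightarrow> f w = Some y \<Longrightarrow> Suc (length y) < 2 ^ S"
begin

text \<open>Branches are grouped by the complete output of \<open>F\<close>, for which the counts
  modulo \<open>k\<close> are known, although the store keeps only one cell of it.\<close>

lemma run_fun_mod:
  assumes y: "query_run cs w" and s: "saved q C T cs" and r: "r Scr = LeftEnd" and p: "C Ans < 2 ^ S"
    and z: "q Fun = 0" "C (Pos Fun) = 0" "C (Cnt Fun) = 0" "T Fun = []"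
  shows "[wt x (run_fun M F) \<kappa> (tidy q r m, 0, word S C T, u) = (case f w of None \<Rightarrow> 0
     | Some y \<Rightarrow> \<kappa> (tidy q (r(Fun := read_cell y (C Ans))) m, 0, word S C T, u))] (mod k)"
proof -
  let ?i = "init_config F"
  let ?A = "accepting_into Map.empty F w UNIV ?i" and ?g = "\<lambda>as. out (the (run Map.empty F w ?i as))"
  let ?h = "\<lambda>y. \<kappa> (tidy q (r(Fun := read_cell y (C Ans))) m, 0, word S C T, u)"
  have W: "finite ?A" "wt x (run_fun M F) \<kappa> (tidy q r m, 0, word S C T, u) = (\<Sum>as\<in>?A. ?h (?g as))"
    using wt_run_fun[where r = r, OF y s r p query_len[OF y] query_space[OF y] query_time[OF y] z] by simp_all
  have c: "card {a\<in>?A. ?g a = b} = card (accepting_branches_with_output Map.empty F w b)" for b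
  proof -
    have "{a\<in>?A. ?g a = b} = accepting_branches_with_output Map.empty F w b"
      by (auto simp: accepting_branches_into(2) accepting_into_def)
    then show ?thesis by simp
  qed
  show ?thesis
  proof (cases "f w")
    case None
    \<comment> \<open>Outside the domain all classes have size 0 modulo \<open>k\<close>; the word
      \<open>[]\<close> is an arbitrary choice.\<close>
    have "[(\<Sum>as\<in>?A. ?h (?g as)) = card {a\<in>?A. ?g a = []} * ?h []] (mod k)"
      by (rule sum_by_class[OF W(1)]) (unfold c, use FUL(2) None in simp)
    also have "[card {a\<in>?A. ?g a = []} * ?h [] = 0 * ?h []] (mod k)"
      unfolding c by (rule cong_scalar_right) (use FUL(2) None in simp)
    finally show ?thesis using W(2) None by simp
  next
    case (Some y)
    have "[(\<Sum>as\<in>?A. ?h (?g as)) = card {a\<in>?A. ?g a = y} * ?h y] (mod k)"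
      by (rule sum_by_class[OF W(1)]) (unfold c, use FUL(2) Some in simp)
    also have "[card {a\<in>?A. ?g a = y} * ?h y = 1 * ?h y] (mod k)"
      unfolding c by (rule cong_scalar_right) (use FUL(1) Some in simp)
    finally show ?thesis using W(2) Some by simp
  qed
qed

text \<open>How an oracle tape that is not stored can be recovered: from the saved configuration
  \<open>cs\<close>, the mode, and the head position \<open>pa\<close> on the answer.
  \<open>NoQuery\<close> says nothing about \<open>cs\<close>.\<close>

definition linked :: "(nat, nat, 'a) config \<Rightarrow> (nat, nat, 'a) config \<Rightarrow> mode \<Rightarrow> nat \<Rightarrow> bool" where
  "linked c cs m pa = (case m of
      NoQuery \<Rightarrow> otape c = Answer [] pa \<and> pa \<le> 1
    | Writing \<Rightarrow> pa = 0 \<and> (\<exists>w as. otape c = Query w \<and> reachable f M x cs \<and> otape cs = Query [] \<and>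
        run f M x cs as = Some c \<and> (\<forall>b\<in>set as. ocmd b \<noteq> OAsk))
    | Answered \<Rightarrow> (\<exists>w y. query_run cs w \<and> f w = Some y \<and> otape c = Answer y pa \<and> pa \<le> Suc (length y)))"

lemma linked_query_run:
  assumes "linked c cs Writing pa" "otape c = Query w" "a \<in> choices M x c" "ocmd a = OAsk"
  shows "query_run cs w"
proof -
  obtain as where as: "reachable f M x cs" "otape cs = Query []" "run f M x cs as = Some c" "\<forall>b\<in>set as. ocmd b \<noteq> OAsk"
    using assms(1) by (auto simp: linked_def)
  obtain bs where bs: "run f M x (init_config M) bs = Some cs" using as(1) by (auto simp: reachable_def)
  have "run f M x (init_config M) (bs @ as) \<noteq> None" using bs as(3) by (simp add: run_append)
  then have "length (bs @ as) < 2 ^ S" by (rule timeM)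
  then have "length as < 2 ^ S" by simp
  with as assms show ?thesis unfolding query_run_def by blast
qed

definition oracle_regs :: "(nat, nat, 'a) config \<Rightarrow> (nat, nat, 'a) config \<Rightarrow> mode \<Rightarrow> 'a regs" where
  "oracle_regs c cs m = tidy ((\<lambda>_. 0)(Cur := cstate c, Sav := cstate cs))
     ((\<lambda>_. LeftEnd)(Fun := read_oracle (otape c))) m"

lemma linked_ans: "linked c cs m pa \<Longrightarrow> pa < 2 ^ S"
  using len answer_len by (fastforce simp: linked_def split: mode.splits)

lemma linked_ans_len: "linked c cs m pa \<Longrightarrow> otape c = Answer y p \<Longrightarrow> p = pa \<and> m \<noteq> Writing \<and> pa \<le> Suc (length y) \<and> Suc (length y) < 2 ^ S"
  using len answer_len by (fastforce simp: linked_def split: mode.splits)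

lemma linked_query: "linked c cs m pa \<Longrightarrow> otape c = Query w \<Longrightarrow> m = Writing \<and> pa = 0"
  by (auto simp: linked_def split: mode.splits)

lemma wt_oracle_cell:
  assumes l: "linked c cs m pa"
  shows "[wt x (oracle_cell M F) \<kappa> (main_store c cs m pa S) =
    \<kappa> (oracle_regs c cs m, snd (main_store c cs m pa S))] (mod k)"
proof (cases "m = Answered")
  case True
  then obtain w y where w: "query_run cs w" "f w = Some y" "otape c = Answer y pa" using l by (auto simp: linked_def)
  let ?q = "(\<lambda>_. 0)(Cur := cstate c, Sav := cstate cs)" and ?r = "\<lambda>_. LeftEnd :: 'a cell"
  let ?C = "(\<lambda>_. 0)(Pos Cur := in_pos c, Pos Sav := in_pos cs, Ans := pa)"
  let ?T = "(\<lambda>_. [])(Cur := work c, Sav := work cs)"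
  have "[wt x (run_fun M F) \<kappa> (tidy ?q ?r m, 0, word S ?C ?T, out c) = (case f w of None \<Rightarrow> 0
     | Some y \<Rightarrow> \<kappa> (tidy ?q (?r(Fun := read_cell y (?C Ans))) m, 0, word S ?C ?T, out c))] (mod k)"
    by (rule run_fun_mod[OF w(1)]) (use linked_ans[OF l] in \<open>simp_all add: saved_def\<close>)
  then show ?thesis using w True by (simp add: oracle_cell_def main_store_def oracle_regs_def)
next
  case False
  have "pa < 2 ^ S" using linked_ans[OF l] .
  moreover have "(if m = Writing \<or> pa = 0 then LeftEnd else RightEnd) = read_oracle (otape c)"
    using l False by (cases m) (auto simp: linked_def read_cell_def)
  ultimately have "wt x (oracle_cell M F) \<kappa> (main_store c cs m pa S) =
      \<kappa> (oracle_regs c cs m, snd (main_store c cs m pa S))"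
    using False by (simp add: oracle_cell_def main_store_def oracle_regs_def wt_zero_test)
  then show ?thesis by simp
qed

definition represents :: "('a regs, letter, 'a) store \<Rightarrow> (nat, nat, 'a) config \<Rightarrow> bool" where
  "represents s c \<longleftrightarrow> (\<exists>cs m pa. s = main_store c cs m pa S \<and> linked c cs m pa)"

text \<open>Separates an action from its oracle command, since the simulation carries out the former
  first, even where the latter fails.\<close>

definition after_step :: "(nat, nat, 'a) action \<Rightarrow> (nat, nat, 'a) config \<Rightarrow> 'a otape \<Rightarrow> (nat, nat, 'a) config" where
  "after_step a c t = \<lparr> cstate = new_state a, in_pos = mv_within x (in_move a) (in_pos c),
     work = map2 (\<lambda>(s, d) (t, p). (t(p := s), mv d p)) (work_acts a) (work c),
     out = out c @ emitted a, otape = t \<rparr>"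

lemma perform_after_step:
  "perform f x a c = map_option (after_step a c) (oracle_step f (ocmd a) (otape c))"
  by (cases "oracle_step f (ocmd a) (otape c)") (simp_all add: perform_def after_step_def emitted_def)

lemma wt_ocmd_com:
  assumes l: "linked c cs m pa" and c: "reachable f M x c" and a: "a \<in> choices M x c"
    and \<kappa>: "\<And>s' c'. reachable f M x c' \<Longrightarrow> represents s' c' \<Longrightarrow> [\<kappa> s' = \<kappa>' c'] (mod k)"
    and e: "st e = (\<lambda>_. 0)(Cur := new_state a, Sav := cstate cs)" "act e = a" "mode e = m"
      "res e = (\<lambda>_. LeftEnd)(Fun := read_oracle (otape c))" "\<not> car e"
  shows "[wt x (ocmd_com M F) (wt x (upd (\<lambda>e. tidy (st e) ((res e)(Fun := LeftEnd)) (mode e))) \<kappa>)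
      (e, snd (main_store (after_step a c t) cs m pa S)) =
    (case perform f x a c of None \<Rightarrow> 0 | Some c' \<Rightarrow> \<kappa>' c')] (mod k)"
proof -
  let ?fin = "wt x (upd (\<lambda>e. tidy (st e) ((res e)(Fun := LeftEnd)) (mode e))) \<kappa>"
  let ?C = "(\<lambda>_. 0)(Pos Cur := mv_within x (in_move a) (in_pos c), Pos Sav := in_pos cs, Ans := pa)"
  let ?T = "(\<lambda>_. [])(Cur := work (after_step a c t), Sav := work cs)"
  let ?u = "out c @ emitted a"
  have sn: "snd (main_store (after_step a c t) cs m pa S) = (0, word S ?C ?T, ?u)"
    by (simp add: main_store_def after_step_def)
  have good: "[\<kappa> (main_store (after_step a c t') cs' m' pa' S) = \<kappa>' (after_step a c t')] (mod k)"
    if "oracle_step f (ocmd a) (otape c) = Some t'" "linked (after_step a c t') cs' m' pa'" for t' cs' m' pa'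
  proof (rule \<kappa>)
    show "reachable f M x (after_step a c t')"
      using reachable_step[OF c a] that(1) by (simp add: perform_after_step)
    show "represents (main_store (after_step a c t') cs' m' pa' S) (after_step a c t')"
      unfolding represents_def using that(2) by blast
  qed
  \<comment> \<open>Any \<open>t'\<close> will do, as \<open>main_store\<close> does not record the
    oracle tape.\<close>
  have fin: "?fin (e, 0, word S ?C ?T, ?u) = \<kappa> (main_store (after_step a c t') cs m pa S)" for t'
    using e by (simp add: main_store_def after_step_def)
  have grow: "linked (after_step a c t') cs Writing pa"
    if grow: "m = Writing" "oracle_step f (ocmd a) (otape c) = Some t'" "ocmd a \<noteq> OAsk" "t' = Query w'" for t' w'
  proof -
    obtain as where as: "reachable f M x cs" "otape cs = Query []" "run f M x cs as = Some c" "\<forall>b\<in>set as. ocmd b \<noteq> OAsk"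
      "pa = 0" using l grow(1) by (auto simp: linked_def)
    have "run f M x cs (as @ [a]) = Some (after_step a c t')"
      using as(3) a grow(2) by (simp add: run_append perform_after_step)
    moreover have "\<forall>b\<in>set (as @ [a]). ocmd b \<noteq> OAsk" using as(4) grow(3) by auto
    moreover have "otape (after_step a c t') = Query w'" using grow(4) by (simp add: after_step_def)
    ultimately show ?thesis using as(1,2,5) by (auto simp: linked_def intro!: exI[of _ "as @ [a]"])
  qed
  show ?thesis
  proof (cases "ocmd a")
    case OIdle
    have "linked (after_step a c (otape c)) cs m pa"
    proof (cases "otape c")
      case (Query w)
      then show ?thesis using grow[of "otape c" w] linked_query[OF l Query] OIdle by simp
    next
      case (Answer y p)
      then show ?thesis using l by (cases m) (auto simp: linked_def after_step_def)
    qed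
    with good[of "otape c" cs m pa] OIdle show ?thesis
      unfolding sn using e by (simp add: ocmd_com_def fin[of "otape c"] perform_after_step del: wt_upd)
  next
    case (OMove d)
    show ?thesis
    proof (cases "otape c")
      case (Query w)
      then show ?thesis unfolding sn using linked_query[OF l Query] OMove e
        by (simp add: ocmd_com_def perform_after_step)
    next
      case (Answer y p)
      have p: "p = pa" "m \<noteq> Writing" "pa \<le> Suc (length y)" "Suc (length y) < 2 ^ S"
        using linked_ans_len[OF l Answer] by auto
      let ?t = "Answer y (mv_within y d pa)"
      have mv: "wt x (move_ctr Ans (\<lambda>e. case ocmd (act e) of OMove d \<Rightarrow> d | _ \<Rightarrow> MStay) (\<lambda>e. res e Fun)) ?fin
          (e, 0, word S ?C ?T, ?u) = ?fin (e, 0, word S (?C(Ans := mv_within y d pa)) ?T, ?u)"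
        using wt_move_ctr[of "\<lambda>e. res e Fun" e y ?C Ans S 0 x "\<lambda>e. case ocmd (act e) of OMove d \<Rightarrow> d | _ \<Rightarrow> MStay" ?fin ?T ?u]
          p e Answer OMove by simp
      have "?fin (e, 0, word S (?C(Ans := mv_within y d pa)) ?T, ?u) = \<kappa> (main_store (after_step a c ?t) cs m (mv_within y d pa) S)"
        using e by (simp add: main_store_def after_step_def)
      moreover have "mv_within y d pa \<le> Suc (length y)" by (simp add: mv_within_def)
      then have "linked (after_step a c ?t) cs m (mv_within y d pa)"
        using l Answer p by (cases m) (auto simp: linked_def after_step_def)
      ultimately show ?thesis
        using good[of ?t cs m "mv_within y d pa"] mv OMove Answer p e unfolding sn
        by (simp add: ocmd_com_def perform_after_step del: wt_upd)
    qed
  next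
    case OOpen
    show ?thesis
    proof (cases "otape c")
      case (Query w)
      then show ?thesis unfolding sn using linked_query[OF l Query] OOpen e
        by (simp add: ocmd_com_def perform_after_step)
    next
      case (Answer y p)
      have p: "m \<noteq> Writing" using linked_ans_len[OF l Answer] by auto
      let ?t = "Query []" and ?c = "after_step a c (Query [])"
      have rc: "reachable f M x ?c"
        using reachable_step[OF c a] OOpen Answer by (simp add: perform_after_step)
      \<comment> \<open>The configuration that opens a query is its own saved configuration, with
        the empty run in between.\<close>
      then have "linked ?c ?c Writing 0"
        by (auto simp: linked_def after_step_def intro: exI[of _ "[]"])
      moreover have "wt x (ocmd_com M F) ?fin (e, 0, word S ?C ?T, ?u) = \<kappa> (main_store ?c ?c Writing 0 S)"
        using OOpen p e by (simp add: ocmd_com_def main_store_def after_step_def fun_upd_twist)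
      ultimately show ?thesis unfolding sn
        using good[of ?t ?c Writing 0] OOpen Answer by (simp add: perform_after_step)
    qed
  next
    case (OWrite b)
    show ?thesis
    proof (cases "otape c")
      case (Query w)
      have m: "m = Writing" "pa = 0" using linked_query[OF l Query] by auto
      have "linked (after_step a c (Query (w @ [b]))) cs m pa"
        using grow[of "Query (w @ [b])" "w @ [b]"] m OWrite Query by simp
      moreover have "wt x (ocmd_com M F) ?fin (e, 0, word S ?C ?T, ?u) =
          \<kappa> (main_store (after_step a c (Query (w @ [b]))) cs m pa S)"
        using OWrite m e by (simp add: ocmd_com_def main_store_def after_step_def)
      ultimately show ?thesis
        unfolding sn using good[of "Query (w @ [b])" cs m pa] OWrite Query by (simp add: perform_after_step)
    next
      case (Answer y p)
      then show ?thesis unfolding sn using linked_ans_len[OF l Answer] OWrite e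
        by (simp add: ocmd_com_def perform_after_step)
    qed
  next
    case OAsk
    show ?thesis
    proof (cases "otape c")
      case (Query w)
      have m: "m = Writing" "pa = 0" using linked_query[OF l Query] by auto
      have qr: "query_run cs w" using linked_query_run l m Query a OAsk by blast
      let ?q = "(\<lambda>_. 0)(Cur := new_state a, Sav := cstate cs)" and ?r = "\<lambda>_. LeftEnd :: 'a cell"
      have 1: "wt x (ocmd_com M F) ?fin (e, 0, word S ?C ?T, ?u) =
          wt x (run_fun M F) ?fin (tidy ?q ?r Answered, 0, word S ?C ?T, ?u)"
        using OAsk m e by (simp add: ocmd_com_def fun_upd_idem)
      have 2: "[wt x (run_fun M F) ?fin (tidy ?q ?r Answered, 0, word S ?C ?T, ?u) = (case f w of None \<Rightarrow> 0
         | Some y \<Rightarrow> ?fin (tidy ?q (?r(Fun := read_cell y (?C Ans))) Answered, 0, word S ?C ?T, ?u))] (mod k)"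
        by (rule run_fun_mod[OF qr]) (use m in \<open>simp_all add: saved_def\<close>)
      have 3: "[(case f w of None \<Rightarrow> 0
         | Some y \<Rightarrow> ?fin (tidy ?q (?r(Fun := read_cell y (?C Ans))) Answered, 0, word S ?C ?T, ?u)) =
         (case perform f x a c of None \<Rightarrow> 0 | Some c' \<Rightarrow> \<kappa>' c')] (mod k)"
      proof (cases "f w")
        case None
        then show ?thesis using OAsk Query by (simp add: perform_after_step)
      next
        case (Some y)
        have "linked (after_step a c (Answer y 0)) cs Answered 0"
          using qr Some by (auto simp: linked_def after_step_def)
        moreover have "?fin (tidy ?q (?r(Fun := read_cell y (?C Ans))) Answered, 0, word S ?C ?T, ?u) =
            \<kappa> (main_store (after_step a c (Answer y 0)) cs Answered 0 S)"
          using m by (simp add: main_store_def after_step_def fun_upd_idem)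
        ultimately show ?thesis using good[of "Answer y 0" cs Answered 0] OAsk Query Some
          by (simp add: perform_after_step)
      qed
      show ?thesis unfolding sn 1 by (rule cong_trans[OF 2 3])
    next
      case (Answer y p)
      then show ?thesis unfolding sn using linked_ans_len[OF l Answer] OAsk e
        by (simp add: ocmd_com_def perform_after_step)
    qed
  qed
qed

text \<open>The weights \<open>\<kappa>\<close> have to agree with \<open>\<kappa>'\<close> only on
  stores that represent reachable configurations: all other stores are entered with multiplicity 0
  modulo \<open>k\<close>.\<close>

lemma wt_main_body:
  assumes s: "represents s c" and c: "reachable f M x c" and na: "cstate c \<notin> accept M"
    and \<kappa>: "\<And>s' c'. reachable f M x c' \<Longrightarrow> represents s' c' \<Longrightarrow> [\<kappa> s' = \<kappa>' c'] (mod k)"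
  shows "[wt x (main_body M F) \<kappa> s =
    (\<Sum>a\<in>choices M x c. case perform f x a c of None \<Rightarrow> 0 | Some c' \<Rightarrow> \<kappa>' c')] (mod k)"
proof -
  obtain cs m pa where ms: "s = main_store c cs m pa S" and l: "linked c cs m pa"
    using s by (auto simp: represents_def)
  have wf: "wf_config M x c" using reachable_wf_config[OF wfM c] .
  let ?C = "(\<lambda>_. 0)(Pos Cur := in_pos c, Pos Sav := in_pos cs, Ans := pa)"
  let ?T = "(\<lambda>_. [])(Cur := work c, Sav := work cs)"
  let ?e = "oracle_regs c cs m"
  define R1 where "R1 = wt x (ocmd_com M F) (wt x (upd (\<lambda>e. tidy (st e) ((res e)(Fun := LeftEnd)) (mode e))) \<kappa>)"
  define R2 where "R2 = wt x (step_com M Cur True (\<lambda>e. res e Fun)) R1"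
  have "wt x (main_body M F) \<kappa> s = wt x (oracle_cell M F) (wt x (read_input Cur) R2) s"
    using na by (simp add: main_body_def ms main_store_def R1_def R2_def)
  also have "[\<dots> = wt x (read_input Cur) R2 (?e, 0, word S ?C ?T, out c)] (mod k)"
    using wt_oracle_cell[OF l, of "wt x (read_input Cur) R2"] by (simp add: ms main_store_def)
  also have "wt x (read_input Cur) R2 (?e, 0, word S ?C ?T, out c) =
      R2 (?e\<lparr>cel := read_cell x (in_pos c)\<rparr>, 0, word S ?C ?T, out c)"
    using wt_read_input[of ?C Cur x S ?e R2 ?T "out c"] len wf by (simp add: wf_config_def oracle_regs_def)
  also have "\<dots> = (\<Sum>a\<in>choices M x c. R1 (?e\<lparr>cel := read_cell x (in_pos c), gs := map (\<lambda>(t, p). t p) (work c),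
      act := a, st := (st ?e)(Cur := new_state a)\<rparr>, 0,
       word S (?C(Pos Cur := mv_within x (in_move a) (in_pos c)))
         (?T(Cur := map2 (\<lambda>(y, d) (t, p). (t(p := y), mv d p)) (work_acts a) (work c))), out c @ emitted a))"
    unfolding R2_def
    by (subst wt_step_com[OF wfM wf spaceM[OF c]]) (use len in \<open>simp_all add: oracle_regs_def\<close>)
  also have "[\<dots> = (\<Sum>a\<in>choices M x c. case perform f x a c of None \<Rightarrow> 0 | Some c' \<Rightarrow> \<kappa>' c')] (mod k)"
  proof (rule cong_sum)
    fix a assume a: "a \<in> choices M x c"
    let ?e' = "?e\<lparr>cel := read_cell x (in_pos c), gs := map (\<lambda>(t, p). t p) (work c),
      act := a, st := (st ?e)(Cur := new_state a)\<rparr>"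
    have "(0, word S (?C(Pos Cur := mv_within x (in_move a) (in_pos c)))
         (?T(Cur := map2 (\<lambda>(y, d) (t, p). (t(p := y), mv d p)) (work_acts a) (work c))), out c @ emitted a) =
       snd (main_store (after_step a c (otape c)) cs m pa S)"
      by (simp add: main_store_def after_step_def fun_upd_twist)
    then show "[R1 (?e', 0,
       word S (?C(Pos Cur := mv_within x (in_move a) (in_pos c)))
         (?T(Cur := map2 (\<lambda>(y, d) (t, p). (t(p := y), mv d p)) (work_acts a) (work c))), out c @ emitted a) =
       (case perform f x a c of None \<Rightarrow> 0 | Some c' \<Rightarrow> \<kappa>' c')] (mod k)"
      using wt_ocmd_com[OF l c a \<kappa>, where e = "?e'" and t = "otape c"] unfolding R1_def
      by (simp add: oracle_regs_def fun_upd_twist del: wt_upd)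
  qed
  finally show ?thesis .
qed

lemma wt_main_loop:
  assumes \<kappa>: "\<And>s' c'. reachable f M x c' \<Longrightarrow> represents s' c' \<Longrightarrow> \<kappa> s' = \<kappa>' c'"
  shows "represents s c \<Longrightarrow> reachable f M x c \<Longrightarrow>
    [(wt x (main_body M F) ^^ n) \<kappa> s = paths f M x n \<kappa>' c] (mod k)"
proof (induction n arbitrary: s c)
  case 0
  then show ?case using \<kappa> by simp
next
  case (Suc n)
  show ?case
  proof (cases "cstate c \<in> accept M")
    case True
    have "wt x (main_body M F) \<kappa>0 s = \<kappa>0 s" for \<kappa>0
      using True Suc.prems(1) by (auto simp: main_body_def represents_def main_store_def)
    then have "(wt x (main_body M F) ^^ Suc n) \<kappa> s = \<kappa> s" by (induction n) simp_all
    then show ?thesis using True \<kappa> Suc.prems by simp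
  next
    case False
    have "[(wt x (main_body M F) ^^ Suc n) \<kappa> s = (\<Sum>a\<in>choices M x c. case perform f x a c of None \<Rightarrow> 0
        | Some c' \<Rightarrow> paths f M x n \<kappa>' c')] (mod k)"
      using wt_main_body[OF Suc.prems False, of "(wt x (main_body M F) ^^ n) \<kappa>" "paths f M x n \<kappa>'"] Suc.IH
      by simp
    then show ?thesis using False by simp
  qed
qed

theorem wt_simulation:
  "[wt x (simulation M F) (\<lambda>(e, i, w, u). if u \<in> Y then 1 else 0)
      (tidy (\<lambda>_. 0) (\<lambda>_. LeftEnd) NoQuery, Suc (length x), word S (\<lambda>_. 0) (\<lambda>_. []), []) =
    card (accepting_into f M x Y (init_config M))] (mod k)"
proof -
  let ?\<kappa> = "\<lambda>(e, i, w, u). if u \<in> Y then 1 else 0 :: nat"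
  let ?i = "init_config M"
  \<comment> \<open>No query has been saved yet; this dummy matches the zeros of the initial
    store.\<close>
  define cs :: "(nat, nat, 'a) config" where
    "cs = \<lparr>cstate = 0, in_pos = 0, work = [], out = [], otape = Answer [] 0\<rparr>"
  let ?s = "main_store ?i cs NoQuery 0 S"
  let ?R = "wt x (Cond (\<lambda>e. st e Cur \<in> accept M) skip abort) ?\<kappa>"
  have ms: "?s = (tidy ((\<lambda>_. 0)(Cur := start M)) (\<lambda>_. LeftEnd) NoQuery, 0,
     word S (\<lambda>_. 0) ((\<lambda>_. [])(Cur := replicate (tapes M) (\<lambda>_. blank M, 0))), [])"
    by (simp add: main_store_def init_config_def cs_def fun_upd_idem)
  have "wt x (simulation M F) ?\<kappa> (tidy (\<lambda>_. 0) (\<lambda>_. LeftEnd) NoQuery, Suc (length x), word S (\<lambda>_. 0) (\<lambda>_. []), []) =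
     (wt x (main_body M F) ^^ 2 ^ S) ?R ?s"
    unfolding ms using len by (simp add: simulation_def wt_rewind)
  also have "[\<dots> = paths f M x (2 ^ S) (\<lambda>c. if cstate c \<in> accept M \<and> out c \<in> Y then 1 else 0) ?i] (mod k)"
  proof (rule wt_main_loop)
    show "?R s' = (if cstate c' \<in> accept M \<and> out c' \<in> Y then 1 else 0)" if "represents s' c'" for s' c'
      using that by (auto simp: represents_def main_store_def)
    show "represents ?s ?i"
      unfolding represents_def by (intro exI conjI, rule refl) (simp add: linked_def init_config_def)
    show "reachable f M x ?i" by (auto simp: reachable_def intro: exI[of _ "[]"])
  qed
  also have "paths f M x (2 ^ S) (\<lambda>c. if cstate c \<in> accept M \<and> out c \<in> Y then 1 else 0) ?i =
      card (accepting_into f M x Y ?i)"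
    using paths_card[OF wfM wf_config_init[OF wfM], of f x "2 ^ S" Y] timeM less_imp_le by blast
  finally show ?thesis .
qed

end

section \<open>Finiteness of the control and of the alphabet\<close>

lemma UNIV_slot: "UNIV = {Cur, Sav, Scr, Fun}"
  using slot.exhaust by auto
instance slot :: finite by standard (simp add: UNIV_slot)

lemma UNIV_ctr: "UNIV = insert Ans (insert Tmp (range Pos \<union> range Cnt))"
proof (rule set_eqI)
  fix z :: ctr show "z \<in> UNIV \<longleftrightarrow> z \<in> insert Ans (insert Tmp (range Pos \<union> range Cnt))"
    by (cases z) auto
qed
instance ctr :: finite by standard (simp add: UNIV_ctr)

lemma UNIV_mode: "UNIV = {NoQuery, Writing, Answered}"
  using mode.exhaust by auto
instance mode :: finite by standard (simp add: UNIV_mode)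

text \<open>The added 0 is the state of a cleared slot.\<close>

definition all_states :: "('q, 'g, 'a) ntm \<Rightarrow> ('q, 'g, 'a) ntm \<Rightarrow> 'q::zero set" where
  "all_states M F = insert 0 (states M \<union> states F)"

definition all_symbols :: "('q, 'g, 'a) ntm \<Rightarrow> ('q, 'g, 'a) ntm \<Rightarrow> 'g::zero set" where
  "all_symbols M F = insert 0 (symbols M \<union> symbols F)"

definition all_actions :: "(nat, nat, 'a) ntm \<Rightarrow> (nat, nat, 'a) ntm \<Rightarrow> (nat, nat, 'a) action set" where
  "all_actions M F = insert idle_act (actions M \<union> actions F)"

lemma all_memb [simp]: "0 \<in> all_states M F" "0 \<in> all_symbols M F" "idle_act \<in> all_actions M F"
  by (simp_all add: all_states_def all_symbols_def all_actions_def)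

context
  fixes M F :: "(nat, nat, 'a::finite) ntm"
  assumes wfM: "wf_ntm M" and wfF: "wf_ntm F"
begin

abbreviation "sim_tapes \<equiv> max (tapes M) (tapes F)"

text \<open>Only these three fields need bounds; all others range over finite types.\<close>

definition sim_regs :: "'a regs set" where
  "sim_regs = {e. range (st e) \<subseteq> all_states M F \<and> set (gs e) \<subseteq> all_symbols M F \<and> length (gs e) \<le> sim_tapes \<and>
     act e \<in> all_actions M F}"

definition sim_letters :: "letter set" where
  "sim_letters = {l. \<forall>s j. fst (snd l (s, j)) \<in> all_symbols M F \<and> (j \<ge> sim_tapes \<longrightarrow> snd l (s, j) = (0, False))}"

lemma sim_letters_iff: "l \<in> sim_letters \<longleftrightarrow>
    (\<forall>s j. fst (snd l (s, j)) \<in> all_symbols M F \<and> (j \<ge> sim_tapes \<longrightarrow> snd l (s, j) = (0, False)))"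
  by (simp add: sim_letters_def)

abbreviation sim_closed :: "'a prog \<Rightarrow> bool" where
  "sim_closed \<equiv> closed_com sim_regs sim_letters"

lemma fin_sim: "finite (all_states M F)" "finite (all_symbols M F)" "finite (all_actions M F)"
  using wfM wfF finite_actions by (auto simp: wf_ntm_def all_states_def all_symbols_def all_actions_def)

lemma finite_sim_regs: "finite sim_regs"
proof -
  let ?Q = "{q :: slot \<Rightarrow> nat. range q \<subseteq> all_states M F}"
  let ?G = "{g. set g \<subseteq> all_symbols M F \<and> length g \<le> sim_tapes}"
  have "?Q = {q. \<forall>s. (s \<in> UNIV \<longrightarrow> q s \<in> all_states M F) \<and> (s \<notin> UNIV \<longrightarrow> q s = 0)}" by auto
  moreover have "finite \<dots>" by (rule finite_set_of_finite_funs) (use fin_sim in auto)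
  ultimately have Q: "finite ?Q" by (simp only:)
  have G: "finite ?G" using fin_sim by (intro finite_lists_length_le)
  let ?mk = "\<lambda>(q, r, c, g, a, m, f1, f2, f3, f4). \<lparr>st = q, res = r, cel = c, gs = g, act = a, mode = m,
     fl = f1, car = f2, ini = f3, asked = f4\<rparr> :: 'a regs"
  have "finite (?mk ` (?Q \<times> UNIV \<times> UNIV \<times> ?G \<times> all_actions M F \<times> UNIV))"
    using Q G fin_sim(3) by (intro finite_imageI finite_cartesian_product) auto
  moreover have "sim_regs \<subseteq> ?mk ` (?Q \<times> UNIV \<times> UNIV \<times> ?G \<times> all_actions M F \<times> UNIV)"
  proof
    fix e assume e: "e \<in> sim_regs"
    show "e \<in> ?mk ` (?Q \<times> UNIV \<times> UNIV \<times> ?G \<times> all_actions M F \<times> UNIV)"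
      by (rule image_eqI[where x = "(st e, res e, cel e, gs e, act e, mode e, fl e, car e, ini e, asked e)"])
        (use e in \<open>auto simp: sim_regs_def\<close>)
  qed
  ultimately show ?thesis by (rule rev_finite_subset)
qed

lemma finite_sim_letters: "finite sim_letters"
proof -
  let ?A = "UNIV \<times> {..<sim_tapes} :: (slot \<times> nat) set" and ?B = "all_symbols M F \<times> (UNIV :: bool set)"
  have "finite {t. \<forall>p. (p \<in> ?A \<longrightarrow> t p \<in> ?B) \<and> (p \<notin> ?A \<longrightarrow> t p = (0, False))}"
    by (rule finite_set_of_finite_funs) (use fin_sim in auto)
  then have "finite ((UNIV :: (ctr \<Rightarrow> bool) set) \<times> {t. \<forall>p. (p \<in> ?A \<longrightarrow> t p \<in> ?B) \<and> (p \<notin> ?A \<longrightarrow> t p = (0, False))})"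
    by simp
  moreover have "sim_letters \<subseteq> UNIV \<times> {t. \<forall>p. (p \<in> ?A \<longrightarrow> t p \<in> ?B) \<and> (p \<notin> ?A \<longrightarrow> t p = (0, False))}"
    by (auto simp: sim_letters_iff mem_Times_iff not_less)
  ultimately show ?thesis by (rule rev_finite_subset)
qed

section \<open>Closure of the simulation programs\<close>

lemma closed_upd: "(\<And>e. e \<in> sim_regs \<Longrightarrow> g e \<in> sim_regs) \<Longrightarrow> sim_closed (upd g)"
  by (simp add: upd_def)

lemma closed_fwd: "(\<And>e l. e \<in> sim_regs \<Longrightarrow> l \<in> sim_letters \<Longrightarrow> g e l \<in> sim_regs \<times> sim_letters) \<Longrightarrow>
    sim_closed (fwd g)"
  by (simp add: fwd_def)

lemma regs_upd [simp]:
  "e\<lparr>car := b\<rparr> \<in> sim_regs \<longleftrightarrow> e \<in> sim_regs" "e\<lparr>fl := b\<rparr> \<in> sim_regs \<longleftrightarrow> e \<in> sim_regs"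
  "e\<lparr>ini := b\<rparr> \<in> sim_regs \<longleftrightarrow> e \<in> sim_regs" "e\<lparr>asked := b\<rparr> \<in> sim_regs \<longleftrightarrow> e \<in> sim_regs"
  "e\<lparr>res := r\<rparr> \<in> sim_regs \<longleftrightarrow> e \<in> sim_regs" "e\<lparr>cel := c\<rparr> \<in> sim_regs \<longleftrightarrow> e \<in> sim_regs"
  "e\<lparr>mode := m\<rparr> \<in> sim_regs \<longleftrightarrow> e \<in> sim_regs"
  by (simp_all add: sim_regs_def)

lemma regs_st: "e \<in> sim_regs \<Longrightarrow> q \<in> all_states M F \<Longrightarrow> e\<lparr>st := (st e)(s := q)\<rparr> \<in> sim_regs"
  by (auto simp: sim_regs_def)

lemma st_in: "e \<in> sim_regs \<Longrightarrow> st e s \<in> all_states M F"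
  by (auto simp: sim_regs_def)

lemma start_in: "start M \<in> all_states M F" "start F \<in> all_states M F"
  using wfM wfF by (auto simp: wf_ntm_def all_states_def)

lemma regs_tidy: "range q \<subseteq> all_states M F \<Longrightarrow> tidy q r m \<in> sim_regs"
  by (auto simp: sim_regs_def)

lemma regs_tidy': "e \<in> sim_regs \<Longrightarrow> tidy (st e) r m \<in> sim_regs"
  by (auto simp: sim_regs_def)

lemma closed_skip [simp]: "sim_closed skip" and closed_abort [simp]: "sim_closed abort"
  by (simp_all add: skip_def closed_upd abort_def)

lemma closed_ctr [simp]:
  "sim_closed (inc k)" "sim_closed (dec k)" "sim_closed (zero_test k)"
  "sim_closed (copy_ctr k k')" "sim_closed (clear_ctr k)"
  unfolding inc_def dec_def zero_test_def copy_ctr_def clear_ctr_def mapl_def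
  by (auto intro!: closed_upd closed_fwd simp: sim_letters_iff)

lemma closed_slot [simp]: "sim_closed (copy_slot s s')" "sim_closed (clear_slot s)"
  unfolding copy_slot_def clear_slot_def mapl_def
  by (auto intro!: closed_fwd simp: sim_letters_iff)

lemma closed_init_slot [simp]:
  "m \<le> sim_tapes \<Longrightarrow> bl \<in> all_symbols M F \<Longrightarrow> sim_closed (init_slot s m bl)"
  unfolding init_slot_def by (auto intro!: closed_upd closed_fwd simp: sim_letters_iff)

lemma closed_read_head: "sim_closed (read_head s j)"
  unfolding read_head_def
proof (rule closed_fwd)
  fix e l assume e: "e \<in> sim_regs" and l: "l \<in> sim_letters"
  have "set ((gs e)[j := fst (snd l (s, j))]) \<subseteq> insert (fst (snd l (s, j))) (set (gs e))"
    by (rule set_update_subset_insert)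
  moreover have "fst (snd l (s, j)) \<in> all_symbols M F" using l by (auto simp: sim_letters_iff)
  ultimately have "e\<lparr>gs := (gs e)[j := fst (snd l (s, j))]\<rparr> \<in> sim_regs"
    using e by (auto simp: sim_regs_def)
  then show "(if snd (snd l (s, j)) then e\<lparr>gs := (gs e)[j := fst (snd l (s, j))]\<rparr> else e, l) \<in> sim_regs \<times> sim_letters"
    using e l by simp
qed

lemma work_act_in: "e \<in> sim_regs \<Longrightarrow> fst (work_act j e) \<in> all_symbols M F"
proof -
  assume "e \<in> sim_regs"
  then have "act e \<in> all_actions M F" by (simp add: sim_regs_def)
  then show ?thesis
    using nth_mem[of j "work_acts (act e)"] by (force simp: work_act_def actions_def idle_act_def all_actions_def all_symbols_def)
qed

lemma closed_write_head: "j < sim_tapes \<Longrightarrow> sim_closed (write_head s j)"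
  unfolding write_head_def closed_com.simps
  using work_act_in[of _ j]
  by (auto intro!: closed_upd simp: sim_letters_iff Let_def case_prod_unfold)

lemma closed_seqs: "(\<And>c. c \<in> set cs \<Longrightarrow> sim_closed c) \<Longrightarrow> sim_closed (seqs cs)"
  by (induction cs) (auto simp: seqs_def)

lemma closed_move_ctr [simp]: "sim_closed (move_ctr k d z)"
  by (simp add: move_ctr_def)

lemma closed_rewind [simp]: "sim_closed rewind"
  by (simp add: rewind_def)

lemma closed_read_input [simp]: "sim_closed (read_input s)"
  by (simp add: read_input_def)

lemma closed_step_com:
  assumes "X = M \<or> X = F"
  shows "sim_closed (step_com X s em z)"
proof -
  have X: "tapes X \<le> sim_tapes" "actions X \<subseteq> all_actions M F" using assms by (auto simp: all_actions_def)
  have "sim_closed (upd (\<lambda>e. e\<lparr>gs := replicate (tapes X) 0\<rparr>))"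
    using X by (intro closed_upd) (auto simp: sim_regs_def)
  moreover have "sim_closed (seqs (map (read_head s) [0..<tapes X]))"
    by (rule closed_seqs) (auto simp: closed_read_head)
  moreover have "sim_closed (seqs (map (write_head s) [0..<tapes X]))"
    using X by (intro closed_seqs) (auto intro!: closed_write_head)
  moreover have "sim_closed (choose_act X s em z)"
  proof -
    have "finite (actions X)" using X(2) fin_sim(3) by (rule finite_subset)
    moreover have "e\<lparr>act := a, st := (st e)(s := new_state a)\<rparr> \<in> sim_regs" if "e \<in> sim_regs" "a \<in> actions X" for e a
    proof -
      have "new_state a \<in> all_states M F" using that(2) assms by (auto simp: actions_def all_states_def)
      moreover have "a \<in> all_actions M F" using that(2) X by blast
      ultimately show ?thesis using that(1) by (auto simp: sim_regs_def)
    qed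
    ultimately show ?thesis by (auto simp: choose_act_def)
  qed
  ultimately show ?thesis by (simp add: step_com_def)
qed

lemma closed_capture [simp]: "sim_closed (capture s sel)"
  by (auto simp: capture_def intro!: closed_upd)

lemma closed_read_query: "sim_closed (read_query M)"
proof -
  have "sim_closed (query_body M)"
    by (auto simp: query_body_def intro!: closed_step_com closed_upd regs_tidy')
  moreover have "e\<lparr>st := (st e)(Scr := st e Sav), res := r, fl := b\<rparr> \<in> sim_regs" if "e \<in> sim_regs" for e r b
    using regs_st[OF that st_in[OF that]] by simp
  moreover have "tidy ((st e)(Scr := 0)) r m \<in> sim_regs" if "e \<in> sim_regs" for e r m
    using that by (intro regs_tidy) (auto simp: sim_regs_def)
  ultimately show ?thesis by (auto simp: read_query_def intro!: closed_upd)
qed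

lemma closed_run_fun: "sim_closed (run_fun M F)"
proof -
  have "sim_closed (fun_body M F)"
    by (auto simp: fun_body_def intro!: closed_step_com closed_read_query closed_upd regs_tidy')
  moreover have "blank F \<in> all_symbols M F" using wfF by (auto simp: wf_ntm_def all_symbols_def)
  moreover have "e\<lparr>st := (st e)(Fun := start F), res := r, fl := b\<rparr> \<in> sim_regs" if "e \<in> sim_regs" for e r b
    using regs_st[OF that start_in(2)] by simp
  moreover have "e\<lparr>st := (st e)(Fun := 0)\<rparr> \<in> sim_regs" if "e \<in> sim_regs" for e
    using regs_st[OF that] by simp
  ultimately show ?thesis by (auto simp: run_fun_def intro!: closed_upd)
qed

lemma closed_simulation: "sim_closed (simulation M F)"
proof -
  have u: "sim_closed (upd (\<lambda>e. e\<lparr>st := (st e)(Sav := st e Cur), mode := Writing\<rparr>))"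
    by (rule closed_upd) (simp add: regs_st[OF _ st_in])
  have t: "sim_closed (upd (\<lambda>e. tidy (st e) ((res e)(Fun := LeftEnd)) Answered))"
    "sim_closed (upd (\<lambda>e. tidy (st e) ((res e)(Fun := LeftEnd)) (mode e)))"
    by (rule closed_upd, erule regs_tidy')+
  have "sim_closed (ocmd_com M F)"
    by (simp add: ocmd_com_def closed_run_fun u t)
  then have "sim_closed (main_body M F)"
    by (auto simp: main_body_def oracle_cell_def closed_run_fun t intro!: closed_step_com closed_upd)
  moreover have "blank M \<in> all_symbols M F" using wfM by (auto simp: wf_ntm_def all_symbols_def)
  moreover have "e\<lparr>st := (st e)(Cur := start M)\<rparr> \<in> sim_regs" if "e \<in> sim_regs" for e
    using regs_st[OF that start_in(1)] by simp
  ultimately show ?thesis by (auto simp: simulation_def intro!: closed_upd)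
qed

end

section \<open>Resource bounds\<close>

text \<open>Powers of \<open>n + 2\<close> compose by multiplying exponents, and a base of at least
  2 absorbs constant factors: \<open>c\<close> is at most \<open>2 ^ c\<close>.\<close>

lemma poly_le_power: "\<exists>e. \<forall>n. c * n ^ d + c \<le> (n + 2) ^ e" for c d :: nat
proof (intro exI allI)
  fix n :: nat
  have "c \<le> 2 ^ c" using less_exp[of c] by simp
  also have "\<dots> \<le> (n + 2) ^ c" by (rule power_mono) auto
  finally have 1: "c \<le> (n + 2) ^ c" .
  have "n ^ d \<le> (n + 2) ^ d" "1 \<le> (n + 2) ^ d" by (auto intro: power_mono)
  then have "n ^ d + 1 \<le> 2 * (n + 2) ^ d" by linarith
  also have "\<dots> \<le> (n + 2) * (n + 2) ^ d" by (rule mult_right_mono) auto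
  finally have "c * (n ^ d + 1) \<le> (n + 2) ^ c * ((n + 2) * (n + 2) ^ d)" using 1 by (intro mult_mono) auto
  then show "c * n ^ d + c \<le> (n + 2) ^ (c + (1 + d))" by (simp add: power_add algebra_simps)
qed

lemma poly_time_power:
  assumes "halts_in_poly_time f M"
  obtains e where "\<And>x as. run f M x (init_config M) as \<noteq> None \<Longrightarrow> length as \<le> (length x + 2) ^ e"
proof -
  obtain c d where "\<And>x as. run f M x (init_config M) as \<noteq> None \<Longrightarrow> length as \<le> c * length x ^ d + c"
    using assms unfolding halts_in_poly_time_def by blast
  moreover obtain e where "\<And>n. c * n ^ d + c \<le> (n + 2) ^ e" using poly_le_power by blast
  ultimately show thesis using that[of e] le_trans by blast
qed

text \<open>Replaces the real logarithm by any \<open>L\<close> with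
  \<open>length x + 2 \<le> 2 ^ L\<close>, so the bound also applies to queries, whose length is
  polynomial in that of the input.\<close>

lemma log_space_bound:
  assumes "runs_in_log_space f M"
  obtains B :: nat where "\<And>x c t p L. reachable f M x c \<Longrightarrow> (t, p) \<in> set (work c) \<Longrightarrow>
    length x + 2 \<le> 2 ^ L \<Longrightarrow> p \<le> B * L"
proof -
  obtain r where r: "\<And>x c t p. reachable f M x c \<Longrightarrow> (t, p) \<in> set (work c) \<Longrightarrow>
      real p \<le> r * log 2 (real (length x) + 2)"
    using assms unfolding runs_in_log_space_def by blast
  define B where "B = nat \<lceil>\<bar>r\<bar>\<rceil>"
  have B: "r \<le> real B" unfolding B_def by linarith
  show thesis
  proof (rule that[of B])
    fix x c t p L assume *: "reachable f M x c" "(t, p) \<in> set (work c)" "length x + 2 \<le> 2 ^ L"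
    have "real (length x + 2) \<le> real (2 ^ L)" using *(3) by (simp only: of_nat_le_iff)
    then have "log 2 (real (length x) + 2) \<le> log 2 (2 ^ L)" by (subst log_le_cancel_iff) auto
    then have l: "log 2 (real (length x) + 2) \<le> real L" by simp
    have "0 \<le> log 2 (real (length x) + 2)" by simp
    then have "real p \<le> real B * log 2 (real (length x) + 2)"
      using r[OF *(1,2)] mult_right_mono[OF B] by (meson order_trans)
    also have "\<dots> \<le> real B * real L" using l by (rule mult_left_mono) simp
    finally show "p \<le> B * L" by (metis of_nat_le_iff of_nat_mult)
  qed
qed

lemma length_out: "run f M x c as = Some c' \<Longrightarrow> length (out c') \<le> length (out c) + length as"
proof (induction as arbitrary: c)
  case (Cons a as)
  then obtain c1 where "perform f x a c = Some c1" "run f M x c1 as = Some c'"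
    by (auto simp: Option.bind_eq_Some_conv split: if_splits)
  moreover from this(1) have "length (out c1) \<le> Suc (length (out c))"
    by (auto simp: perform_def split: option.splits)
  ultimately show ?case using Cons.IH by fastforce
qed auto

fun query_length :: "'a otape \<Rightarrow> nat" where
  "query_length (Query w) = length w"
| "query_length (Answer y p) = 0"

lemma oracle_step_length: "oracle_step f z t = Some t' \<Longrightarrow> query_length t' \<le> Suc (query_length t)"
  by (induction f z t rule: oracle_step.induct) auto

lemma length_query: "run f M x c as = Some c' \<Longrightarrow> query_length (otape c') \<le> query_length (otape c) + length as"
proof (induction as arbitrary: c)
  case (Cons a as)
  then obtain c1 where "perform f x a c = Some c1" "run f M x c1 as = Some c'"
    by (auto simp: Option.bind_eq_Some_conv split: if_splits)
  moreover from this(1) have "query_length (otape c1) \<le> Suc (query_length (otape c))"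
    using oracle_step_length by (auto simp: perform_def)
  ultimately show ?case using Cons.IH by fastforce
qed auto

lemma reachable_query_length:
  assumes "\<And>as. run f M x (init_config M) as \<noteq> None \<Longrightarrow> length as \<le> N"
    and "reachable f M x c" "otape c = Query w"
  shows "length w \<le> N"
proof -
  obtain as where as: "run f M x (init_config M) as = Some c" using assms(2) by (auto simp: reachable_def)
  then have "length as \<le> N" using assms(1) by simp
  moreover have "length w \<le> length as" using length_query[OF as] assms(3) by (simp add: init_config_def)
  ultimately show ?thesis by simp
qed

text \<open>A single \<open>M'\<close> preserves, modulo \<open>k\<close>, the counts for every set
  \<open>Y\<close> of outputs; this covers the classes defined by acceptance and \<open>FUL\<close>
  alike.\<close>

theorem oracle_elimination:
  fixes M :: "(nat, nat, 'a::finite) ntm"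
  assumes k: "k \<ge> 2" and f: "f \<in> FUL k None" and M: "logspace_ntm (Some f) M"
  obtains M' :: "(nat, nat, 'a) ntm" where "logspace_ntm None M'"
    "\<And>x Y. [card (accepting_into Map.empty M' x Y (init_config M')) =
       card (accepting_into f M x Y (init_config M))] (mod k)"
proof -
  obtain F :: "(nat, nat, 'a) ntm" where F: "logspace_ntm None F"
    and FUL: "\<And>w y. f w = Some y \<Longrightarrow> [card (accepting_branches_with_output Map.empty F w y) = 1] (mod k)"
      "\<And>w y. f w \<noteq> Some y \<Longrightarrow> [card (accepting_branches_with_output Map.empty F w y) = 0] (mod k)"
    using f by (auto simp: FUL_def)
  have wf: "wf_ntm M" "wf_ntm F" "oracle_free F" and det: "deterministic_queries f M"
    and hM: "halts_in_poly_time f M" and hF: "halts_in_poly_time Map.empty F"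
    and sM: "runs_in_log_space f M" and sF: "runs_in_log_space Map.empty F"
    using M F by (auto simp: logspace_ntm_def)
  obtain eM where eM: "\<And>x as. run f M x (init_config M) as \<noteq> None \<Longrightarrow> length as \<le> (length x + 2) ^ eM"
    by (rule poly_time_power[OF hM]) (rule that)
  obtain eF where eF: "\<And>x as. run Map.empty F x (init_config F) as \<noteq> None \<Longrightarrow> length as \<le> (length x + 2) ^ eF"
    by (rule poly_time_power[OF hF]) (rule that)
  obtain BM where BM: "\<And>x c t p L. reachable f M x c \<Longrightarrow> (t, p) \<in> set (work c) \<Longrightarrow>
      length x + 2 \<le> 2 ^ L \<Longrightarrow> p \<le> BM * L" by (rule log_space_bound[OF sM]) (rule that)
  obtain BF where BF: "\<And>x c t p L. reachable Map.empty F x c \<Longrightarrow> (t, p) \<in> set (work c) \<Longrightarrow>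
      length x + 2 \<le> 2 ^ L \<Longrightarrow> p \<le> BF * L" by (rule log_space_bound[OF sF]) (rule that)
  \<comment> \<open>Time \<open>(n + 2) ^ eM\<close> of \<open>M\<close> bounds query lengths, so
    \<open>F\<close> runs on inputs of length below \<open>(n + 2) ^ (eM + 2)\<close>, for time
    \<open>(n + 2) ^ ((eM + 2) * eF)\<close> and in space \<open>BF * (eM + 2)\<close> times
    \<open>L n\<close>. Each of these exponents and factors, and those of \<open>M\<close>, must fit
    into \<open>b\<close> with 2 to spare.\<close>
  define b where "b = eM + (eM + 2) * (eF + BF) + BM + 4"
  let ?e0 = "tidy (\<lambda>_. 0) (\<lambda>_. LeftEnd) NoQuery :: 'a regs" and ?l0 = "letter (\<lambda>_. 0) (\<lambda>_. []) 0"
  have cl: "closed_com (sim_regs M F) (sim_letters M F) (simulation M F)"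
    by (rule closed_simulation[OF wf(1,2)])
  have e0: "?e0 \<in> sim_regs M F" by (rule regs_tidy[OF wf(1,2)]) auto
  have l0: "?l0 \<in> sim_letters M F" by (simp add: sim_letters_iff[OF wf(1,2)] letter_def)
  have b1: "b \<ge> 1" by (simp add: b_def)
  obtain M' :: "(nat, nat, 'a) ntm" and L where M': "logspace_ntm None M'" "\<And>n. n + 1 < 2 ^ L n"
    "\<And>x Y. card (accepting_into Map.empty M' x Y (init_config M')) =
      wt x (simulation M F) (\<lambda>(e, i, w, u). if u \<in> Y then 1 else 0)
        (?e0, Suc (length x), replicate (b * L (length x)) ?l0, [])"
    by (rule compile[OF cl finite_sim_regs[OF wf(1,2)] finite_sim_letters[OF wf(1,2)] e0 l0 b1]) (rule that, assumption+)
  show thesis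
  proof (rule that[OF M'(1)])
    fix x :: "'a list" and Y
    define n where "n = length x"
    define S where "S = b * L n"
    have L1: "n + 2 \<le> 2 ^ L n" using M'(2)[of n] by simp
    have Lpos: "L n \<ge> 1" using L1 by (cases "L n") auto
    have pow: "(n + 2) ^ j \<le> 2 ^ (j * L n)" for j
    proof -
      have "(n + 2) ^ j \<le> (2 ^ L n) ^ j" using L1 by (rule power_mono) simp
      then show ?thesis by (simp add: power_mult[symmetric] mult.commute)
    qed
    \<comment> \<open>The two spare exponents contribute a factor of at least 4, which absorbs the
      added 2 and makes the bound strict.\<close>
    have powS: "(n + 2) ^ j + 2 < 2 ^ S" if "j + 2 \<le> b" for j
    proof -
      have "1 \<le> (n + 2) ^ j" by (rule one_le_power) simp
      moreover have "4 * (n + 2) ^ j \<le> (n + 2) ^ 2 * (n + 2) ^ j"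
        by (rule mult_right_mono) (auto simp: power2_eq_square)
      ultimately have "(n + 2) ^ j + 2 < (n + 2) ^ 2 * (n + 2) ^ j" by linarith
      also have "\<dots> = (n + 2) ^ (j + 2)" by (simp only: power_add mult.commute)
      also have "\<dots> \<le> (n + 2) ^ b" using that by (intro power_increasing) auto
      also have "\<dots> \<le> 2 ^ S" unfolding S_def by (rule pow)
      finally show ?thesis .
    qed
    have space: "Suc p < S" if "p \<le> j * L n" "j + 2 \<le> b" for p j
    proof -
      have "Suc p < (j + 2) * L n" using that(1) Lpos by (simp add: algebra_simps)
      also have "\<dots> \<le> S" unfolding S_def using that(2) by (rule mult_right_mono) simp
      finally show ?thesis .
    qed
    have bM: "eM + 2 \<le> b" "BM + 2 \<le> b" "(eM + 2) * eF + 2 \<le> b" "BF * (eM + 2) + 2 \<le> b"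
      by (simp_all add: b_def algebra_simps)
    have len: "Suc (length x) < 2 ^ S"
    proof -
      have "n + 2 \<le> (n + 2) ^ 1" by simp
      also have "\<dots> \<le> (n + 2) ^ b" using b1 by (intro power_increasing) auto
      also have "\<dots> \<le> 2 ^ S" unfolding S_def by (rule pow)
      finally show ?thesis by (simp add: n_def)
    qed
    have sp: "\<forall>(t, p)\<in>set (work c). Suc p < S" if "reachable f M x c" for c
      using BM[OF that, of _ _ "L n"] L1 space bM(2) by (auto simp: n_def)
    interpret simulated M F f x S
      by unfold_locales (use wf det sp len in auto)
    have qlen: "length w + 2 \<le> (n + 2) ^ (eM + 2)" if qr: "query_run cs w" for cs w
    proof -
      obtain as c1 where "reachable f M x cs" "run f M x cs as = Some c1" "otape c1 = Query w"
        using qr by (auto simp: query_run_def)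
      then have "reachable f M x c1" "otape c1 = Query w"
        by (auto simp: reachable_def) (metis Option.bind_lunit run_append)
      then have "length w \<le> (n + 2) ^ eM"
        using reachable_query_length[of f M x "(n + 2) ^ eM"] eM by (simp add: n_def)
      moreover have "1 \<le> (n + 2) ^ eM" by (rule one_le_power) simp
      moreover have "4 * (n + 2) ^ eM \<le> (n + 2) ^ 2 * (n + 2) ^ eM"
        by (rule mult_right_mono) (auto simp: power2_eq_square)
      ultimately have "length w + 2 \<le> (n + 2) ^ 2 * (n + 2) ^ eM" by linarith
      then show ?thesis by (simp only: power_add mult.commute)
    qed
    have tF: "length as \<le> (n + 2) ^ ((eM + 2) * eF)"
      if "query_run cs w" "run Map.empty F w (init_config F) as \<noteq> None" for cs w as
    proof -
      have "length as \<le> (length w + 2) ^ eF" using eF that(2) by blast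
      also have "\<dots> \<le> ((n + 2) ^ (eM + 2)) ^ eF" using qlen[OF that(1)] by (rule power_mono) simp
      finally show ?thesis by (simp only: power_mult)
    qed
    interpret simulated_mod M F f x S k
    proof unfold_locales
      show "length as < 2 ^ S" if "run f M x (init_config M) as \<noteq> None" for as
        using eM[OF that] powS[OF bM(1)] by (simp add: n_def)
      show "Suc (length w) < 2 ^ S" if qr: "query_run cs w" for cs w
      proof -
        have "length w + 2 \<le> (n + 2) ^ b"
          using qlen[OF qr] by (rule order_trans) (rule power_increasing[OF bM(1)], simp)
        also have "\<dots> \<le> 2 ^ S" unfolding S_def by (rule pow)
        finally show ?thesis by simp
      qed
      show "\<forall>(t, p)\<in>set (work d). Suc p < S" if "query_run cs w" "reachable Map.empty F w d" for cs w d
      proof -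
        have lw: "length w + 2 \<le> 2 ^ ((eM + 2) * L n)" using qlen[OF that(1)] pow by (rule order_trans)
        have "p \<le> (BF * (eM + 2)) * L n" if "(t, p) \<in> set (work d)" for t p
          using BF[OF \<open>reachable Map.empty F w d\<close> that lw] by (simp only: mult.assoc)
        then show ?thesis using space bM(4) by fast
      qed
      show "length as \<le> 2 ^ S" if "query_run cs w" "run Map.empty F w (init_config F) as \<noteq> None" for cs w as
        using tF[OF that] powS[OF bM(3)] by simp
      show "Suc (length y) < 2 ^ S" if qr: "query_run cs w" and y: "f w = Some y" for cs w y
      proof -
        \<comment> \<open>For \<open>k\<close> at least 2 a count congruent to 1 is not 0, so some
          branch of \<open>F\<close> writes \<open>y\<close>, and its running time bounds the length
          of \<open>y\<close>.\<close>
        have "accepting_branches_with_output Map.empty F w y \<noteq> {}"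
        proof
          assume "accepting_branches_with_output Map.empty F w y = {}"
          then have "[0 = 1] (mod k)" using FUL(1)[OF y] by simp
          then show False using k by (simp add: cong_def)
        qed
        then obtain as d where as: "run Map.empty F w (init_config F) as = Some d" "out d = y"
          by (auto simp: accepting_branches_with_output_def)
        have "length y \<le> length as" using length_out[OF as(1)] as(2) by (simp add: init_config_def)
        also have "\<dots> \<le> (n + 2) ^ ((eM + 2) * eF)" using tF[OF qr] as(1) by simp
        finally show ?thesis using powS[OF bM(3)] by simp
      qed
    qed (use FUL in auto)
    \<comment> \<open>The constant word that the compiled machine starts with encodes zero counters
      and empty slots.\<close>
    have "word S (\<lambda>_. 0) (\<lambda>_. []) = replicate S ?l0"
      by (intro nth_equalityI) (auto simp: word_def letter_def)
    then show "[card (accepting_into Map.empty M' x Y (init_config M')) =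
       card (accepting_into f M x Y (init_config M))] (mod k)"
      using wt_simulation[of Y] unfolding M'(3) S_def n_def by simp
  qed
qed

section \<open>Lowness\<close>

text \<open>\<open>low_for\<close> takes a union over all oracles of the class, so the trivial
  inclusion needs at least one of them; the nowhere defined function serves.\<close>

lemma FUL_nonempty: "Map.empty \<in> (FUL k None :: 'a::finite pfun set)"
proof -
  let ?M = "\<lparr>states = {0}, symbols = {0}, blank = 0, tapes = 0, start = 0, accept = {},
     delta = \<lambda>_ _ _ _. {}\<rparr> :: (nat, nat, 'a) ntm"
  have run: "run f ?M x c as = Some c' \<longleftrightarrow> as = [] \<and> c' = c" for f x c as c'
    by (cases as) (auto simp: choices_def)
  have "run f ?M x c as \<noteq> None \<Longrightarrow> length as \<le> 0" for f x c as
    by (cases as) (auto simp: choices_def)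
  then have "halts_in_poly_time Map.empty ?M" unfolding halts_in_poly_time_def by (metis le_zero_eq zero_le)
  moreover have "runs_in_log_space Map.empty ?M"
    by (auto simp: runs_in_log_space_def reachable_def run init_config_def)
  moreover have "wf_ntm ?M" "oracle_free ?M" by (auto simp: wf_ntm_def oracle_free_def)
  ultimately have "logspace_ntm None ?M"
    using oracle_free_deterministic_queries by (auto simp: logspace_ntm_def)
  moreover have "accepting_branches_with_output g ?M x y = {}" for g x y
    by (auto simp: accepting_branches_with_output_def)
  ultimately show ?thesis unfolding FUL_def by (auto intro!: exI[of _ ?M])
qed

lemma accepting_into_oracle_free:
  "oracle_free M \<Longrightarrow> accepting_into f M x Y c = accepting_into g M x Y c"
  using oracle_free_run[of M f x c _ g] by (simp add: accepting_into_def)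

lemma SharpL_add_oracle: "SharpL None \<subseteq> SharpL (Some f)"
proof
  fix \<phi> :: "'a list \<Rightarrow> nat" assume "\<phi> \<in> SharpL None"
  then obtain M :: "(nat, nat, 'a) ntm" where "logspace_ntm None M"
    "\<forall>x. \<phi> x = card (accepting_branches Map.empty M x)" by (auto simp: SharpL_def)
  moreover from this(1) have "accepting_branches f M x = accepting_branches Map.empty M x" for x
    unfolding accepting_branches_into by (intro accepting_into_oracle_free) (simp add: logspace_ntm_def)
  ultimately show "\<phi> \<in> SharpL (Some f)"
    using logspace_ntm_add_oracle[of M f] by (auto simp: SharpL_def)
qed

lemma FUL_add_oracle: "FUL k None \<subseteq> FUL k (Some f)"
proof
  fix g :: "'a pfun" assume "g \<in> FUL k None"
  then obtain M :: "(nat, nat, 'a) ntm" where M: "logspace_ntm None M"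
    "\<forall>x y. (g x = Some y \<longrightarrow> [card (accepting_branches_with_output Map.empty M x y) = 1] (mod k)) \<and>
       (g x \<noteq> Some y \<longrightarrow> [card (accepting_branches_with_output Map.empty M x y) = 0] (mod k))"
    by (auto simp: FUL_def)
  then have "accepting_branches_with_output f M x y = accepting_branches_with_output Map.empty M x y" for x y
    unfolding accepting_branches_into by (intro accepting_into_oracle_free) (simp add: logspace_ntm_def)
  then show "g \<in> FUL k (Some f)"
    using logspace_ntm_add_oracle[OF M(1), of f] M(2) by (auto simp: FUL_def)
qed

text \<open>The count is reproduced only up to congruence, which suffices because the classes
  \<open>ModL\<close>, \<open>coModL\<close> and \<open>SharpModL\<close> see it modulo
  \<open>k\<close>.\<close>

lemma SharpL_eliminate_oracle:
  fixes f :: "'a::finite pfun"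
  assumes "k \<ge> 2" "f \<in> FUL k None" "\<phi> \<in> SharpL (Some f)"
  obtains \<psi> where "\<psi> \<in> SharpL None" "\<And>x. [\<psi> x = \<phi> x] (mod k)"
proof -
  obtain M :: "(nat, nat, 'a) ntm" where M: "logspace_ntm (Some f) M" "\<And>x. \<phi> x = card (accepting_branches f M x)"
    using assms(3) by (auto simp: SharpL_def)
  obtain M' :: "(nat, nat, 'a) ntm" where "logspace_ntm None M'" "\<And>x Y. [card (accepting_into Map.empty M' x Y (init_config M')) =
       card (accepting_into f M x Y (init_config M))] (mod k)"
    by (rule oracle_elimination[OF assms(1,2) M(1)]) (rule that)
  then show thesis
    using that[of "\<lambda>x. card (accepting_branches Map.empty M' x)"] M(2)
    by (auto simp: SharpL_def accepting_branches_into)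
qed

lemma FUL_eliminate_oracle:
  fixes f :: "'a::finite pfun"
  assumes "k \<ge> 2" "f \<in> FUL k None"
  shows "FUL k (Some f) \<subseteq> FUL k None"
proof
  fix g assume "g \<in> FUL k (Some f)"
  then obtain M :: "(nat, nat, 'a) ntm" where M: "logspace_ntm (Some f) M"
    "\<forall>x y. (g x = Some y \<longrightarrow> [card (accepting_branches_with_output f M x y) = 1] (mod k)) \<and>
       (g x \<noteq> Some y \<longrightarrow> [card (accepting_branches_with_output f M x y) = 0] (mod k))"
    by (auto simp: FUL_def)
  obtain M' :: "(nat, nat, 'a) ntm" where M': "logspace_ntm None M'" "\<And>x Y. [card (accepting_into Map.empty M' x Y (init_config M')) =
       card (accepting_into f M x Y (init_config M))] (mod k)"
    by (rule oracle_elimination[OF assms M(1)]) (rule that)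
  have "[card (accepting_branches_with_output Map.empty M' x y) =
      card (accepting_branches_with_output f M x y)] (mod k)" for x y
    using M'(2)[of x "{y}"] by (simp add: accepting_branches_into)
  then show "g \<in> FUL k None"
    using M'(1) M(2) unfolding FUL_def cong_def by (auto intro!: exI[of _ M'])
qed

lemma low_forI:
  assumes "F \<noteq> {}" "\<And>f. f \<in> F \<Longrightarrow> C (Some f) \<subseteq> C None" "\<And>f. C None \<subseteq> C (Some f)"
  shows "low_for F C"
  using assms unfolding low_for_def by blast

theorem lemma8:
  fixes k :: nat
  assumes "k \<ge> 2"
  shows "low_for (FUL k None :: 'a::finite pfun set) (ModL k) \<and>
         low_for (FUL k None :: 'a pfun set) (coModL k) \<and>
         low_for (FUL k None :: 'a pfun set) (SharpModL k) \<and>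
         low_for (FUL k None :: 'a pfun set) (FUL k)"
proof (intro conjI low_forI)
  show "(FUL k None :: 'a pfun set) \<noteq> {}" "(FUL k None :: 'a pfun set) \<noteq> {}"
    "(FUL k None :: 'a pfun set) \<noteq> {}" "(FUL k None :: 'a pfun set) \<noteq> {}"
    using FUL_nonempty by blast+
  fix f :: "'a pfun"
  show "ModL k None \<subseteq> ModL k (Some f)" "coModL k None \<subseteq> coModL k (Some f)"
    "SharpModL k None \<subseteq> SharpModL k (Some f)"
    using SharpL_add_oracle[of f] unfolding ModL_def coModL_def SharpModL_def by blast+
  show "FUL k None \<subseteq> FUL k (Some f)" by (rule FUL_add_oracle)
  assume f: "f \<in> FUL k None"
  show "FUL k (Some f) \<subseteq> FUL k None" by (rule FUL_eliminate_oracle[OF assms f])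
  show "ModL k (Some f) \<subseteq> ModL k None"
  proof
    fix A assume "A \<in> ModL k (Some f)"
    then obtain \<phi> where \<phi>: "\<phi> \<in> SharpL (Some f)" "\<forall>x. x \<in> A \<longleftrightarrow> \<not> [\<phi> x = 0] (mod k)" by (auto simp: ModL_def)
    obtain \<psi> where "\<psi> \<in> SharpL None" "\<And>x. [\<psi> x = \<phi> x] (mod k)"
      using SharpL_eliminate_oracle[OF assms f \<phi>(1)] by blast
    with \<phi>(2) show "A \<in> ModL k None" unfolding ModL_def cong_def by (intro CollectI conjI bexI[of _ \<psi>]) auto
  qed
  show "coModL k (Some f) \<subseteq> coModL k None"
  proof
    fix A assume "A \<in> coModL k (Some f)"
    then obtain \<phi> where \<phi>: "\<phi> \<in> SharpL (Some f)" "\<forall>x. x \<in> A \<longleftrightarrow> [\<phi> x = 0] (mod k)" by (auto simp: coModL_def)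
    obtain \<psi> where "\<psi> \<in> SharpL None" "\<And>x. [\<psi> x = \<phi> x] (mod k)"
      using SharpL_eliminate_oracle[OF assms f \<phi>(1)] by blast
    with \<phi>(2) show "A \<in> coModL k None" unfolding coModL_def cong_def by (intro CollectI conjI bexI[of _ \<psi>]) auto
  qed
  show "SharpModL k (Some f) \<subseteq> SharpModL k None"
  proof
    fix g assume "g \<in> SharpModL k (Some f)"
    then obtain \<phi> where \<phi>: "\<forall>x. g x < k" "\<phi> \<in> SharpL (Some f)" "\<forall>x. [g x = \<phi> x] (mod k)"
      by (auto simp: SharpModL_def)
    obtain \<psi> where "\<psi> \<in> SharpL None" "\<And>x. [\<psi> x = \<phi> x] (mod k)"
      using SharpL_eliminate_oracle[OF assms f \<phi>(2)] by blast
    with \<phi>(1,3) show "g \<in> SharpModL k None" unfolding SharpModL_def cong_def by (intro CollectI conjI bexI[of _ \<psi>]) auto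
  qed
qed

end
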